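(* Let $d\ge1$ be an integer and $\mathbf m=(m_1,\dots,m_d)\in\mathbb N^d$. Let $P,Q\in\mathbb Q$ with $\sqrt D$ irrational, and let $\chi_1,\dots,\chi_d$ be quadratic Dirichlet characters of the same modulus $q\ge2$. Then $\mathcal L_U^d(-\mathbf m\mid\chi)=\mathcal L_U^d(-m_1,\dots,-m_d\mid\chi_1,\dots,\chi_d)$ is rational valued except for the singularities (i.e. whenever $-\mathbf m$ is not a singularity of the meromorphically continued function, its value there is a rational number).
   Context: Standing assumptions: $P,Q$ are real numbers with $P>0$, $Q\ne 0$, $D:=P^2-4Q$, and $Q<P-1$ if $0<P\le 2$, $Q\le P-1$ if $P>2$. Let $\alpha,\beta$ be the roots of $x^2-Px+Q=0$, with $\alpha=(P+\sqrt D)/2$, $\beta=(P-\sqrt D)/2$, and let $U_n=(\alpha^n-\beta^n)/(\alpha-\beta)$ for $n\ge 0$ (Lucas sequence of the first kind). $\mathbb N$ denotes the positive integers. The multiple Lucas $L$-function of depth $d$ is the meromorphic continuation to $\mathbb C^d$ of $$\mathcal L_U^d(s_1,\dots,s_d\mid\chi_1,\dots,\chi_d):=\sum_{0<n_1<\cdots<n_d}\frac{\chi_1(n_1)}{U_{n_1}^{s_1}}\cdots\frac{\chi_d(n_d)}{U_{n_d}^{s_d}},$$ which converges absolutely for $(s_1,\dots,s_d)\in\mathbb C^d$ with $\sum_{i=j}^d\mathrm{Re}(s_i)>0$ for $1\le j\le d$. *)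

theory Defs
  imports "HOL-Analysis.Analysis"
begin

definition lucas_disc :: "real \<Rightarrow> real \<Rightarrow> real" where
  "lucas_disc P Q = P\<^sup>2 - 4 * Q"

text \<open>The condition below forces the discriminant to be positive, so the roots of
  \<open>x\<^sup>2 - P x + Q\<close> are real and distinct, and \<open>\<bar>\<beta>\<bar> < \<alpha>\<close>, \<open>1 < \<alpha>\<close>.\<close>

definition lucas_admissible :: "real \<Rightarrow> real \<Rightarrow> bool" where
  "lucas_admissible P Q \<longleftrightarrow>
     P > 0 \<and> Q \<noteq> 0 \<and> (P \<le> 2 \<longrightarrow> Q < P - 1) \<and> (P > 2 \<longrightarrow> Q \<le> P - 1)"

definition lucas_alpha :: "real \<Rightarrow> real \<Rightarrow> real" where
  "lucas_alpha P Q = (P + sqrt (lucas_disc P Q)) / 2"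

definition lucas_beta :: "real \<Rightarrow> real \<Rightarrow> real" where
  "lucas_beta P Q = (P - sqrt (lucas_disc P Q)) / 2"

definition lucas_U :: "real \<Rightarrow> real \<Rightarrow> nat \<Rightarrow> real" where
  "lucas_U P Q n =
     (lucas_alpha P Q ^ n - lucas_beta P Q ^ n) / (lucas_alpha P Q - lucas_beta P Q)"

definition dirichlet_character :: "nat \<Rightarrow> (nat \<Rightarrow> complex) \<Rightarrow> bool" where
  "dirichlet_character q \<psi> \<longleftrightarrow>
     (\<forall>n. \<psi> (n + q) = \<psi> n) \<and> (\<forall>m n. \<psi> (m * n) = \<psi> m * \<psi> n) \<and>
     (\<forall>n. \<psi> n \<noteq> 0 \<longleftrightarrow> coprime n q)"

text \<open>Quadratic means of order exactly two in the group of characters modulo \<open>q\<close>;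
  the principal character is not quadratic.\<close>

definition quadratic_character :: "nat \<Rightarrow> (nat \<Rightarrow> complex) \<Rightarrow> bool" where
  "quadratic_character q \<psi> \<longleftrightarrow> dirichlet_character q \<psi> \<and>
     (\<forall>n. coprime n q \<longrightarrow> (\<psi> n)\<^sup>2 = 1) \<and> (\<exists>n. coprime n q \<and> \<psi> n \<noteq> 1)"

text \<open>Holomorphy in several variables, for open \<open>A\<close>: the Frechet derivative exists and is
  complex linear.\<close>

definition holomorphic_multi_on :: "(complex ^ 'd \<Rightarrow> complex) \<Rightarrow> (complex ^ 'd) set \<Rightarrow> bool" where
  "holomorphic_multi_on f A \<longleftrightarrow>
     (\<forall>z\<in>A. \<exists>f'. (f has_derivative f') (at z) \<and> (\<forall>c v. f' (c *s v) = c * f' v))"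

definition holomorphic_multi_at :: "(complex ^ 'd \<Rightarrow> complex) \<Rightarrow> complex ^ 'd \<Rightarrow> bool" where
  "holomorphic_multi_at f z \<longleftrightarrow> (\<exists>W. open W \<and> z \<in> W \<and> holomorphic_multi_on f W)"

text \<open>Meromorphic means locally a quotient \<open>g / h\<close> of holomorphic functions, where the zero
  set of \<open>h\<close> has empty interior.  Nothing is said about the value of \<open>f\<close> where \<open>h\<close> vanishes.\<close>

definition meromorphic_multi_on :: "(complex ^ 'd \<Rightarrow> complex) \<Rightarrow> (complex ^ 'd) set \<Rightarrow> bool" where
  "meromorphic_multi_on f S \<longleftrightarrow>
     (\<forall>z\<in>S. \<exists>W g h. open W \<and> z \<in> W \<and>
        holomorphic_multi_on g W \<and> holomorphic_multi_on h W \<and>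
        W \<subseteq> closure {w \<in> W. h w \<noteq> 0} \<and>
        (\<forall>w\<in>W. h w \<noteq> 0 \<longrightarrow> f w = g w / h w))"

text \<open>A point is singular if \<open>f\<close> has no holomorphic extension there; these are the poles
  and the points of indeterminacy.  For meromorphic \<open>f\<close>, agreement with a holomorphic \<open>\<phi>\<close>
  on a dense subset of \<open>W\<close> is the same as \<open>g = \<phi> h\<close> near each point of \<open>W\<close>, for every local
  representation \<open>g / h\<close> of \<open>f\<close>.\<close>

definition singularity_multi :: "(complex ^ 'd \<Rightarrow> complex) \<Rightarrow> complex ^ 'd \<Rightarrow> bool" where
  "singularity_multi f z \<longleftrightarrow>
     \<not> (\<exists>W \<phi>. open W \<and> z \<in> W \<and> holomorphic_multi_on \<phi> W \<and>
          W \<subseteq> closure {w \<in> W. f w = \<phi> w})"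

text \<open>A meromorphic function as a total function, normalised as for \<open>nicely_meromorphic_on\<close>
  in one variable: removable singularities have been removed, and the value at each singular
  point is \<open>0\<close>.  By the identity theorem, this determines the function from its values on any
  nonempty open subset of a connected open \<open>S\<close>.\<close>

definition nicely_meromorphic_multi_on ::
    "(complex ^ 'd \<Rightarrow> complex) \<Rightarrow> (complex ^ 'd) set \<Rightarrow> bool" where
  "nicely_meromorphic_multi_on f S \<longleftrightarrow> meromorphic_multi_on f S \<and>
     (\<forall>z\<in>S. if singularity_multi f z then f z = 0 else holomorphic_multi_at f z)"

text \<open>The index type \<open>'d\<close>, a finite linear order, plays the role of \<open>{1, \<dots>, d}\<close>; its
  cardinality is the depth.\<close>

definition lucas_L_region :: "(complex ^ 'd::{finite,linorder}) set" where
  "lucas_L_region = {s. \<forall>j. (\<Sum>i\<in>{j..}. Re (s $ i)) > 0}"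

definition lucas_L_series ::
    "real \<Rightarrow> real \<Rightarrow> ('d::{finite,linorder} \<Rightarrow> nat \<Rightarrow> complex) \<Rightarrow> complex ^ 'd::{finite,linorder} \<Rightarrow> complex" where
  "lucas_L_series P Q \<psi> s =
     (\<Sum>\<^sub>\<infinity>n\<in>{n :: 'd \<Rightarrow> nat. strict_mono n \<and> (\<forall>i. 0 < n i)}.
        \<Prod>i\<in>UNIV. \<psi> i (n i) / complex_of_real (lucas_U P Q (n i)) powr (s $ i))"

definition multiple_lucas_L ::
    "real \<Rightarrow> real \<Rightarrow> ('d::{finite,linorder} \<Rightarrow> nat \<Rightarrow> complex) \<Rightarrow> complex ^ 'd::{finite,linorder} \<Rightarrow> complex" where
  "multiple_lucas_L P Q \<psi> =
     (SOME F. nicely_meromorphic_multi_on F UNIV \<and>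
        (\<forall>s\<in>lucas_L_region. F s = lucas_L_series P Q \<psi> s))"

end

theory Submission
  imports Defs "HOL-Complex_Analysis.Complex_Analysis"
begin

text \<open>
  Write \<open>\<rho> = \<beta> / \<alpha>\<close>.  Expanding each \<open>U\<^sub>n powr (- s)\<close> by the binomial series and summing over the
  gaps of \<open>n\<^sub>1 < \<dots> < n\<^sub>d\<close> turns the series into a sum over \<open>k \<in> \<nat>\<^sup>d\<close> of
  \<open>(\<Prod>\<^sub>i binom (s\<^sub>i + k\<^sub>i - 1) k\<^sub>i) * R (y\<^sub>1, \<dots>, y\<^sub>d)\<close>, where \<open>y\<^sub>l = \<Prod>\<^sub>i\<^sub>\<ge>\<^sub>l \<alpha> powr (- s\<^sub>i) * \<rho> ^ k\<^sub>i\<close> and \<open>R\<close> is a fixed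
  rational combination of the products \<open>\<Prod>\<^sub>l y\<^sub>l ^ b\<^sub>l / (1 - y\<^sub>l ^ q)\<close>, \<open>1 \<le> b\<^sub>l \<le> q\<close>.  This sum is
  the meromorphic continuation.

  At \<open>s = - m\<close> every coefficient with some \<open>k\<^sub>i > m\<^sub>i\<close> vanishes, but a term may have a pole there.
  The key point is that at a nonsingular \<open>- m\<close> no term has one.  If \<open>y\<^sub>l ^ q = 1\<close> passes through
  \<open>- m\<close>, clear denominators and follow the complex line inside that divisor from \<open>- m\<close> to a point
  where all \<open>y\<^sub>j\<close>, for one single \<open>k\<close>, are prescribed \<open>q\<close>-th roots of unity.  The cleared function is
  zero near \<open>- m\<close>, hence zero at the end point, where only that \<open>k\<close> contributes.  So all Fourier
  coefficients of the residue of \<open>R\<close> vanish, and with them the residue, for every \<open>k\<close> at once.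

  The value is then a finite sum in \<open>\<rat>(\<surd>D)\<close>.  Conjugation exchanges \<open>\<alpha>\<close> and \<open>\<beta>\<close>, that is, the terms
  of \<open>k\<close> and \<open>m - k\<close>, so the value is fixed by it and is rational.
\<close>

text \<open>There are infinitely many polar divisors, but on a ball \<open>tail_ratio\<close> decays
  like \<open>\<bar>\<rho>\<bar> ^ K\<close>, so only finitely many meet it. All identities are
  therefore stated on balls, multiplied by a finite product of denominators. As
  \<open>multiple_lucas_L\<close> is a choice that is known to agree with the explicit sum only on a
  dense set, its value is reached by continuity of both sides of such a cleared identity. If a polar
  divisor passes through - m, the cleared identity has a zero factor there and says nothing about
  the value. Vanishing residues repair this: the residue of \<open>y ^ b / (1 - y ^ q)\<close> at a
  root of unity e is proportional to \<open>e ^ b\<close>, so subtracting \<open>e ^ b\<close> from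
  \<open>y ^ b\<close> leaves the sum over b unchanged while the fraction becomes regular.
  Irrationality enters twice. Besides the final conjugation, it forces a polar exponent at - m to be
  half of the tail sum of m. This keeps the binomial coefficient at the end point of the line
  nonzero, and makes the polar terms their own mirror images under conjugation.\<close>

no_notation Infinite_Set_Sum.abs_summable_on (infix "abs'_summable'_on" 50)
no_notation fps_nth (infixl "$" 75)

section \<open>Holomorphic functions of several variables\<close>

lemma holomorphic_multi_on_subset:
  "holomorphic_multi_on f A \<Longrightarrow> B \<subseteq> A \<Longrightarrow> holomorphic_multi_on f B"
  unfolding holomorphic_multi_on_def by blast

lemma holomorphic_multi_on_continuous:
  assumes "holomorphic_multi_on f A"
  shows "continuous_on A f"
proof (intro continuous_at_imp_continuous_on ballI)
  fix x assume "x \<in> A"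
  then obtain f' where "(f has_derivative f') (at x)"
    using assms unfolding holomorphic_multi_on_def by blast
  then show "isCont f x"
    by (rule has_derivative_continuous)
qed

lemma holomorphic_multi_on_cong:
  assumes "open A" "\<And>z. z \<in> A \<Longrightarrow> f z = g z" "holomorphic_multi_on f A"
  shows "holomorphic_multi_on g A"
  unfolding holomorphic_multi_on_def
proof
  fix z assume z: "z \<in> A"
  then obtain f' where "(f has_derivative f') (at z)" "\<forall>c v. f' (c *s v) = c * f' v"
    using assms(3) unfolding holomorphic_multi_on_def by blast
  then show "\<exists>f'. (g has_derivative f') (at z) \<and> (\<forall>c v. f' (c *s v) = c * f' v)"
    using has_derivative_transform_within_open[of f _ z UNIV A g] assms(1,2) z by blast
qed

lemma holomorphic_multi_on_const: "holomorphic_multi_on (\<lambda>_. c) A"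
  unfolding holomorphic_multi_on_def by (auto intro!: exI[of _ "\<lambda>_. 0"])

lemma holomorphic_multi_on_component: "holomorphic_multi_on (\<lambda>s. s $ i) A"
  unfolding holomorphic_multi_on_def
  by (auto intro!: exI[of _ "\<lambda>h. h $ i"] bounded_linear_imp_has_derivative bounded_linear_vec_nth)

lemma holomorphic_multi_on_add:
  assumes "holomorphic_multi_on f A" "holomorphic_multi_on g A"
  shows "holomorphic_multi_on (\<lambda>z. f z + g z) A"
  unfolding holomorphic_multi_on_def
proof
  fix z assume z: "z \<in> A"
  obtain f' where f': "(f has_derivative f') (at z)" "\<forall>c v. f' (c *s v) = c * f' v"
    using assms(1) z unfolding holomorphic_multi_on_def by blast
  obtain g' where g': "(g has_derivative g') (at z)" "\<forall>c v. g' (c *s v) = c * g' v"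
    using assms(2) z unfolding holomorphic_multi_on_def by blast
  show "\<exists>D. ((\<lambda>z. f z + g z) has_derivative D) (at z) \<and> (\<forall>c v. D (c *s v) = c * D v)"
    by (rule exI, rule conjI, rule has_derivative_add[OF f'(1) g'(1)])
       (use f'(2) g'(2) in \<open>simp add: algebra_simps\<close>)
qed

lemma holomorphic_multi_on_mult:
  assumes "holomorphic_multi_on f A" "holomorphic_multi_on g A"
  shows "holomorphic_multi_on (\<lambda>z. f z * g z) A"
  unfolding holomorphic_multi_on_def
proof
  fix z assume z: "z \<in> A"
  obtain f' where f': "(f has_derivative f') (at z)" "\<forall>c v. f' (c *s v) = c * f' v"
    using assms(1) z unfolding holomorphic_multi_on_def by blast
  obtain g' where g': "(g has_derivative g') (at z)" "\<forall>c v. g' (c *s v) = c * g' v"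
    using assms(2) z unfolding holomorphic_multi_on_def by blast
  show "\<exists>D. ((\<lambda>z. f z * g z) has_derivative D) (at z) \<and> (\<forall>c v. D (c *s v) = c * D v)"
    by (rule exI, rule conjI, rule has_derivative_mult[OF f'(1) g'(1)])
       (use f'(2) g'(2) in \<open>simp add: algebra_simps\<close>)
qed

lemma holomorphic_multi_on_compose:
  assumes "holomorphic_multi_on g A"
    and "\<And>z. z \<in> A \<Longrightarrow> \<exists>D. (f has_field_derivative D) (at (g z))"
  shows "holomorphic_multi_on (\<lambda>z. f (g z)) A"
  unfolding holomorphic_multi_on_def
proof
  fix z assume z: "z \<in> A"
  obtain g' where g': "(g has_derivative g') (at z)" "\<forall>c v. g' (c *s v) = c * g' v"
    using assms(1) z unfolding holomorphic_multi_on_def by blast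
  obtain D where D: "(f has_field_derivative D) (at (g z))"
    using assms(2) z by blast
  have "((\<lambda>z. f (g z)) has_derivative (\<lambda>x. D * g' x)) (at z)"
    using has_derivative_compose[OF g'(1), of f "(*) D"] D
    by (simp add: has_field_derivative_def)
  then show "\<exists>D. ((\<lambda>z. f (g z)) has_derivative D) (at z) \<and> (\<forall>c v. D (c *s v) = c * D v)"
    using g'(2) by (auto intro!: exI[of _ "\<lambda>x. D * g' x"])
qed

lemma holomorphic_multi_on_sum:
  assumes "\<And>i. i \<in> I \<Longrightarrow> holomorphic_multi_on (f i) A"
  shows "holomorphic_multi_on (\<lambda>z. \<Sum>i\<in>I. f i z) A"
  using assms
  by (induction I rule: infinite_finite_induct)
     (auto intro: holomorphic_multi_on_const holomorphic_multi_on_add)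

lemma holomorphic_multi_on_prod:
  assumes "\<And>i. i \<in> I \<Longrightarrow> holomorphic_multi_on (f i) A"
  shows "holomorphic_multi_on (\<lambda>z. \<Prod>i\<in>I. f i z) A"
  using assms
  by (induction I rule: infinite_finite_induct)
     (auto intro: holomorphic_multi_on_const holomorphic_multi_on_mult)

lemma holomorphic_multi_on_power:
  assumes "holomorphic_multi_on f A"
  shows "holomorphic_multi_on (\<lambda>z. f z ^ n) A"
  using assms by (induction n) (auto intro: holomorphic_multi_on_const holomorphic_multi_on_mult)

lemma holomorphic_multi_on_diff:
  assumes "holomorphic_multi_on f A" "holomorphic_multi_on g A"
  shows "holomorphic_multi_on (\<lambda>z. f z - g z) A"
  using holomorphic_multi_on_add[OF assms(1)
      holomorphic_multi_on_mult[OF holomorphic_multi_on_const[of "-1"] assms(2)]]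
  by simp

lemma holomorphic_multi_on_exp:
  assumes "holomorphic_multi_on f A"
  shows "holomorphic_multi_on (\<lambda>z. exp (f z)) A"
  by (rule holomorphic_multi_on_compose[OF assms]) (use DERIV_exp in blast)

lemma holomorphic_multi_on_divide:
  assumes "holomorphic_multi_on f A" "holomorphic_multi_on g A" "\<And>z. z \<in> A \<Longrightarrow> g z \<noteq> 0"
  shows "holomorphic_multi_on (\<lambda>z. f z / g z) A"
proof -
  have "holomorphic_multi_on (\<lambda>z. inverse (g z)) A"
    by (rule holomorphic_multi_on_compose[OF assms(2)]) (use DERIV_inverse assms(3) in blast)
  from holomorphic_multi_on_mult[OF assms(1) this] show ?thesis
    by (simp add: divide_inverse)
qed

lemmas holomorphic_multi_intros =
  holomorphic_multi_on_const holomorphic_multi_on_component holomorphic_multi_on_add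
  holomorphic_multi_on_diff holomorphic_multi_on_mult holomorphic_multi_on_sum
  holomorphic_multi_on_prod holomorphic_multi_on_power holomorphic_multi_on_exp

section \<open>Restriction to complex lines and the identity theorem\<close>

lemma norm_vector_smult:
  fixes v :: "complex ^ 'n::finite"
  shows "norm (c *s v) = norm c * norm v"
  by (simp add: norm_vec_def norm_mult L2_set_right_distrib)

lemma bounded_linear_vector_smult_left:
  "bounded_linear (\<lambda>t. t *s (v :: complex ^ 'n::finite))"
proof (rule bounded_linear_intro[where K = "norm v"])
  fix x y :: complex and r :: real
  show "(x + y) *s v = x *s v + y *s v" by (rule vector_sadd_rdistrib)
  show "(r *\<^sub>R x) *s v = r *\<^sub>R (x *s v)" by (simp add: vec_eq_iff)
  show "norm (x *s v) \<le> norm x * norm v" by (simp add: norm_vector_smult)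
qed

lemma holomorphic_multi_on_line:
  fixes f :: "complex ^ 'n::finite \<Rightarrow> complex"
  assumes "holomorphic_multi_on f A" "z + t *s v \<in> A"
    and f': "(f has_derivative f') (at (z + t *s v))" "\<And>c v. f' (c *s v) = c * f' v"
  shows "((\<lambda>t. f (z + t *s v)) has_field_derivative f' v) (at t)"
proof -
  have "((\<lambda>t. z + t *s v) has_derivative (\<lambda>h. h *s v)) (at t)"
    using has_derivative_add[OF has_derivative_const
        bounded_linear_imp_has_derivative[OF bounded_linear_vector_smult_left[of v]]]
    by simp
  from has_derivative_compose[OF this f'(1)]
  have "((\<lambda>t. f (z + t *s v)) has_derivative (\<lambda>h. f' (h *s v))) (at t)" .
  then show ?thesis
    by (simp add: f'(2) has_field_derivative_def mult.commute[of _ "f' v"])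
qed

lemma holomorphic_on_line:
  fixes f :: "complex ^ 'n::finite \<Rightarrow> complex"
  assumes "holomorphic_multi_on f A" "\<And>t. t \<in> T \<Longrightarrow> z + t *s v \<in> A"
  shows "(\<lambda>t. f (z + t *s v)) holomorphic_on T"
proof (rule holomorphic_onI)
  fix t assume "t \<in> T"
  then have t: "z + t *s v \<in> A" by (rule assms(2))
  then obtain f' where "(f has_derivative f') (at (z + t *s v))" "\<forall>c v. f' (c *s v) = c * f' v"
    using assms(1) unfolding holomorphic_multi_on_def by blast
  then have "((\<lambda>t. f (z + t *s v)) has_field_derivative f' v) (at t)"
    using holomorphic_multi_on_line[OF assms(1) t] by blast
  then show "(\<lambda>t. f (z + t *s v)) field_differentiable at t within T"
    using field_differentiable_at_within field_differentiable_def by blast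
qed

lemma continuous_on_line:
  fixes a v :: "complex ^ 'n::finite"
  shows "continuous_on A (\<lambda>t. a + t *s v)"
  by (intro continuous_on_add continuous_on_const
      linear_continuous_on bounded_linear_vector_smult_left)

text \<open>The part of the complex line through \<open>a\<close> and \<open>w\<close> inside a
  convex set is a convex domain of the parameter t, so the identity theorem in one variable applies.
  Zeros are required on this line only; that allows an application inside a polar divisor, where
  nothing is known on an open set.\<close>

lemma holomorphic_multi_zero_on_line:
  fixes f :: "complex ^ 'n::finite \<Rightarrow> complex"
  assumes f: "holomorphic_multi_on f B" and B: "open B" "convex B" and "a \<in> B" "w \<in> B"
    and "\<delta> > 0" and zero: "\<And>t. norm t < \<delta> \<Longrightarrow> f (a + t *s (w - a)) = 0"
  shows "f w = 0"
proof -
  define l where "l = (\<lambda>t::complex. a + t *s (w - a))"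
  define T where "T = l -` B"
  have conv: "convex T"
  proof (rule convexI)
    fix x y :: complex and u v :: real
    assume xy: "x \<in> T" "y \<in> T" and uv: "0 \<le> u" "0 \<le> v" "u + v = 1"
    have u: "u = 1 - v" using uv(3) by simp
    have "l (u *\<^sub>R x + v *\<^sub>R y) $ i = (u *\<^sub>R l x + v *\<^sub>R l y) $ i" for i
      unfolding l_def u by (simp add: scaleR_conv_of_real[where 'a = complex] algebra_simps)
    then have "l (u *\<^sub>R x + v *\<^sub>R y) = u *\<^sub>R l x + v *\<^sub>R l y"
      by (simp add: vec_eq_iff)
    moreover have "u *\<^sub>R l x + v *\<^sub>R l y \<in> B"
      using xy uv B(2) unfolding T_def convex_def by auto
    ultimately show "u *\<^sub>R x + v *\<^sub>R y \<in> T" by (simp add: T_def)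
  qed
  have opT: "open T"
    unfolding T_def l_def using continuous_on_line B(1) by (rule open_vimage[rotated])
  have 0: "0 \<in> T" and 1: "1 \<in> T"
    using assms(4,5) by (auto simp: T_def l_def)
  have hol: "(\<lambda>t. f (a + t *s (w - a))) holomorphic_on T"
    by (rule holomorphic_on_line[OF f]) (simp add: T_def l_def)
  have "(\<lambda>t. f (a + t *s (w - a))) 1 = (0::complex)"
  proof (rule analytic_continuation[OF hol opT convex_connected[OF conv], of "ball 0 \<delta> \<inter> T" 0])
    show "0 islimpt ball 0 \<delta> \<inter> T"
      by (rule interior_limit_point)
         (use 0 \<open>\<delta> > 0\<close> opT in \<open>simp add: interior_open open_Int\<close>)
  qed (use 0 1 zero in \<open>auto simp: dist_norm\<close>)
  then show ?thesis by simp
qed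

lemma holomorphic_multi_zero_convex:
  fixes f :: "complex ^ 'n::finite \<Rightarrow> complex"
  assumes f: "holomorphic_multi_on f B" and B: "open B" "convex B"
    and U: "open U" "U \<inter> B \<noteq> {}" and zero: "\<And>z. z \<in> U \<inter> B \<Longrightarrow> f z = 0" and "w \<in> B"
  shows "f w = 0"
proof -
  obtain a where a: "a \<in> U \<inter> B" using U by blast
  have "open ((\<lambda>t::complex. a + t *s (w - a)) -` (U \<inter> B))"
    using continuous_on_line by (rule open_vimage[rotated]) (use U B in blast)
  moreover have "0 \<in> (\<lambda>t::complex. a + t *s (w - a)) -` (U \<inter> B)"
    using a by simp
  ultimately obtain \<delta> where "\<delta> > 0" "ball 0 \<delta> \<subseteq> (\<lambda>t::complex. a + t *s (w - a)) -` (U \<inter> B)"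
    using open_contains_ball by blast
  then have "\<And>t. norm t < \<delta> \<Longrightarrow> f (a + t *s (w - a)) = 0"
    using zero by (force simp: subset_iff dist_norm)
  then show ?thesis
    using holomorphic_multi_zero_on_line[OF f B _ \<open>w \<in> B\<close> \<open>\<delta> > 0\<close>] a by blast
qed

text \<open>The source of all density statements about denominators: one nonzero value on a ball is
  enough.\<close>

lemma holomorphic_multi_nonzero_dense:
  fixes f :: "complex ^ 'n::finite \<Rightarrow> complex"
  assumes "holomorphic_multi_on f B" "open B" "convex B" "w \<in> B" "f w \<noteq> 0"
  shows "B \<subseteq> closure {z \<in> B. f z \<noteq> 0}"
proof
  fix z assume "z \<in> B"
  show "z \<in> closure {z \<in> B. f z \<noteq> 0}"
  proof (rule ccontr)
    assume "z \<notin> closure {z \<in> B. f z \<noteq> 0}"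
    then have "f w = 0"
    proof (intro holomorphic_multi_zero_convex[OF assms(1-3) _ _ _ assms(4)])
      show "open (- closure {z \<in> B. f z \<noteq> 0})" by (rule open_Compl[OF closed_closure])
      show "f u = 0" if "u \<in> - closure {z \<in> B. f z \<noteq> 0} \<inter> B" for u
        using that closure_subset[of "{z \<in> B. f z \<noteq> 0}"] by blast
    qed (use \<open>z \<in> B\<close> in blast)
    then show False using assms(5) by simp
  qed
qed

section \<open>Cauchy estimates and sums of holomorphic functions\<close>

lemma holomorphic_multi_derivative_bound:
  fixes f :: "complex ^ 'n::finite \<Rightarrow> complex"
  assumes f: "holomorphic_multi_on f (ball z (2 * r))" and "r > 0"
    and bd: "\<And>w. w \<in> ball z (2 * r) \<Longrightarrow> norm (f w) \<le> M"
    and w: "w \<in> ball z r"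
    and f': "(f has_derivative f') (at w)" "\<And>c v. f' (c *s v) = c * f' v"
  shows "norm (f' v) \<le> (2 * M / r) * norm v"
proof (cases "v = 0")
  case True
  then show ?thesis using f'(2)[of 0 0] by simp
next
  case False
  then have nv: "norm v > 0" by simp
  \<comment> \<open>With this radius \<open>t *s v\<close> has norm at most r / 2, so the disc
    around \<open>w\<close> stays inside the ball of radius 2 r; Cauchy's inequality on it gives the
    bound.\<close>
  define \<rho> where "\<rho> = r / (2 * norm v)"
  have \<rho>: "\<rho> > 0" using nv \<open>r > 0\<close> by (simp add: \<rho>_def)
  have sub: "w + t *s v \<in> ball z (2 * r)" if "norm t \<le> \<rho>" for t
  proof -
    have "norm (t *s v) \<le> \<rho> * norm v"
      unfolding norm_vector_smult by (rule mult_right_mono[OF that]) simp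
    also have "\<dots> = r / 2" using nv by (simp add: \<rho>_def)
    finally have "norm (t *s v) < r" using \<open>r > 0\<close> by simp
    moreover have "norm (w - z) < r" using w by (simp add: dist_norm norm_minus_commute)
    moreover have "dist z (w + t *s v) \<le> norm (w - z) + norm (t *s v)"
      using norm_triangle_ineq[of "w - z" "t *s v"]
      by (simp add: dist_norm norm_minus_commute algebra_simps)
    ultimately show ?thesis by simp
  qed
  have hol: "(\<lambda>t. f (w + t *s v)) holomorphic_on cball 0 \<rho>"
    by (rule holomorphic_on_line[OF f]) (use sub in \<open>simp add: dist_norm\<close>)
  have D: "((\<lambda>t. f (w + t *s v)) has_field_derivative f' v) (at 0)"
    by (rule holomorphic_multi_on_line[OF f]) (use w f' \<open>r > 0\<close> in auto)
  have "norm ((deriv ^^ 1) (\<lambda>t. f (w + t *s v)) 0) \<le> fact 1 * M / \<rho> ^ 1"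
    by (rule Cauchy_inequality)
       (use hol \<rho> sub bd in \<open>auto intro: holomorphic_on_subset holomorphic_on_imp_continuous_on\<close>)
  then have "norm (f' v) \<le> M / \<rho>"
    using DERIV_imp_deriv[OF D] by simp
  then show ?thesis by (simp add: \<rho>_def mult_ac)
qed

text \<open>By the Cauchy estimate the majorant \<open>M\<close> also dominates the derivatives,
  uniformly on a smaller ball, so the series may be differentiated termwise; complex linearity
  passes to the sum.\<close>

lemma holomorphic_multi_on_suminf:
  fixes f :: "nat \<Rightarrow> complex ^ 'n::finite \<Rightarrow> complex"
  assumes f: "\<And>k. holomorphic_multi_on (f k) W" and "open W"
    and bd: "\<And>k z. z \<in> W \<Longrightarrow> norm (f k z) \<le> M k" and M: "summable M"
  shows "holomorphic_multi_on (\<lambda>z. \<Sum>k. f k z) W"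
  unfolding holomorphic_multi_on_def
proof
  fix z assume "z \<in> W"
  then obtain r0 where r0: "r0 > 0" "ball z r0 \<subseteq> W"
    using \<open>open W\<close> open_contains_ball by blast
  define r where "r = r0 / 2"
  have r: "r > 0" "ball z (2 * r) \<subseteq> W" using r0 by (auto simp: r_def)
  have "\<exists>F. \<forall>k. \<forall>w\<in>W. (f k has_derivative F k w) (at w) \<and> (\<forall>c v. F k w (c *s v) = c * F k w v)"
    using f unfolding holomorphic_multi_on_def by metis
  then obtain F where F: "\<And>k w. w \<in> W \<Longrightarrow> (f k has_derivative F k w) (at w)"
    "\<And>k w c v. w \<in> W \<Longrightarrow> F k w (c *s v) = c * F k w v" by blast
  have S: "ball z r \<subseteq> W" using r by (auto intro: order_trans[rotated])
  have bF: "norm (F k w v) \<le> (2 * M k / r) * norm v" if "w \<in> ball z r" for k w v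
    using holomorphic_multi_derivative_bound[OF holomorphic_multi_on_subset[OF f r(2)] r(1) bd that]
      F that S r(2) by blast
  have sM: "summable (\<lambda>k. 2 * M k / r)"
    using M by (intro summable_divide summable_mult)
  have sF: "summable (\<lambda>k. F k w v)" if "w \<in> ball z r" for w v
    by (rule summable_comparison_test'[OF summable_mult2[OF sM, of "norm v"]])
       (use bF[OF that] in auto)
  define G where "G w v = (\<Sum>k. F k w v)" for w v
  have "\<exists>g. \<forall>x\<in>ball z r. (\<lambda>n. f n x) sums g x \<and> (g has_derivative G x) (at x within ball z r)"
  proof (rule has_derivative_series)
    show "(f n has_derivative F n x) (at x within ball z r)" if "x \<in> ball z r" for n x
      using F(1) that S by (blast intro: has_derivative_at_withinI)
    show "z \<in> ball z r" using r by simp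
    show "(\<lambda>n. f n z) sums (\<Sum>n. f n z)"
      by (rule summable_sums[OF summable_comparison_test'[OF M]]) (use bd \<open>z \<in> W\<close> in auto)
    show "\<forall>\<^sub>F n in sequentially. \<forall>x\<in>ball z r. \<forall>h. norm ((\<Sum>i<n. F i x h) - G x h) \<le> e * norm h"
      if "e > 0" for e
    proof -
      have "(\<lambda>n. \<Sum>i. 2 * M (i + n) / r) \<longlonglongrightarrow> 0"
        using suminf_exist_split2[OF sM] .
      then have "\<forall>\<^sub>F n in sequentially. (\<Sum>i. 2 * M (i + n) / r) < e"
        using \<open>e > 0\<close> by (rule order_tendstoD(2))
      then show ?thesis
      proof (rule eventually_mono, intro ballI allI)
        fix n x and h :: "complex ^ 'n"
        assume n: "(\<Sum>i. 2 * M (i + n) / r) < e" and x: "x \<in> ball z r"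
        have sMn: "summable (\<lambda>i. 2 * M (i + n) / r * norm h)"
          using summable_mult2[OF sM[THEN summable_ignore_initial_segment[of _ n]], of "norm h"] .
        have "norm ((\<Sum>i<n. F i x h) - G x h) = norm (\<Sum>i. F (i + n) x h)"
          unfolding G_def suminf_minus_initial_segment[OF sF[OF x]] by (simp add: norm_minus_commute)
        also have "\<dots> \<le> (\<Sum>i. 2 * M (i + n) / r * norm h)"
          by (rule norm_suminf_le[OF _ sMn]) (use bF[OF x] in auto)
        also have "\<dots> = (\<Sum>i. 2 * M (i + n) / r) * norm h"
          by (rule suminf_mult2[symmetric])
             (rule summable_ignore_initial_segment[OF sM])
        also have "\<dots> \<le> e * norm h"
          using n by (intro mult_right_mono) auto
        finally show "norm ((\<Sum>i<n. F i x h) - G x h) \<le> e * norm h" .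
      qed
    qed
  qed simp_all
  then obtain g where g: "\<And>x. x \<in> ball z r \<Longrightarrow> (\<lambda>n. f n x) sums g x"
    "\<And>x. x \<in> ball z r \<Longrightarrow> (g has_derivative G x) (at x within ball z r)" by blast
  have zr: "z \<in> ball z r" using r by simp
  have "(g has_derivative G z) (at z)"
    using g(2)[OF zr] zr by (simp add: at_within_open[OF zr open_ball])
  then have "((\<lambda>z. \<Sum>k. f k z) has_derivative G z) (at z)"
    by (rule has_derivative_transform_within_open[OF _ open_ball zr])
       (use g(1) sums_unique in blast)
  moreover have "G z (c *s v) = c * G z v" for c v
    unfolding G_def using F(2)[OF \<open>z \<in> W\<close>] suminf_mult[OF sF[OF zr]] by simp
  ultimately show "\<exists>f'. ((\<lambda>z. \<Sum>k. f k z) has_derivative f') (at z) \<and> (\<forall>c v. f' (c *s v) = c * f' v)"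
    by blast
qed

lemma abs_summable_sums_infsum:
  fixes f :: "nat \<Rightarrow> complex"
  assumes "summable (\<lambda>n. norm (f n))"
  shows "infsum f UNIV = (\<Sum>n. f n)"
  using infsumI[OF norm_summable_imp_has_sum[OF assms summable_sums[OF summable_norm_cancel[OF assms]]]] .

lemma holomorphic_multi_on_infsum:
  fixes f :: "'a::countable \<Rightarrow> complex ^ 'n::finite \<Rightarrow> complex"
  assumes f: "\<And>k. holomorphic_multi_on (f k) W" and "open W" and inf: "infinite (UNIV :: 'a set)"
    and bd: "\<And>k z. z \<in> W \<Longrightarrow> norm (f k z) \<le> M k" and M: "M summable_on UNIV"
  shows "holomorphic_multi_on (\<lambda>z. \<Sum>\<^sub>\<infinity>k. f k z) W"
proof -
  obtain e :: "nat \<Rightarrow> 'a" where e: "bij_betw e UNIV UNIV"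
    using bij_betw_from_nat_into[OF _ inf] by auto
  have "(M \<circ> e) summable_on UNIV"
    using M e summable_on_reindex[of e UNIV M] by (simp add: bij_betw_def)
  then have sM: "summable (\<lambda>n. M (e n))"
    using summable_on_imp_summable by (simp add: comp_def)
  have "holomorphic_multi_on (\<lambda>z. \<Sum>n. f (e n) z) W"
    by (rule holomorphic_multi_on_suminf[OF f \<open>open W\<close> bd sM])
  then show ?thesis
  proof (rule holomorphic_multi_on_cong[OF \<open>open W\<close>, rotated])
    fix z assume z: "z \<in> W"
    have "summable (\<lambda>n. norm (f (e n) z))"
      by (rule summable_comparison_test'[OF sM]) (use bd[OF z] in auto)
    then show "(\<Sum>n. f (e n) z) = (\<Sum>\<^sub>\<infinity>k. f k z)"
      using abs_summable_sums_infsum infsum_reindex_bij_betw[OF e, of "\<lambda>k. f k z"] by metis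
  qed
qed

section \<open>Meromorphic functions of several variables\<close>

text \<open>The form in which both \<open>meromorphic_multi_on\<close> and
  \<open>singularity_multi\<close> express density.\<close>

definition dense_on :: "'a::topological_space set \<Rightarrow> ('a \<Rightarrow> bool) \<Rightarrow> bool" where
  "dense_on W P \<longleftrightarrow> W \<subseteq> closure {w \<in> W. P w}"

lemma dense_on_mono: "dense_on W P \<Longrightarrow> (\<And>w. w \<in> W \<Longrightarrow> P w \<Longrightarrow> Q w) \<Longrightarrow> dense_on W Q"
  unfolding dense_on_def by (rule order_trans) (auto intro!: closure_mono)

lemma dense_on_subset:
  assumes "dense_on W P" "open V" "V \<subseteq> W"
  shows "dense_on V P"
proof -
  have "V \<subseteq> V \<inter> closure {w \<in> W. P w}"
    using assms unfolding dense_on_def by blast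
  also have "\<dots> \<subseteq> closure (V \<inter> {w \<in> W. P w})"
    by (rule open_Int_closure_subset[OF \<open>open V\<close>])
  also have "V \<inter> {w \<in> W. P w} = {w \<in> V. P w}" using assms(3) by blast
  finally show ?thesis unfolding dense_on_def .
qed

text \<open>Two dense sets may be disjoint; openness of the first lets the density of the second be
  used inside it.\<close>

lemma dense_on_conj:
  assumes "dense_on W P" "dense_on W Q" "open {w \<in> W. P w}"
  shows "dense_on W (\<lambda>w. P w \<and> Q w)"
proof -
  have "dense_on {w \<in> W. P w} Q"
    by (rule dense_on_subset[OF assms(2,3)]) blast
  then have "{w \<in> W. P w} \<subseteq> closure {w \<in> W. P w \<and> Q w}"
    unfolding dense_on_def by (simp add: conj_assoc)
  then show ?thesis
    using assms(1) closure_minimal[OF _ closed_closure] unfolding dense_on_def by blast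
qed

lemma dense_on_nonempty: "dense_on W P \<Longrightarrow> W \<noteq> {} \<Longrightarrow> \<exists>w\<in>W. P w"
  unfolding dense_on_def by (metis (mono_tags, lifting) closure_empty empty_Collect_eq subset_empty)

lemma open_nonzero:
  fixes f :: "'a::topological_space \<Rightarrow> complex"
  assumes "open W" "continuous_on W f"
  shows "open {w \<in> W. f w \<noteq> 0}"
proof -
  have "{w \<in> W. f w \<noteq> 0} = W \<inter> f -` (- {0})" by auto
  then show ?thesis
    using continuous_open_preimage[OF assms(2,1), of "- {0}"] by (simp add: open_Compl)
qed

lemma dense_on_eq:
  fixes f g :: "'a::topological_space \<Rightarrow> complex"
  assumes "open W" "continuous_on W f" "continuous_on W g" "dense_on W (\<lambda>w. f w = g w)" "z \<in> W"
  shows "f z = g z"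
proof (rule ccontr)
  assume neq: "f z \<noteq> g z"
  let ?V = "{w \<in> W. f w - g w \<noteq> 0}"
  have "open ?V"
    by (rule open_nonzero) (use assms in \<open>auto intro: continuous_on_diff\<close>)
  then have "dense_on ?V (\<lambda>w. f w = g w)"
    by (rule dense_on_subset[OF assms(4)]) blast
  then have "\<exists>w\<in>?V. f w = g w"
    by (rule dense_on_nonempty) (use neq assms(5) in auto)
  then show False by auto
qed

lemma meromorphic_multi_onE:
  assumes "meromorphic_multi_on f S" "z \<in> S"
  obtains W g h where "open W" "z \<in> W" "holomorphic_multi_on g W" "holomorphic_multi_on h W"
    "dense_on W (\<lambda>w. h w \<noteq> 0)" "\<And>w. w \<in> W \<Longrightarrow> h w \<noteq> 0 \<Longrightarrow> f w = g w / h w"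
    "open {w \<in> W. h w \<noteq> 0}"
proof -
  obtain W g h where **: "open W \<and> z \<in> W \<and> holomorphic_multi_on g W \<and> holomorphic_multi_on h W \<and>
      W \<subseteq> closure {w \<in> W. h w \<noteq> 0} \<and> (\<forall>w\<in>W. h w \<noteq> 0 \<longrightarrow> f w = g w / h w)"
    using assms(1)[unfolded meromorphic_multi_on_def, rule_format, OF assms(2)]
    by (elim exE) (rule that)
  then have *: "open W" "z \<in> W" "holomorphic_multi_on g W" "holomorphic_multi_on h W"
    "dense_on W (\<lambda>w. h w \<noteq> 0)" "\<And>w. w \<in> W \<Longrightarrow> h w \<noteq> 0 \<Longrightarrow> f w = g w / h w"
    unfolding dense_on_def by simp_all
  show ?thesis
    by (rule that[OF *(1-6) open_nonzero[OF *(1) holomorphic_multi_on_continuous[OF *(4)]]])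
qed

text \<open>Agreement is claimed on a dense set only, because the values at zeros of the local
  denominators are arbitrary.\<close>

theorem meromorphic_multi_identity:
  fixes f1 f2 :: "complex ^ 'n::finite \<Rightarrow> complex"
  assumes f1: "meromorphic_multi_on f1 UNIV" and f2: "meromorphic_multi_on f2 UNIV"
    and U: "open U" "U \<noteq> {}" "\<And>z. z \<in> U \<Longrightarrow> f1 z = f2 z"
  shows "dense_on UNIV (\<lambda>w. f1 w = f2 w)"
proof -
  let ?E = "{w. f1 w = f2 w}"
  \<comment> \<open>Taking the interior makes \<open>A\<close> open by construction; the local
    fractions will show that it is closed as well.\<close>
  define A where "A = interior (closure ?E)"
  have opA: "open A" by (simp add: A_def)
  have denA: "dense_on A (\<lambda>w. f1 w = f2 w)"
  proof -
    have "A \<subseteq> closure ?E" by (simp add: A_def interior_subset)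
    then have "A \<subseteq> A \<inter> closure ?E" by blast
    also have "\<dots> \<subseteq> closure (A \<inter> ?E)" by (rule open_Int_closure_subset[OF opA])
    finally show ?thesis unfolding dense_on_def by (simp add: Collect_conj_eq)
  qed
  have "U \<subseteq> A"
    unfolding A_def by (rule interior_maximal) (use U closure_subset[of ?E] in blast)+
  then have neA: "A \<noteq> {}" using U by blast
  have "closure A \<subseteq> A"
  proof
    fix z assume z: "z \<in> closure A"
    obtain W1 g1 h1 where 1: "open W1" "z \<in> W1" "holomorphic_multi_on g1 W1"
      "holomorphic_multi_on h1 W1" "dense_on W1 (\<lambda>w. h1 w \<noteq> 0)"
      "\<And>w. w \<in> W1 \<Longrightarrow> h1 w \<noteq> 0 \<Longrightarrow> f1 w = g1 w / h1 w"
      by (rule meromorphic_multi_onE[OF f1 UNIV_I[of z]]) (rule that)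
    obtain W2 g2 h2 where 2: "open W2" "z \<in> W2" "holomorphic_multi_on g2 W2"
      "holomorphic_multi_on h2 W2" "dense_on W2 (\<lambda>w. h2 w \<noteq> 0)"
      "\<And>w. w \<in> W2 \<Longrightarrow> h2 w \<noteq> 0 \<Longrightarrow> f2 w = g2 w / h2 w"
      by (rule meromorphic_multi_onE[OF f2 UNIV_I[of z]]) (rule that)
    obtain r where r: "r > 0" "ball z r \<subseteq> W1 \<inter> W2"
      using 1(1,2) 2(1,2) open_contains_ball[of "W1 \<inter> W2"] by blast
    let ?b = "ball z r"
    have hol: "holomorphic_multi_on g1 ?b" "holomorphic_multi_on h1 ?b"
      "holomorphic_multi_on g2 ?b" "holomorphic_multi_on h2 ?b"
      using holomorphic_multi_on_subset[OF 1(3)] holomorphic_multi_on_subset[OF 1(4)]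
        holomorphic_multi_on_subset[OF 2(3)] holomorphic_multi_on_subset[OF 2(4)] r by auto
    have d1: "dense_on ?b (\<lambda>w. h1 w \<noteq> 0)" and d2: "dense_on ?b (\<lambda>w. h2 w \<noteq> 0)"
      using dense_on_subset[OF 1(5)] dense_on_subset[OF 2(5)] r by auto
    have o1: "open {w \<in> ?b. h1 w \<noteq> 0}"
      by (rule open_nonzero[OF open_ball holomorphic_multi_on_continuous[OF hol(2)]])
    have o2: "open {w \<in> ?b. h2 w \<noteq> 0}"
      by (rule open_nonzero[OF open_ball holomorphic_multi_on_continuous[OF hol(4)]])
    have d: "dense_on ?b (\<lambda>w. h1 w \<noteq> 0 \<and> h2 w \<noteq> 0)"
      by (rule dense_on_conj[OF d1 d2 o1])
    have "{w \<in> ?b. h1 w \<noteq> 0 \<and> h2 w \<noteq> 0} = {w \<in> ?b. h1 w \<noteq> 0} \<inter> {w \<in> ?b. h2 w \<noteq> 0}" by blast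
    then have o: "open {w \<in> ?b. h1 w \<noteq> 0 \<and> h2 w \<noteq> 0}" using o1 o2 by (simp add: open_Int)
    \<comment> \<open>The cross-multiplied difference is holomorphic on the whole ball, so its
      vanishing spreads from \<open>A\<close> to the ball.\<close>
    let ?\<phi> = "\<lambda>w. g1 w * h2 w - g2 w * h1 w"
    have h\<phi>: "holomorphic_multi_on ?\<phi> ?b"
      using hol by (intro holomorphic_multi_intros)
    have opb: "open (A \<inter> ?b)" using opA by (simp add: open_Int)
    have "dense_on (A \<inter> ?b) (\<lambda>w. (h1 w \<noteq> 0 \<and> h2 w \<noteq> 0) \<and> f1 w = f2 w)"
    proof (rule dense_on_conj)
      show "dense_on (A \<inter> ?b) (\<lambda>w. h1 w \<noteq> 0 \<and> h2 w \<noteq> 0)"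
        by (rule dense_on_subset[OF d opb]) blast
      show "dense_on (A \<inter> ?b) (\<lambda>w. f1 w = f2 w)"
        by (rule dense_on_subset[OF denA opb]) blast
      have "{w \<in> A \<inter> ?b. h1 w \<noteq> 0 \<and> h2 w \<noteq> 0} = A \<inter> {w \<in> ?b. h1 w \<noteq> 0 \<and> h2 w \<noteq> 0}" by blast
      then show "open {w \<in> A \<inter> ?b. h1 w \<noteq> 0 \<and> h2 w \<noteq> 0}" using o opA by (simp add: open_Int)
    qed
    then have "dense_on (A \<inter> ?b) (\<lambda>w. ?\<phi> w = 0)"
    proof (rule dense_on_mono)
      fix w assume w: "w \<in> A \<inter> ?b" and *: "(h1 w \<noteq> 0 \<and> h2 w \<noteq> 0) \<and> f1 w = f2 w"
      have "w \<in> W1" "w \<in> W2" using w r by auto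
      then have "g1 w / h1 w = g2 w / h2 w" using * 1(6) 2(6) by metis
      then show "?\<phi> w = 0" using * by (simp add: field_simps)
    qed
    then have z0: "?\<phi> w = 0" if "w \<in> A \<inter> ?b" for w
      using dense_on_eq[OF opb _ continuous_on_const _ that]
        continuous_on_subset[OF holomorphic_multi_on_continuous[OF h\<phi>]] by blast
    have "A \<inter> ?b \<noteq> {}" using z r(1) by (metis closure_iff_nhds_not_empty centre_in_ball open_ball subset_refl inf_commute)
    then have z1: "?\<phi> w = 0" if "w \<in> ?b" for w
      using holomorphic_multi_zero_convex[OF h\<phi> open_ball convex_ball opA] z0 that by blast
    have "dense_on ?b (\<lambda>w. f1 w = f2 w)"
    proof (rule dense_on_mono[OF d])
      fix w assume w: "w \<in> ?b" and *: "h1 w \<noteq> 0 \<and> h2 w \<noteq> 0"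
      have "w \<in> W1" "w \<in> W2" using w r by auto
      then show "f1 w = f2 w"
        using * 1(6)[of w] 2(6)[of w] z1[OF w] by (simp add: frac_eq_eq)
    qed
    then have "?b \<subseteq> closure ?E"
      unfolding dense_on_def by (rule order_trans) (auto intro!: closure_mono)
    then have "?b \<subseteq> A"
      unfolding A_def by (rule interior_maximal[OF _ open_ball])
    then show "z \<in> A" using r(1) by auto
  qed
  then have "closed A" using closure_subset[of A] closure_eq[of A] by blast
  then have "A = UNIV" using opA neA clopen[of A] by blast
  with denA show ?thesis by simp
qed

text \<open>Near \<open>z\<close> both extensions, multiplied by a local denominator of
  \<open>f\<close>, equal the numerator. Cancelling on the dense set where the denominator is
  nonzero leaves two continuous functions that agree densely.\<close>

lemma holomorphic_extension_unique:
  fixes f :: "complex ^ 'n::finite \<Rightarrow> complex"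
  assumes f: "meromorphic_multi_on f UNIV"
    and \<phi>: "open W" "holomorphic_multi_on \<phi> W" "dense_on W (\<lambda>w. f w = \<phi> w)"
    and \<phi>': "open W'" "holomorphic_multi_on \<phi>' W'" "dense_on W' (\<lambda>w. f w = \<phi>' w)"
    and z: "z \<in> W" "z \<in> W'"
  shows "\<phi> z = \<phi>' z"
proof -
  obtain V g h where V: "open V" "z \<in> V" "holomorphic_multi_on g V" "holomorphic_multi_on h V"
    "dense_on V (\<lambda>w. h w \<noteq> 0)" "\<And>w. w \<in> V \<Longrightarrow> h w \<noteq> 0 \<Longrightarrow> f w = g w / h w"
    by (rule meromorphic_multi_onE[OF f UNIV_I[of z]]) (rule that)
  define N where "N = V \<inter> W \<inter> W'"
  have N: "open N" "N \<subseteq> V" "N \<subseteq> W" "N \<subseteq> W'" "z \<in> N"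
    using V \<phi> \<phi>' z by (auto simp: N_def)
  have d: "dense_on N (\<lambda>w. h w \<noteq> 0)" by (rule dense_on_subset[OF V(5) N(1,2)])
  have ch: "continuous_on N h" "continuous_on N g" "continuous_on N \<phi>" "continuous_on N \<phi>'"
    using holomorphic_multi_on_continuous[OF V(3)] holomorphic_multi_on_continuous[OF V(4)]
      holomorphic_multi_on_continuous[OF \<phi>(2)] holomorphic_multi_on_continuous[OF \<phi>'(2)]
      N(2-4) continuous_on_subset by metis+
  have o: "open {w \<in> N. h w \<noteq> 0}" by (rule open_nonzero[OF N(1) ch(1)])
  have key: "\<psi> w * h w = g w"
    if \<psi>: "continuous_on N \<psi>" "dense_on N (\<lambda>w. f w = \<psi> w)" and w: "w \<in> N" for \<psi> w
  proof (rule dense_on_eq[OF N(1) _ ch(2) _ w])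
    show "continuous_on N (\<lambda>w. \<psi> w * h w)" using \<psi> ch by (intro continuous_on_mult)
    show "dense_on N (\<lambda>w. \<psi> w * h w = g w)"
      by (rule dense_on_mono[OF dense_on_conj[OF d \<psi>(2) o]]) (metis N(2) V(6) nonzero_eq_divide_eq subsetD)
  qed
  have "dense_on N (\<lambda>w. \<phi> w = \<phi>' w)"
    by (rule dense_on_mono[OF d])
       (use key[OF ch(3) dense_on_subset[OF \<phi>(3) N(1,3)]]
            key[OF ch(4) dense_on_subset[OF \<phi>'(3) N(1,4)]] in \<open>metis mult_right_cancel\<close>)
  then show ?thesis by (rule dense_on_eq[OF N(1) ch(3,4) _ N(5)])
qed

text \<open>The value at a nonsingular point is that of any local holomorphic extension, which
  uniqueness makes well defined.\<close>

theorem nicely_meromorphic_multi_exists: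
  fixes f :: "complex ^ 'n::finite \<Rightarrow> complex"
  assumes f: "meromorphic_multi_on f UNIV"
  obtains F where "nicely_meromorphic_multi_on F UNIV"
    "\<And>z. holomorphic_multi_at f z \<Longrightarrow> F z = f z"
proof -
  define ext where "ext z W \<phi> \<longleftrightarrow> open W \<and> z \<in> W \<and> holomorphic_multi_on \<phi> W \<and>
    dense_on W (\<lambda>w. f w = \<phi> w)" for z W \<phi>
  have sing: "singularity_multi f z \<longleftrightarrow> \<not> (\<exists>W \<phi>. ext z W \<phi>)" for z
    unfolding singularity_multi_def ext_def dense_on_def by blast
  define F where "F z = (if singularity_multi f z then 0 else (SOME \<phi>. \<exists>W. ext z W \<phi>) z)" for z
  \<comment> \<open>The extension is chosen separately at every point; throughout the domain of a
    single extension all these choices have the same values as it.\<close>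
  have Fext: "F w = \<phi> w" if "ext z W \<phi>" "w \<in> W" for z W \<phi> w
  proof -
    have e: "ext w W \<phi>" using that by (auto simp: ext_def)
    then have "\<not> singularity_multi f w" using sing by blast
    moreover have "\<exists>W. ext w W (SOME \<phi>. \<exists>W. ext w W \<phi>)"
      by (rule someI_ex[where P = "\<lambda>\<phi>. \<exists>W. ext w W \<phi>"]) (use e in blast)
    then obtain W' where "ext w W' (SOME \<phi>. \<exists>W. ext w W \<phi>)" ..
    then have "(SOME \<phi>. \<exists>W. ext w W \<phi>) w = \<phi> w"
      using e holomorphic_extension_unique[OF f] unfolding ext_def by blast
    ultimately show ?thesis by (simp add: F_def)
  qed
  have Fhol: "F z = f z" if hz: "holomorphic_multi_at f z" for z
  proof -
    obtain W where "open W" "z \<in> W" "holomorphic_multi_on f W"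
      using hz unfolding holomorphic_multi_at_def by blast
    then have "ext z W f" by (simp add: ext_def dense_on_def closure_subset[of W])
    then show ?thesis using \<open>z \<in> W\<close> by (rule Fext)
  qed
  \<comment> \<open>Where the denominator is nonzero, \<open>f\<close> is holomorphic. So
    normalising changes \<open>f\<close> at most on the zeros of \<open>h\<close>, and the fractions
    for \<open>f\<close> also serve for \<open>F\<close>.\<close>
  have Frep: "F w = f w" if "open W" "holomorphic_multi_on g W" "holomorphic_multi_on h W"
    "\<And>w. w \<in> W \<Longrightarrow> h w \<noteq> 0 \<Longrightarrow> f w = g w / h w" "w \<in> W" "h w \<noteq> 0" for W g h w
  proof (rule Fhol)
    let ?O = "{w \<in> W. h w \<noteq> 0}"
    have o: "open ?O" by (rule open_nonzero[OF that(1) holomorphic_multi_on_continuous[OF that(3)]])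
    have "holomorphic_multi_on (\<lambda>w. g w / h w) ?O"
      by (rule holomorphic_multi_on_divide)
         (auto intro: holomorphic_multi_on_subset[OF that(2)] holomorphic_multi_on_subset[OF that(3)])
    then have "holomorphic_multi_on f ?O"
      by (rule holomorphic_multi_on_cong[OF o, rotated]) (use that(4) in auto)
    then show "holomorphic_multi_at f w"
      unfolding holomorphic_multi_at_def using o that(5,6) by blast
  qed
  have mero: "meromorphic_multi_on F UNIV"
    unfolding meromorphic_multi_on_def
  proof
    fix z :: "complex ^ 'n"
    obtain W g h where W: "open W" "z \<in> W" "holomorphic_multi_on g W" "holomorphic_multi_on h W"
      "dense_on W (\<lambda>w. h w \<noteq> 0)" "\<And>w. w \<in> W \<Longrightarrow> h w \<noteq> 0 \<Longrightarrow> f w = g w / h w"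
      by (rule meromorphic_multi_onE[OF f UNIV_I[of z]]) (rule that)
    then show "\<exists>W g h. open W \<and> z \<in> W \<and> holomorphic_multi_on g W \<and> holomorphic_multi_on h W \<and>
        W \<subseteq> closure {w \<in> W. h w \<noteq> 0} \<and> (\<forall>w\<in>W. h w \<noteq> 0 \<longrightarrow> F w = g w / h w)"
      using Frep[OF W(1,3,4,6)] unfolding dense_on_def by (intro exI[of _ W] exI[of _ g] exI[of _ h]) auto
  qed
  \<comment> \<open>Otherwise a singular point of \<open>f\<close>, where \<open>F\<close> is set to
    0, might be nonsingular for \<open>F\<close>, and \<open>F\<close> would have to be holomorphic
    there.\<close>
  have singF: "\<not> singularity_multi f z" if nF: "\<not> singularity_multi F z" for z
  proof -
    obtain W \<phi> where W: "open W" "z \<in> W" "holomorphic_multi_on \<phi> W" "dense_on W (\<lambda>w. F w = \<phi> w)"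
      using nF unfolding singularity_multi_def dense_on_def by blast
    obtain V g h where V: "open V" "z \<in> V" "holomorphic_multi_on g V" "holomorphic_multi_on h V"
      "dense_on V (\<lambda>w. h w \<noteq> 0)" "\<And>w. w \<in> V \<Longrightarrow> h w \<noteq> 0 \<Longrightarrow> f w = g w / h w"
      by (rule meromorphic_multi_onE[OF f UNIV_I[of z]]) (rule that)
    have N: "open (V \<inter> W)" using V W by blast
    have "dense_on (V \<inter> W) (\<lambda>w. h w \<noteq> 0 \<and> F w = \<phi> w)"
    proof (rule dense_on_conj)
      show "dense_on (V \<inter> W) (\<lambda>w. h w \<noteq> 0)" by (rule dense_on_subset[OF V(5) N]) blast
      show "dense_on (V \<inter> W) (\<lambda>w. F w = \<phi> w)" by (rule dense_on_subset[OF W(4) N]) blast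
      show "open {w \<in> V \<inter> W. h w \<noteq> 0}"
        by (rule open_nonzero[OF N continuous_on_subset[OF holomorphic_multi_on_continuous[OF V(4)]]]) blast
    qed
    then have "dense_on (V \<inter> W) (\<lambda>w. f w = \<phi> w)"
      by (rule dense_on_mono) (use Frep[OF V(1,3,4,6)] in auto)
    then have "ext z (V \<inter> W) \<phi>"
      using N V W holomorphic_multi_on_subset[OF W(3)] by (auto simp: ext_def)
    then show ?thesis using sing by blast
  qed
  have "nicely_meromorphic_multi_on F UNIV"
    unfolding nicely_meromorphic_multi_on_def
  proof (intro conjI mero ballI)
    fix z :: "complex ^ 'n"
    show "if singularity_multi F z then F z = 0 else holomorphic_multi_at F z"
    proof (cases "singularity_multi f z")
      case True
      then have "singularity_multi F z" using singF by blast
      then show ?thesis using True by (simp add: F_def)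
    next
      case False
      then obtain W \<phi> where e: "ext z W \<phi>" using sing by blast
      then have "holomorphic_multi_on F W"
        using holomorphic_multi_on_cong[of W \<phi> F] Fext[OF e] by (auto simp: ext_def)
      then have "holomorphic_multi_at F z"
        using e unfolding holomorphic_multi_at_def ext_def by blast
      moreover have "\<not> singularity_multi F z"
      proof -
        obtain V where "open V" "z \<in> V" "holomorphic_multi_on F V"
          using \<open>holomorphic_multi_at F z\<close> unfolding holomorphic_multi_at_def by blast
        moreover have "V \<subseteq> closure {w \<in> V. F w = F w}" by (simp add: closure_subset)
        ultimately show ?thesis unfolding singularity_multi_def by blast
      qed
      ultimately show ?thesis by simp
    qed
  qed
  with Fhol that show ?thesis by blast
qed

text \<open>Existence of a normalised continuation is what gives the \<open>SOME\<close> in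
  \<open>multiple_lucas_L\<close> its meaning. Equality with \<open>G\<close> is only dense, as
  \<open>G\<close> carries no normalisation on its polar set.\<close>

lemma multiple_lucas_L_continuation:
  fixes G :: "complex ^ 'd::{finite,linorder} \<Rightarrow> complex"
  assumes G: "meromorphic_multi_on G UNIV"
    and hol: "\<And>s. s \<in> lucas_L_region \<Longrightarrow> holomorphic_multi_at G s"
    and series: "\<And>s. s \<in> lucas_L_region \<Longrightarrow> G s = lucas_L_series P Q \<psi> s"
    and region: "open U" "U \<noteq> {}" "U \<subseteq> (lucas_L_region :: (complex ^ 'd::{finite,linorder}) set)"
  shows "nicely_meromorphic_multi_on (multiple_lucas_L P Q \<psi>) UNIV"
    and "dense_on UNIV (\<lambda>s. multiple_lucas_L P Q \<psi> s = G s)"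
proof -
  let ?P = "\<lambda>F. nicely_meromorphic_multi_on F UNIV \<and>
    (\<forall>s\<in>lucas_L_region. F s = lucas_L_series P Q \<psi> s)"
  have "\<exists>F. ?P F"
    using nicely_meromorphic_multi_exists[OF G] hol series by metis
  then have *: "?P (multiple_lucas_L P Q \<psi>)"
    unfolding multiple_lucas_L_def by (rule someI_ex)
  then show "nicely_meromorphic_multi_on (multiple_lucas_L P Q \<psi>) UNIV" by blast
  then have "meromorphic_multi_on (multiple_lucas_L P Q \<psi>) UNIV"
    by (simp add: nicely_meromorphic_multi_on_def)
  from meromorphic_multi_identity[OF this G region(1,2)]
  show "dense_on UNIV (\<lambda>s. multiple_lucas_L P Q \<psi> s = G s)"
    using * series region(3) by (metis subsetD)
qed

text \<open>The identity holds on the dense set where \<open>u\<close> is nonzero and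
  \<open>F = G\<close>, and both sides are continuous. The marker \<open>u\<close> is kept apart
  from \<open>h\<close> so that \<open>u\<close> can be the full denominator while \<open>h\<close>
  is one with some zeros already cancelled.\<close>

lemma continuation_times_denominator:
  fixes F G :: "complex ^ 'n::finite \<Rightarrow> complex"
  assumes FG: "dense_on UNIV (\<lambda>s. F s = G s)"
    and F: "open V" "holomorphic_multi_on F V"
    and B: "open B" "holomorphic_multi_on g B" "holomorphic_multi_on h B"
      "dense_on B (\<lambda>w. u w \<noteq> 0)" "continuous_on B u"
      "\<And>w. w \<in> B \<Longrightarrow> u w \<noteq> (0::complex) \<Longrightarrow> G w * h w = g w"
    and z: "z \<in> V" "z \<in> B"
  shows "F z * h z = g z"
proof -
  have N: "open (V \<inter> B)" using F B by blast
  show ?thesis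
  proof (rule dense_on_eq[OF N, of "\<lambda>z. F z * h z"])
    show "continuous_on (V \<inter> B) (\<lambda>z. F z * h z)" "continuous_on (V \<inter> B) g"
      using holomorphic_multi_on_continuous[OF F(2)] holomorphic_multi_on_continuous[OF B(2)]
        holomorphic_multi_on_continuous[OF B(3)]
      by (auto intro!: continuous_on_mult intro: continuous_on_subset)
    have "dense_on (V \<inter> B) (\<lambda>w. u w \<noteq> 0 \<and> F w = G w)"
    proof (rule dense_on_conj)
      show "dense_on (V \<inter> B) (\<lambda>w. u w \<noteq> 0)" by (rule dense_on_subset[OF B(4) N]) blast
      show "dense_on (V \<inter> B) (\<lambda>w. F w = G w)" by (rule dense_on_subset[OF FG N]) blast
      show "open {w \<in> V \<inter> B. u w \<noteq> 0}"
        by (rule open_nonzero[OF N continuous_on_subset[OF B(5)]]) blast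
    qed
    then show "dense_on (V \<inter> B) (\<lambda>z. F z * h z = g z)"
      by (rule dense_on_mono) (use B(6) in auto)
  qed (use z in blast)
qed

section \<open>Sums over strictly increasing tuples\<close>

lemma greaterThan_eq_atLeast_Min:
  fixes l :: "'d::{finite,linorder}"
  assumes "{l<..} \<noteq> {}"
  shows "{l<..} = {Min {l<..}..}"
proof -
  have "Min {l<..} \<in> {l<..}" using assms by (intro Min_in) auto
  then show ?thesis by (auto intro: order_less_le_trans)
qed

lemma lessThan_eq_atMost_Max:
  fixes l :: "'d::{finite,linorder}"
  assumes "{..<l} \<noteq> {}"
  shows "{..<l} = {..Max {..<l}}"
proof -
  have "Max {..<l} \<in> {..<l}" using assms by (intro Max_in) auto
  then show ?thesis by (auto intro: order_le_less_trans)
qed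

lemma sum_atLeast_split:
  fixes f :: "'d::{finite,linorder} \<Rightarrow> 'a::comm_monoid_add"
  shows "(\<Sum>i\<in>{l..}. f i) = f l + (\<Sum>i\<in>{l<..}. f i)"
proof -
  have "{l..} = insert l {l<..}" by auto
  then show ?thesis by simp
qed

lemma sum_atMost_split:
  fixes f :: "'d::{finite,linorder} \<Rightarrow> 'a::comm_monoid_add"
  shows "(\<Sum>i\<in>{..l}. f i) = f l + (\<Sum>i\<in>{..<l}. f i)"
proof -
  have "{..l} = insert l {..<l}" by auto
  then show ?thesis by simp
qed

text \<open>Tail sums serve as coordinates: each polar divisor fixes a single one of them, so a
  point can be put on prescribed divisors, one for every \<open>l\<close>, independently.\<close>

lemma tail_sums_surj:
  fixes T :: "'d::{finite,linorder} \<Rightarrow> 'a::ab_group_add"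
  obtains s where "\<And>l. (\<Sum>i\<in>{l..}. s i) = T l"
proof
  \<comment> \<open>\<open>Min {l<..}\<close> is the successor of \<open>l\<close>; at the last
    index the remaining tail is empty and counts as 0.\<close>
  define s where "s l = T l - (if {l<..} = {} then 0 else T (Min {l<..}))" for l
  show "(\<Sum>i\<in>{l..}. s i) = T l" for l
  proof (induction "card {l..}" arbitrary: l rule: less_induct)
    case less
    show ?case
    proof (cases "{l<..} = {}")
      case True
      then show ?thesis by (simp add: sum_atLeast_split s_def)
    next
      case False
      define l' where "l' = Min {l<..}"
      have l': "{l<..} = {l'..}"
        using greaterThan_eq_atLeast_Min[OF False] by (simp add: l'_def)
      then have "l < l'" by auto
      then have "{l'..} \<subset> {l..}" by force
      then have "card {l'..} < card {l..}" by (rule psubset_card_mono[OF finite])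
      then have "(\<Sum>i\<in>{l'..}. s i) = T l'"
        by (rule less)
      moreover have "s l = T l - T l'" using False by (simp add: s_def l'_def)
      ultimately show ?thesis by (simp add: sum_atLeast_split[of s l] l')
    qed
  qed
qed

lemma tail_sums_inj:
  fixes k k' :: "'d::{finite,linorder} \<Rightarrow> 'a::cancel_comm_monoid_add"
  assumes "\<And>l. (\<Sum>i\<in>{l..}. k i) = (\<Sum>i\<in>{l..}. k' i)"
  shows "k = k'"
proof
  fix l
  have "(\<Sum>i\<in>{l<..}. k i) = (\<Sum>i\<in>{l<..}. k' i)"
    by (cases "{l<..} = {}") (simp, metis greaterThan_eq_atLeast_Min assms)
  then show "k l = k' l"
    using assms[of l] by (simp add: sum_atLeast_split)
qed

lemma head_sums_inj:
  fixes k k' :: "'d::{finite,linorder} \<Rightarrow> 'a::cancel_comm_monoid_add"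
  assumes "\<And>l. (\<Sum>i\<in>{..l}. k i) = (\<Sum>i\<in>{..l}. k' i)"
  shows "k = k'"
proof
  fix l
  have "(\<Sum>i\<in>{..<l}. k i) = (\<Sum>i\<in>{..<l}. k' i)"
    by (cases "{..<l} = {}") (simp, metis lessThan_eq_atMost_Max assms)
  then show "k l = k' l"
    using assms[of l] by (simp add: sum_atMost_split)
qed

text \<open>\<open>g\<close> lists the gaps of \<open>n\<close>, the first one being measured from
  0; unlike the entries of \<open>n\<close>, they vary independently.\<close>

lemma bij_betw_head_sums:
  "bij_betw (\<lambda>g i. \<Sum>j\<in>{..i}. g j) {g :: 'd::{finite,linorder} \<Rightarrow> nat. \<forall>i. 1 \<le> g i}
     {n. strict_mono n \<and> (\<forall>i. 0 < n i)}"
proof (rule bij_betw_imageI)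
  show "inj_on (\<lambda>g i. \<Sum>j\<in>{..i}. g j) {g :: 'd \<Rightarrow> nat. \<forall>i. 1 \<le> g i}"
    by (rule inj_onI, rule head_sums_inj) (metis (mono_tags))
  show "(\<lambda>g i. \<Sum>j\<in>{..i}. g j) ` {g :: 'd \<Rightarrow> nat. \<forall>i. 1 \<le> g i} = {n. strict_mono n \<and> (\<forall>i. 0 < n i)}"
  proof (intro equalityI subsetI)
    fix n assume "n \<in> (\<lambda>g i. \<Sum>j\<in>{..i}. g j) ` {g :: 'd \<Rightarrow> nat. \<forall>i. 1 \<le> g i}"
    then obtain g :: "'d \<Rightarrow> nat" where g: "\<And>i. 1 \<le> g i" and n: "n = (\<lambda>i. \<Sum>j\<in>{..i}. g j)" by auto
    have "strict_mono n"
    proof (rule strict_monoI)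
      fix x y :: 'd assume "x < y"
      have "g y \<noteq> 0" using g[of y] by simp
      then show "n x < n y" unfolding n
        by (intro sum_strict_mono2[of _ _ y]) (use \<open>x < y\<close> in auto)
    qed
    moreover have "0 < n i" for i
      using g[of i] by (simp add: n sum_atMost_split)
    ultimately show "n \<in> {n. strict_mono n \<and> (\<forall>i. 0 < n i)}" by blast
  next
    fix n :: "'d \<Rightarrow> nat" assume "n \<in> {n. strict_mono n \<and> (\<forall>i. 0 < n i)}"
    then have mono: "strict_mono n" and pos: "\<And>i. 0 < n i" by auto
    \<comment> \<open>\<open>Max {..<l}\<close> is the predecessor of \<open>l\<close>. At the first
      index the gap is \<open>n l\<close> itself, which is where positivity of \<open>n\<close> is
      used.\<close>
    define g where "g l = n l - (if {..<l} = {} then 0 else n (Max {..<l}))" for l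
    have lt: "n (Max {..<l}) < n l" if "{..<l} \<noteq> {}" for l
    proof (rule strict_monoD[OF mono])
      have "Max {..<l} \<in> {..<l}" using that by (intro Max_in) auto
      then show "Max {..<l} < l" by simp
    qed
    have g: "1 \<le> g l" for l
      using pos[of l] lt[of l] by (cases "{..<l} = {}") (simp_all add: g_def Suc_le_eq del: lessThan_empty_iff)
    have "(\<Sum>i\<in>{..l}. g i) = n l" for l
    proof (induction "card {..l}" arbitrary: l rule: less_induct)
      case less
      show ?case
      proof (cases "{..<l} = {}")
        case True
        then show ?thesis by (simp add: sum_atMost_split g_def)
      next
        case False
        define l' where "l' = Max {..<l}"
        have l': "{..<l} = {..l'}"
          using lessThan_eq_atMost_Max[OF False] by (simp add: l'_def)
        then have "l' < l" by auto
        then have "{..l'} \<subset> {..l}" by force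
        then have "card {..l'} < card {..l}" by (rule psubset_card_mono[OF finite])
        then have "(\<Sum>i\<in>{..l'}. g i) = n l'"
          by (rule less)
        moreover have "g l + n l' = n l" using False lt[OF False] by (simp add: g_def l'_def)
        ultimately show ?thesis by (simp add: sum_atMost_split[of g l] l')
      qed
    qed
    then show "n \<in> (\<lambda>g i. \<Sum>j\<in>{..i}. g j) ` {g :: 'd \<Rightarrow> nat. \<forall>i. 1 \<le> g i}"
      using g by (intro image_eqI[of _ _ g]) auto
  qed
qed

text \<open>The gap \<open>g j\<close> is a summand of the i-th index for every i \<ge> j, so its
  base is the product of \<open>x i\<close> over that tail. This is where \<open>tail_ratio\<close>
  comes from.\<close>

lemma prod_power_head_sums:
  fixes x :: "'d::{finite,linorder} \<Rightarrow> 'a::comm_semiring_1"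
  shows "(\<Prod>i\<in>UNIV. x i ^ (\<Sum>j\<in>{..i}. g j)) = (\<Prod>j\<in>UNIV. (\<Prod>i\<in>{j..}. x i) ^ g j)"
proof -
  have "(\<Prod>i\<in>UNIV. x i ^ (\<Sum>j\<in>{..i}. g j)) = (\<Prod>i\<in>UNIV. \<Prod>j\<in>{j \<in> UNIV. j \<le> i}. x i ^ g j)"
    by (simp add: power_sum atMost_def)
  also have "\<dots> = (\<Prod>j\<in>UNIV. \<Prod>i\<in>{i \<in> UNIV. j \<le> i}. x i ^ g j)"
    by (rule prod.swap_restrict) auto
  finally show ?thesis by (simp add: prod_power_distrib atLeast_def)
qed

section \<open>Summable products and geometric series over residue classes\<close>

lemma abs_summable_on_prod_PiE:
  fixes f :: "'a \<Rightarrow> 'b \<Rightarrow> 'c::{real_normed_field, banach}"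
  assumes A: "finite A" and f: "\<And>x. x \<in> A \<Longrightarrow> f x abs_summable_on B x"
  shows "(\<lambda>g. \<Prod>x\<in>A. f x (g x)) abs_summable_on (PiE A B)"
proof (rule nonneg_bdd_above_summable_on)
  show "bdd_above (sum (\<lambda>g. norm (\<Prod>x\<in>A. f x (g x))) ` {F. F \<subseteq> PiE A B \<and> finite F})"
  proof (rule bdd_aboveI2)
    fix F assume "F \<in> {F. F \<subseteq> PiE A B \<and> finite F}"
    then have F: "F \<subseteq> PiE A B" "finite F" by auto
    \<comment> \<open>The projections of \<open>F\<close> enlarge it to a finite box, over which the
      sum of products factors.\<close>
    define B' where "B' x = (\<lambda>g. g x) ` F" for x
    have fin: "finite (B' x)" for x using F by (simp add: B'_def)
    have "F \<subseteq> PiE A B'"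
      using F by (auto simp: B'_def PiE_iff)
    then have "(\<Sum>g\<in>F. norm (\<Prod>x\<in>A. f x (g x))) \<le> (\<Sum>g\<in>PiE A B'. norm (\<Prod>x\<in>A. f x (g x)))"
      by (intro sum_mono2 finite_PiE A fin) auto
    also have "\<dots> = (\<Prod>x\<in>A. \<Sum>y\<in>B' x. norm (f x y))"
      by (simp add: prod_norm[symmetric] prod_sum_PiE A fin)
    also have "\<dots> \<le> (\<Prod>x\<in>A. \<Sum>\<^sub>\<infinity>y\<in>B x. norm (f x y))"
    proof (rule prod_mono, intro conjI)
      fix x assume x: "x \<in> A"
      show "0 \<le> (\<Sum>y\<in>B' x. norm (f x y))" by (simp add: sum_nonneg)
      show "(\<Sum>y\<in>B' x. norm (f x y)) \<le> (\<Sum>\<^sub>\<infinity>y\<in>B x. norm (f x y))"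
        by (rule finite_sum_le_infsum[OF f[OF x] fin]) (use F x in \<open>auto simp: B'_def\<close>)
    qed
    finally show "(\<Sum>g\<in>F. norm (\<Prod>x\<in>A. f x (g x))) \<le> (\<Prod>x\<in>A. \<Sum>\<^sub>\<infinity>y\<in>B x. norm (f x y))" .
  qed
qed simp

lemma PiE_UNIV_eq: "PiE UNIV B = {g. \<forall>i. g i \<in> B i}"
  by (auto simp: PiE_iff)

lemma geometric_abs_summable:
  fixes y :: complex
  assumes "norm y < 1"
  shows "(\<lambda>n. y ^ n) abs_summable_on A"
proof -
  have "(\<lambda>n. norm (norm (y ^ n))) summable_on (UNIV :: nat set)"
    by (rule norm_summable_imp_summable_on)
       (use assms in \<open>simp add: norm_power summable_geometric\<close>)
  then have "(\<lambda>n. y ^ n) abs_summable_on UNIV" by simp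
  then show ?thesis by (rule summable_on_subset_banach) simp
qed

text \<open>Representatives are taken in 1..q because summation starts at 1: the class of
  \<open>b\<close> then consists exactly of b + q e with e \<ge> 0, also for b = q.\<close>

lemma infsum_geometric_class:
  fixes y :: complex
  assumes y: "norm y < 1" and b: "1 \<le> b" "b \<le> q"
  shows "(\<Sum>\<^sub>\<infinity>n\<in>{1..}. of_bool (n mod q = b mod q) * y ^ n) = y ^ b / (1 - y ^ q)"
proof -
  have q: "q > 0" using b by simp
  have yq: "norm (y ^ q) < 1"
    using y q by (simp add: norm_power power_less_one_iff)
  have inj: "inj (\<lambda>e. b + q * e)" using q by (auto simp: inj_on_def)
  have rng: "n \<in> range (\<lambda>e. b + q * e)" if "1 \<le> n" "n mod q = b mod q" for n
  proof -
    have "b \<le> n"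
    proof (rule ccontr)
      assume "\<not> b \<le> n"
      then have "n mod q = n" using b by simp
      then have "b mod q = n" using that by simp
      then show False using b that \<open>\<not> b \<le> n\<close> by (cases "b = q") auto
    qed
    then have "q dvd n - b" using that(2) by (metis mod_eq_dvd_iff_nat)
    then obtain e where "n - b = q * e" by blast
    then show ?thesis using \<open>b \<le> n\<close> by (intro image_eqI[of _ _ e]) auto
  qed
  have "(\<Sum>\<^sub>\<infinity>n\<in>{1..}. of_bool (n mod q = b mod q) * y ^ n) = infsum (\<lambda>n. y ^ n) (range (\<lambda>e. b + q * e))"
    by (rule infsum_cong_neutral) (use rng b in auto)
  also have "\<dots> = (\<Sum>\<^sub>\<infinity>e. y ^ b * (y ^ q) ^ e)"
    by (subst infsum_reindex[OF inj]) (simp add: o_def power_add power_mult)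
  also have "\<dots> = y ^ b * (\<Sum>\<^sub>\<infinity>e. (y ^ q) ^ e)" by (rule infsum_cmult_right')
  also have "(\<Sum>\<^sub>\<infinity>e. (y ^ q) ^ e) = (\<Sum>e. (y ^ q) ^ e)"
    by (rule abs_summable_sums_infsum) (use yq in \<open>simp add: norm_power summable_geometric\<close>)
  also have "\<dots> = 1 / (1 - y ^ q)" by (rule suminf_geometric[OF yq])
  finally show ?thesis by simp
qed

lemma infsum_sum:
  fixes f :: "'a \<Rightarrow> 'b \<Rightarrow> complex"
  assumes "finite I" "\<And>i. i \<in> I \<Longrightarrow> f i summable_on A"
  shows "(\<Sum>\<^sub>\<infinity>x\<in>A. \<Sum>i\<in>I. f i x) = (\<Sum>i\<in>I. \<Sum>\<^sub>\<infinity>x\<in>A. f i x)"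
proof -
  have "((\<lambda>x. \<Sum>i\<in>I. f i x) has_sum (\<Sum>i\<in>I. \<Sum>\<^sub>\<infinity>x\<in>A. f i x)) A"
    using assms by (induction I rule: finite_induct) (auto intro: has_sum_add)
  then show ?thesis by (rule infsumI)
qed

text \<open>Sorting the gaps by residue class makes the coefficient constant, and each class
  contributes a product of geometric series in one variable.\<close>

lemma infsum_periodic_coeffs:
  fixes a :: "('d::finite \<Rightarrow> nat) \<Rightarrow> complex" and y :: "'d \<Rightarrow> complex"
  assumes q: "q > 0" and y: "\<And>j. norm (y j) < 1"
    and per: "\<And>g g'. (\<And>j. g j mod q = g' j mod q) \<Longrightarrow> a g = a g'"
  shows "(\<Sum>\<^sub>\<infinity>g\<in>{g. \<forall>j. 1 \<le> g j}. a g * (\<Prod>j\<in>UNIV. y j ^ g j)) =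
    (\<Sum>b\<in>PiE UNIV (\<lambda>_. {1..q}). a b * (\<Prod>j\<in>UNIV. y j ^ b j / (1 - y j ^ q)))"
proof -
  let ?P = "PiE (UNIV :: 'd set) (\<lambda>_. {1..q})" and ?G = "PiE (UNIV :: 'd set) (\<lambda>_. {1::nat..})"
  let ?f = "\<lambda>b j n. of_bool (n mod q = (b :: 'd \<Rightarrow> nat) j mod q) * y j ^ n"
  have G: "{g. \<forall>j. 1 \<le> g j} = ?G" by (auto simp: PiE_iff)
  have fin: "finite ?P" by (intro finite_PiE) auto
  have expand: "a g * (\<Prod>j\<in>UNIV. y j ^ g j) = (\<Sum>b\<in>?P. a b * (\<Prod>j\<in>UNIV. ?f b j (g j)))"
    if "g \<in> ?G" for g
  proof -
    \<comment> \<open>The shift by one yields the representative q, not 0, for multiples of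
      q.\<close>
    define b0 where "b0 j = (g j - 1) mod q + 1" for j
    have b0: "b0 \<in> ?P" using q by (auto simp: b0_def PiE_iff Suc_le_eq)
    have m0: "g j mod q = b0 j mod q" for j
    proof -
      have "1 \<le> g j" using that by (simp add: PiE_iff)
      then have "Suc (g j - 1) = g j" by simp
      then show ?thesis by (simp add: b0_def mod_Suc_eq)
    qed
    have uniq: "b = b0" if "b \<in> ?P" "\<And>j. g j mod q = b j mod q" for b
    proof
      fix j
      have "b j mod q = b0 j mod q" "1 \<le> b j" "b j \<le> q" "1 \<le> b0 j" "b0 j \<le> q"
        using that b0 m0 by (auto simp: PiE_iff)
      then show "b j = b0 j"
        by (cases "b j = q"; cases "b0 j = q") auto
    qed
    have "(\<Sum>b\<in>?P. a b * (\<Prod>j\<in>UNIV. ?f b j (g j))) = (\<Sum>b\<in>{b0}. a b * (\<Prod>j\<in>UNIV. ?f b j (g j)))"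
    proof (rule sum.mono_neutral_right[OF fin])
      show "\<forall>b\<in>?P - {b0}. a b * (\<Prod>j\<in>UNIV. ?f b j (g j)) = 0"
      proof
        fix b assume "b \<in> ?P - {b0}"
        then obtain j where "g j mod q \<noteq> b j mod q" using uniq by blast
        then have "(\<Prod>j\<in>UNIV. ?f b j (g j)) = 0" by (intro prod_zero) auto
        then show "a b * (\<Prod>j\<in>UNIV. ?f b j (g j)) = 0" by simp
      qed
    qed (use b0 in auto)
    also have "\<dots> = a g * (\<Prod>j\<in>UNIV. y j ^ g j)"
      using per[of b0 g] m0 by simp
    finally show ?thesis ..
  qed
  have abs: "?f b j abs_summable_on {1..}" for b j
    by (rule Infinite_Sum.abs_summable_on_comparison_test[OF geometric_abs_summable[OF y[of j]]])
       (simp add: norm_mult of_bool_def)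
  have "(\<Sum>\<^sub>\<infinity>g\<in>?G. a g * (\<Prod>j\<in>UNIV. y j ^ g j)) = (\<Sum>\<^sub>\<infinity>g\<in>?G. \<Sum>b\<in>?P. a b * (\<Prod>j\<in>UNIV. ?f b j (g j)))"
    by (rule infsum_cong) (rule expand)
  also have "\<dots> = (\<Sum>b\<in>?P. \<Sum>\<^sub>\<infinity>g\<in>?G. a b * (\<Prod>j\<in>UNIV. ?f b j (g j)))"
    by (rule infsum_sum)
       (rule fin, rule summable_on_cmult_right, rule abs_summable_summable,
        rule abs_summable_on_prod_PiE[OF finite abs])
  also have "\<dots> = (\<Sum>b\<in>?P. a b * (\<Prod>j\<in>UNIV. \<Sum>\<^sub>\<infinity>n\<in>{1..}. ?f b j n))"
  proof (unfold infsum_cmult_right', rule sum.cong[OF refl])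
    fix b
    show "a b * (\<Sum>\<^sub>\<infinity>g\<in>?G. \<Prod>j\<in>UNIV. ?f b j (g j)) = a b * (\<Prod>j\<in>UNIV. \<Sum>\<^sub>\<infinity>n\<in>{1..}. ?f b j n)"
      using infsum_prod_PiE_abs[of UNIV "?f b" "\<lambda>_. {1..}"] abs by simp
  qed
  also have "\<dots> = (\<Sum>b\<in>?P. a b * (\<Prod>j\<in>UNIV. y j ^ b j / (1 - y j ^ q)))"
    by (intro sum.cong refl arg_cong2[of _ _ _ _ "(*)"] prod.cong infsum_geometric_class y)
       (auto simp: PiE_iff)
  finally show ?thesis unfolding G .
qed

text \<open>The binomial coefficient (s + k - 1 over k), that is, the coefficient of
  \<open>z ^ k\<close> in \<open>(1 - z) powr (- s)\<close>. In the \<open>pochhammer\<close> form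
  it is visibly a polynomial in \<open>s\<close> with nonnegative coefficients.\<close>

definition negbin :: "'a::field_char_0 \<Rightarrow> nat \<Rightarrow> 'a" where
  "negbin s k = pochhammer s k / fact k"

lemma negbin_gbinomial: "negbin s k = (- 1) ^ k * ((- s) gchoose k)"
  by (simp add: negbin_def gbinomial_pochhammer flip: power_mult_distrib mult.assoc)

lemma negbin_sums:
  fixes z s :: complex
  assumes "norm z < 1"
  shows "(\<lambda>k. negbin s k * z ^ k) sums (1 - z) powr (- s)"
  using gen_binomial_complex[of "- z" "- s"] assms
  by (simp add: negbin_gbinomial power_minus[of z] mult_ac)

lemma negbin_real_summable:
  fixes z r :: real
  assumes "\<bar>z\<bar> < 1"
  shows "summable (\<lambda>k. negbin r k * z ^ k)"
  using gen_binomial_real[of "- z" "- r"] assms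
  by (simp add: negbin_gbinomial power_minus[of z] mult_ac sums_iff)

text \<open>Each factor s + i is bounded by r + i. Only a bound on the norm of \<open>s\<close> is
  used, so a single majorant serves for a whole ball.\<close>

lemma norm_negbin_le:
  fixes s :: complex
  assumes "norm s \<le> r"
  shows "norm (negbin s k) \<le> negbin r k"
proof -
  have "norm (pochhammer s k) \<le> pochhammer r k"
    unfolding pochhammer_prod prod_norm[symmetric]
  proof (intro prod_mono conjI)
    fix i
    have "norm (s + of_nat i) \<le> norm s + norm (of_nat i :: complex)" by (rule norm_triangle_ineq)
    then show "norm (s + of_nat i) \<le> r + of_nat i" using assms by simp
  qed simp
  then show ?thesis
    by (simp add: negbin_def norm_divide divide_right_mono)
qed

lemma negbin_abs_summable:
  fixes z s :: complex
  assumes "norm z < 1"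
  shows "(\<lambda>k. negbin s k * z ^ k) abs_summable_on UNIV"
proof (rule Infinite_Sum.abs_summable_on_comparison_test')
  show "(\<lambda>k. negbin (norm s) k * norm z ^ k) summable_on UNIV"
  proof (rule norm_summable_imp_summable_on)
    have "norm (negbin (norm s) k * norm z ^ k) = negbin (norm s) k * norm z ^ k" for k
      using order_trans[OF norm_ge_zero norm_negbin_le[of s "norm s" k]] by (simp add: abs_mult)
    then show "summable (\<lambda>k. norm (negbin (norm s) k * norm z ^ k))"
      using negbin_real_summable[of "norm z" "norm s"] assms by simp
  qed
  show "norm (negbin s k * z ^ k) \<le> negbin (norm s) k * norm z ^ k" for k
    by (simp add: norm_mult norm_power mult_right_mono norm_negbin_le)
qed

lemma infsum_negbin:
  fixes z s :: complex
  assumes "norm z < 1"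
  shows "(\<Sum>\<^sub>\<infinity>k. negbin s k * z ^ k) = (1 - z) powr (- s)"
proof -
  have "summable (\<lambda>k. norm (negbin s k * z ^ k))"
    using negbin_abs_summable[OF assms] summable_on_imp_summable by blast
  from abs_summable_sums_infsum[OF this] sums_unique[OF negbin_sums[OF assms]]
  show ?thesis by simp
qed

section \<open>The series as a sum over exponents\<close>

text \<open>\<open>P\<^sup>2 - 4 * (P - 1)\<close> equals \<open>(P - 2)\<^sup>2\<close>, so the
  bound on Q compares the discriminant with \<open>(P - 2)\<^sup>2\<close>. The condition \<alpha> >
  1 means that the root of the discriminant exceeds 2 - P: for P \<le> 2 the strict inequality gives
  this, for P > 2 the right side is negative.\<close>

lemma lucas_admissible_roots:
  assumes "lucas_admissible P Q"
  shows "lucas_disc P Q > 0" "lucas_alpha P Q > 1" "\<bar>lucas_beta P Q\<bar> < lucas_alpha P Q"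
    "lucas_beta P Q \<noteq> 0" "lucas_alpha P Q * lucas_beta P Q = Q"
    "lucas_alpha P Q - lucas_beta P Q = sqrt (lucas_disc P Q)"
proof -
  have P: "P > 0" and Q: "Q \<noteq> 0" using assms by (auto simp: lucas_admissible_def)
  have sq: "(P - 2)\<^sup>2 = P\<^sup>2 - 4 * (P - 1)" by (simp add: power2_eq_square algebra_simps)
  have *: "lucas_disc P Q > 0 \<and> sqrt (lucas_disc P Q) > 2 - P"
  proof (cases "P \<le> 2")
    case True
    then have "(2 - P)\<^sup>2 < lucas_disc P Q"
      using assms sq by (simp add: lucas_admissible_def lucas_disc_def power2_commute)
    then show ?thesis
      using real_less_rsqrt[of "2 - P" "lucas_disc P Q"] zero_le_power2[of "2 - P"] by linarith
  next
    case False
    then have "(P - 2)\<^sup>2 \<le> lucas_disc P Q"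
      using assms sq by (simp add: lucas_admissible_def lucas_disc_def)
    moreover have "(P - 2)\<^sup>2 > 0" using False by simp
    ultimately have "lucas_disc P Q > 0" by linarith
    then show ?thesis using False real_sqrt_gt_zero[of "lucas_disc P Q"] by linarith
  qed
  then show D: "lucas_disc P Q > 0" by simp
  show "lucas_alpha P Q > 1" using * by (simp add: lucas_alpha_def)
  have "sqrt (lucas_disc P Q) > 0" using D by simp
  then show "\<bar>lucas_beta P Q\<bar> < lucas_alpha P Q"
    using P unfolding lucas_alpha_def lucas_beta_def by (simp add: abs_less_iff field_simps)
  have "(sqrt (lucas_disc P Q))\<^sup>2 = lucas_disc P Q" using D by simp
  then show ab: "lucas_alpha P Q * lucas_beta P Q = Q"
    unfolding lucas_alpha_def lucas_beta_def
    by (simp add: lucas_disc_def power2_eq_square field_simps)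
  then show "lucas_beta P Q \<noteq> 0" using Q by auto
  show "lucas_alpha P Q - lucas_beta P Q = sqrt (lucas_disc P Q)"
    by (simp add: lucas_alpha_def lucas_beta_def field_simps)
qed

lemma abs_summable_times:
  fixes f :: "'a \<Rightarrow> real" and h :: "'b \<Rightarrow> real" and F :: "'a \<times> 'b \<Rightarrow> 'c::banach"
  assumes "f summable_on A" "h summable_on B" "\<And>x. x \<in> A \<Longrightarrow> 0 \<le> f x" "\<And>y. y \<in> B \<Longrightarrow> 0 \<le> h y"
    and "\<And>x y. x \<in> A \<Longrightarrow> y \<in> B \<Longrightarrow> norm (F (x, y)) \<le> f x * h y"
  shows "F summable_on A \<times> B"
proof (rule abs_summable_summable, rule Infinite_Sum.abs_summable_on_comparison_test')
  show "(\<lambda>(x, y). f x * h y) summable_on A \<times> B"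
  proof (rule summable_on_SigmaI)
    show "((\<lambda>y. case (x, y) of (x, y) \<Rightarrow> f x * h y) has_sum f x * infsum h B) B" if "x \<in> A" for x
      using assms(2) by (simp add: has_sum_cmult_right)
    show "(\<lambda>x. f x * infsum h B) summable_on A"
      using assms(1) by (rule summable_on_cmult_left)
  qed (use assms in auto)
  show "norm (F z) \<le> (case z of (x, y) \<Rightarrow> f x * h y)" if "z \<in> A \<times> B" for z
    using that assms(5) by auto
qed

locale lucas_L_setup =
  fixes P Q :: real and q :: nat and \<psi> :: "'d::{finite,linorder} \<Rightarrow> nat \<Rightarrow> complex"
  assumes adm: "lucas_admissible P Q" and q_pos: "q > 0"
    and periodic: "\<And>i n. \<psi> i (n mod q) = \<psi> i n" and bounded: "\<And>i n. norm (\<psi> i n) \<le> 1"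
begin

definition \<alpha> where "\<alpha> = lucas_alpha P Q"
definition \<beta> where "\<beta> = lucas_beta P Q"
definition \<rho> where "\<rho> = \<beta> / \<alpha>"

lemma alpha_gt_1: "\<alpha> > 1" and beta_less: "\<bar>\<beta>\<bar> < \<alpha>" and beta_nz: "\<beta> \<noteq> 0"
  using lucas_admissible_roots[OF adm] by (simp_all add: \<alpha>_def \<beta>_def)

lemma rho_less_1: "\<bar>\<rho>\<bar> < 1" and rho_nz: "\<rho> \<noteq> 0"
  using alpha_gt_1 beta_less beta_nz by (simp_all add: \<rho>_def)

lemma ln_alpha_pos: "ln \<alpha> > 0"
  using alpha_gt_1 by simp

text \<open>The argument lists gaps; the characters are evaluated at the indices, which are the head
  sums.\<close>

definition coef :: "('d \<Rightarrow> nat) \<Rightarrow> complex" where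
  "coef b = (\<Prod>i\<in>UNIV. \<psi> i (\<Sum>j\<in>{..i}. b j))"

definition residues :: "('d \<Rightarrow> nat) set" where
  "residues = PiE UNIV (\<lambda>_. {1..q})"

text \<open>The product of the \<open>x\<^sub>i\<close> over \<open>i \<ge> l\<close>, where \<open>x\<^sub>i = \<alpha> powr (- s\<^sub>i) * \<rho> ^ k\<^sub>i\<close>; it depends on \<open>k\<close> only
  through the tail sum \<open>K\<close>.\<close>

definition tail_ratio :: "(complex, 'd) vec \<Rightarrow> 'd \<Rightarrow> nat \<Rightarrow> complex" where
  "tail_ratio s l K = exp (- of_real (ln \<alpha>) * (\<Sum>i\<in>{l..}. s $ i)) * of_real \<rho> ^ K"

definition binom_coeff :: "(complex, 'd) vec \<Rightarrow> ('d \<Rightarrow> nat) \<Rightarrow> complex" where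
  "binom_coeff s k = (\<Prod>i\<in>UNIV. negbin (s $ i) (k i))"

text \<open>The power of \<alpha> - \<beta> collected from the denominators of the Lucas
  numbers.\<close>

definition disc_factor :: "(complex, 'd) vec \<Rightarrow> complex" where
  "disc_factor s = exp (of_real (ln (\<alpha> - \<beta>)) * (\<Sum>i\<in>UNIV. s $ i))"

text \<open>Off the polar divisors \<open>tail_ratio s l K ^ q = 1\<close> this is the continuation of the series.\<close>

definition continuation :: "(complex, 'd) vec \<Rightarrow> complex" where
  "continuation s = disc_factor s * (\<Sum>\<^sub>\<infinity>k. binom_coeff s k * (\<Sum>b\<in>residues. coef b *
     (\<Prod>l\<in>UNIV. tail_ratio s l (\<Sum>i\<in>{l..}. k i) ^ b l / (1 - tail_ratio s l (\<Sum>i\<in>{l..}. k i) ^ q))))"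

lemma coef_cong:
  assumes "\<And>j. g j mod q = g' j mod q"
  shows "coef g = coef g'"
proof -
  have "(\<Sum>j\<in>{..i}. g j) mod q = (\<Sum>j\<in>{..i}. g' j) mod q" for i
    using assms by (metis (mono_tags, lifting) mod_sum_eq sum.cong)
  then show ?thesis unfolding coef_def by (metis periodic)
qed

lemma norm_coef: "norm (coef b) \<le> 1"
  unfolding coef_def by (rule norm_prod_le[THEN order_trans]) (simp add: bounded prod_le_1)

lemma lucas_U_pos:
  assumes "n > 0"
  shows "lucas_U P Q n > 0"
    and "ln (lucas_U P Q n) = real n * ln \<alpha> + ln (1 - \<rho> ^ n) - ln (\<alpha> - \<beta>)"
proof -
  have \<rho>n: "\<bar>\<rho> ^ n\<bar> < 1"
    using rho_less_1 assms by (simp add: power_abs power_less_one_iff)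
  have U: "lucas_U P Q n = \<alpha> ^ n * (1 - \<rho> ^ n) / (\<alpha> - \<beta>)"
    using alpha_gt_1 unfolding lucas_U_def \<alpha>_def[symmetric] \<beta>_def[symmetric]
    by (simp add: \<rho>_def power_divide algebra_simps)
  have pos: "\<alpha> ^ n > 0" "1 - \<rho> ^ n > 0" "\<alpha> - \<beta> > 0"
    using alpha_gt_1 \<rho>n beta_less by auto
  then show "lucas_U P Q n > 0" unfolding U by simp
  show "ln (lucas_U P Q n) = real n * ln \<alpha> + ln (1 - \<rho> ^ n) - ln (\<alpha> - \<beta>)"
    unfolding U using pos alpha_gt_1 by (simp add: ln_div ln_mult_pos ln_realpow)
qed

text \<open>The n-th Lucas number is a product of the positive reals \<open>\<alpha> ^ n\<close>,
  \<open>1 - \<rho> ^ n\<close> and \<open>1 / (\<alpha> - \<beta>)\<close>, so the principal power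
  splits without any branch correction. Only the middle factor needs a series.\<close>

lemma lucas_U_powr:
  assumes "n > 0"
  shows "1 / complex_of_real (lucas_U P Q n) powr s =
    exp (of_real (ln (\<alpha> - \<beta>)) * s) * exp (- of_real (ln \<alpha>) * s) ^ n *
      (\<Sum>\<^sub>\<infinity>k. negbin s k * (of_real \<rho> ^ n) ^ k)"
proof -
  have \<rho>n: "\<bar>\<rho> ^ n\<bar> < 1"
    using rho_less_1 assms by (simp add: power_abs power_less_one_iff)
  have "norm (complex_of_real \<rho> ^ n) < 1"
    using \<rho>n by (simp add: norm_power power_abs)
  then have "(\<Sum>\<^sub>\<infinity>k. negbin s k * (of_real \<rho> ^ n) ^ k) = (1 - of_real \<rho> ^ n) powr (- s)"
    by (rule infsum_negbin)
  also have "1 - complex_of_real \<rho> ^ n = of_real (1 - \<rho> ^ n)" by simp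
  also have "complex_of_real (1 - \<rho> ^ n) powr (- s) = exp (- s * of_real (ln (1 - \<rho> ^ n)))"
    using \<rho>n by (simp add: powr_def Ln_of_real del: of_real_diff)
  finally have 1: "(\<Sum>\<^sub>\<infinity>k. negbin s k * (of_real \<rho> ^ n) ^ k) = exp (- s * of_real (ln (1 - \<rho> ^ n)))" .
  have "1 / complex_of_real (lucas_U P Q n) powr s = exp (- s * of_real (ln (lucas_U P Q n)))"
    using lucas_U_pos(1)[OF assms] by (simp add: powr_def Ln_of_real exp_minus divide_inverse)
  also have "\<dots> = exp (of_real (ln (\<alpha> - \<beta>)) * s) * exp (- of_real (ln \<alpha>) * s) ^ n *
      exp (- s * of_real (ln (1 - \<rho> ^ n)))"
    unfolding lucas_U_pos(2)[OF assms] exp_of_nat_mult[symmetric] exp_add[symmetric]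
    by (simp add: algebra_simps)
  finally show ?thesis unfolding 1 .
qed

lemma tail_ratio_prod:
  "(\<Prod>i\<in>{l..}. exp (- of_real (ln \<alpha>) * s $ i) * of_real \<rho> ^ k i) = tail_ratio s l (\<Sum>i\<in>{l..}. k i)"
  by (simp add: tail_ratio_def prod.distrib power_sum sum_distrib_left
      flip: exp_sum sum_negf)

lemma norm_tail_ratio:
  "norm (tail_ratio s l K) = exp (- ln \<alpha> * (\<Sum>i\<in>{l..}. Re (s $ i))) * \<bar>\<rho>\<bar> ^ K"
  by (simp add: tail_ratio_def norm_mult norm_power)

lemma norm_tail_ratio_less_1:
  assumes "s \<in> lucas_L_region"
  shows "norm (tail_ratio s l K) < 1"
proof -
  have "exp (- ln \<alpha> * (\<Sum>i\<in>{l..}. Re (s $ i))) < 1"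
    using assms ln_alpha_pos by (simp add: lucas_L_region_def)
  moreover have "\<bar>\<rho>\<bar> ^ K \<le> 1" using rho_less_1 by (simp add: power_le_one)
  ultimately have "exp (- ln \<alpha> * (\<Sum>i\<in>{l..}. Re (s $ i))) * \<bar>\<rho>\<bar> ^ K < 1 * 1"
    using rho_nz by (intro mult_less_le_imp_less) auto
  then show ?thesis by (simp add: norm_tail_ratio)
qed

lemma lucas_L_series_term:
  assumes "\<And>i. n i > 0"
  shows "(\<Prod>i\<in>UNIV. \<psi> i (n i) / complex_of_real (lucas_U P Q (n i)) powr (s $ i)) =
    disc_factor s * (\<Sum>\<^sub>\<infinity>k. binom_coeff s k * (\<Prod>i\<in>UNIV. \<psi> i (n i)) *
      (\<Prod>i\<in>UNIV. (exp (- of_real (ln \<alpha>) * s $ i) * of_real \<rho> ^ k i) ^ n i))"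
proof -
  let ?e = "\<lambda>i. exp (- of_real (ln \<alpha>) * s $ i)"
  let ?f = "\<lambda>i k. negbin (s $ i) k * (complex_of_real \<rho> ^ n i) ^ k"
  have abs: "?f i abs_summable_on UNIV" for i
    by (rule negbin_abs_summable)
       (use rho_less_1 assms[of i] in \<open>simp add: norm_power power_less_one_iff\<close>)
  have "(\<Prod>i\<in>UNIV. \<psi> i (n i) / complex_of_real (lucas_U P Q (n i)) powr (s $ i)) =
    (\<Prod>i\<in>UNIV. exp (of_real (ln (\<alpha> - \<beta>)) * s $ i) * (\<psi> i (n i) * ?e i ^ n i * infsum (?f i) UNIV))"
  proof (rule prod.cong[OF refl])
    fix i
    have "\<psi> i (n i) / complex_of_real (lucas_U P Q (n i)) powr (s $ i) =
        \<psi> i (n i) * (1 / complex_of_real (lucas_U P Q (n i)) powr (s $ i))" by simp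
    then show "\<psi> i (n i) / complex_of_real (lucas_U P Q (n i)) powr (s $ i) =
      exp (of_real (ln (\<alpha> - \<beta>)) * s $ i) * (\<psi> i (n i) * ?e i ^ n i * infsum (?f i) UNIV)"
      unfolding lucas_U_powr[OF assms[of i]] by (simp only: mult_ac)
  qed
  also have "\<dots> = disc_factor s * ((\<Prod>i\<in>UNIV. \<psi> i (n i)) * (\<Prod>i\<in>UNIV. ?e i ^ n i) *
      (\<Prod>i\<in>UNIV. infsum (?f i) UNIV))"
    by (simp add: prod.distrib disc_factor_def exp_sum sum_distrib_left)
  also have "(\<Prod>i\<in>UNIV. infsum (?f i) UNIV) = (\<Sum>\<^sub>\<infinity>k\<in>PiE UNIV (\<lambda>_. UNIV). \<Prod>i\<in>UNIV. ?f i (k i))"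
    using infsum_prod_PiE_abs[of UNIV ?f "\<lambda>_. UNIV"] abs by simp
  also have "PiE UNIV (\<lambda>_. UNIV) = (UNIV :: ('d \<Rightarrow> nat) set)" by (auto simp: PiE_UNIV_eq)
  also have "(\<Prod>i\<in>UNIV. \<psi> i (n i)) * (\<Prod>i\<in>UNIV. ?e i ^ n i) * (\<Sum>\<^sub>\<infinity>k. \<Prod>i\<in>UNIV. ?f i (k i)) =
    (\<Sum>\<^sub>\<infinity>k. binom_coeff s k * (\<Prod>i\<in>UNIV. \<psi> i (n i)) * (\<Prod>i\<in>UNIV. (?e i * of_real \<rho> ^ k i) ^ n i))"
    unfolding infsum_cmult_right'[symmetric]
  proof (rule infsum_cong)
    fix k :: "'d \<Rightarrow> nat"
    have "(\<Prod>i\<in>UNIV. ?f i (k i)) = binom_coeff s k * (\<Prod>i\<in>UNIV. (of_real \<rho> ^ k i) ^ n i)"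
      by (simp add: binom_coeff_def prod.distrib mult.commute flip: power_mult)
    then show "(\<Prod>i\<in>UNIV. \<psi> i (n i)) * (\<Prod>i\<in>UNIV. ?e i ^ n i) * (\<Prod>i\<in>UNIV. ?f i (k i)) =
      binom_coeff s k * (\<Prod>i\<in>UNIV. \<psi> i (n i)) * (\<Prod>i\<in>UNIV. (?e i * of_real \<rho> ^ k i) ^ n i)"
      by (simp only: power_mult_distrib prod.distrib mult_ac)
  qed
  finally show ?thesis .
qed

text \<open>The sum over gaps has to be done first, for fixed exponents, where it is geometric with
  periodic coefficients. The interchange needs a majorant that separates gaps from
  exponents.\<close>

theorem lucas_L_series_eq_continuation:
  assumes s: "s \<in> lucas_L_region"
  shows "lucas_L_series P Q \<psi> s = continuation s"
proof -
  let ?e = "\<lambda>i. exp (- of_real (ln \<alpha>) * s $ i)"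
  let ?\<Gamma> = "{g :: 'd \<Rightarrow> nat. \<forall>j. 1 \<le> g j}"
  let ?n = "\<lambda>g i. \<Sum>j\<in>{..i::'d}. g j :: nat"
  define T where "T g k = binom_coeff s k * coef g *
    (\<Prod>i\<in>UNIV. (?e i * of_real \<rho> ^ k i) ^ ?n g i)" for g k
  have n_pos: "?n g i > 0" if "g \<in> ?\<Gamma>" for g i
    using that by (simp add: sum_atMost_split Suc_le_eq)
  have T_eq: "T g k = binom_coeff s k * (coef g * (\<Prod>j\<in>UNIV. tail_ratio s j (\<Sum>i\<in>{j..}. k i) ^ g j))" for g k
    unfolding T_def prod_power_head_sums tail_ratio_prod by (simp only: mult.assoc)
  \<comment> \<open>The norm of \<open>tail_ratio s j 0\<close>.\<close>
  define r where "r j = exp (- ln \<alpha> * (\<Sum>i\<in>{j..}. Re (s $ i)))" for j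
  have r: "0 < r j" "r j < 1" for j
    using s ln_alpha_pos by (simp_all add: lucas_L_region_def r_def)
  have "(\<lambda>(g, k). T g k) summable_on ?\<Gamma> \<times> UNIV"
  proof (rule abs_summable_times)
    have "(\<lambda>g. \<Prod>j\<in>UNIV. complex_of_real (r j) ^ g j) abs_summable_on PiE UNIV (\<lambda>_. {1::nat..})"
      by (rule abs_summable_on_prod_PiE[OF finite geometric_abs_summable])
         (use r in \<open>simp add: less_le\<close>)
    also have "PiE UNIV (\<lambda>_. {1::nat..}) = ?\<Gamma>" by (auto simp: PiE_UNIV_eq)
    finally show "(\<lambda>g. \<Prod>j\<in>UNIV. r j ^ g j) summable_on ?\<Gamma>"
      using r by (simp add: norm_power less_imp_le flip: prod_norm)
    have "(\<lambda>k. \<Prod>i\<in>UNIV. negbin (s $ i) (k i) * complex_of_real \<rho> ^ k i) abs_summable_on PiE UNIV (\<lambda>_. UNIV)"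
      by (rule abs_summable_on_prod_PiE[OF finite negbin_abs_summable]) (use rho_less_1 in simp)
    also have "PiE UNIV (\<lambda>_. UNIV) = (UNIV :: ('d \<Rightarrow> nat) set)" by (auto simp: PiE_UNIV_eq)
    finally show "(\<lambda>k. norm (binom_coeff s k) * (\<Prod>i\<in>UNIV. \<bar>\<rho>\<bar> ^ k i)) summable_on UNIV"
      by (simp add: binom_coeff_def norm_mult norm_power prod.distrib flip: prod_norm)
    show "0 \<le> (\<Prod>j\<in>UNIV. r j ^ g j)" for g using r by (simp add: prod_nonneg less_imp_le)
    show "0 \<le> norm (binom_coeff s k) * (\<Prod>i\<in>UNIV. \<bar>\<rho>\<bar> ^ k i)" for k by (simp add: prod_nonneg)
    fix g k assume g: "g \<in> ?\<Gamma>"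
    have "norm (\<Prod>i\<in>UNIV. (?e i * of_real \<rho> ^ k i) ^ ?n g i) =
      (\<Prod>i\<in>UNIV. norm (?e i) ^ ?n g i) * (\<Prod>i\<in>UNIV. (\<bar>\<rho>\<bar> ^ k i) ^ ?n g i)"
      by (simp add: norm_mult norm_power power_mult_distrib prod.distrib flip: prod_norm)
    also have "(\<Prod>i\<in>UNIV. norm (?e i) ^ ?n g i) = (\<Prod>j\<in>UNIV. r j ^ g j)"
      unfolding prod_power_head_sums
      by (simp add: r_def sum_distrib_left flip: exp_sum sum_negf)
    \<comment> \<open>Every index is at least 1, so one factor
      \<open>\<bar>\<rho>\<bar> ^ k i\<close> can be kept and the others dropped; what remains no
      longer involves \<open>g\<close>.\<close>
    also have "(\<Prod>i\<in>UNIV. (\<bar>\<rho>\<bar> ^ k i) ^ ?n g i) \<le> (\<Prod>i\<in>UNIV. \<bar>\<rho>\<bar> ^ k i)"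
    proof (intro prod_mono conjI)
      fix i
      have "(\<bar>\<rho>\<bar> ^ k i) ^ ?n g i \<le> (\<bar>\<rho>\<bar> ^ k i) ^ 1"
        by (rule power_decreasing) (use n_pos[OF g, of i] rho_less_1 in \<open>auto simp: power_le_one Suc_le_eq\<close>)
      then show "(\<bar>\<rho>\<bar> ^ k i) ^ ?n g i \<le> \<bar>\<rho>\<bar> ^ k i" by simp
    qed simp
    finally have 1: "norm (\<Prod>i\<in>UNIV. (?e i * of_real \<rho> ^ k i) ^ ?n g i) \<le>
      (\<Prod>j\<in>UNIV. r j ^ g j) * (\<Prod>i\<in>UNIV. \<bar>\<rho>\<bar> ^ k i)"
      using r by (simp add: mult_left_mono prod_nonneg less_imp_le)
    have "norm (T g k) \<le> norm (binom_coeff s k) * 1 * ((\<Prod>j\<in>UNIV. r j ^ g j) * (\<Prod>i\<in>UNIV. \<bar>\<rho>\<bar> ^ k i))"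
      unfolding T_def norm_mult using 1 norm_coef
      by (intro mult_mono) (auto intro!: mult_nonneg_nonneg prod_nonneg)
    then show "norm (case (g, k) of (g, k) \<Rightarrow> T g k) \<le>
      (\<Prod>j\<in>UNIV. r j ^ g j) * (norm (binom_coeff s k) * (\<Prod>i\<in>UNIV. \<bar>\<rho>\<bar> ^ k i))"
      by (simp add: mult_ac)
  qed
  note swap = infsum_swap_banach[OF this]
  have "lucas_L_series P Q \<psi> s = (\<Sum>\<^sub>\<infinity>g\<in>?\<Gamma>. \<Prod>i\<in>UNIV. \<psi> i (?n g i) /
      complex_of_real (lucas_U P Q (?n g i)) powr (s $ i))"
    unfolding lucas_L_series_def by (rule infsum_reindex_bij_betw[OF bij_betw_head_sums, symmetric])
  also have "\<dots> = (\<Sum>\<^sub>\<infinity>g\<in>?\<Gamma>. disc_factor s * (\<Sum>\<^sub>\<infinity>k. T g k))"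
    unfolding T_def coef_def by (rule infsum_cong, rule lucas_L_series_term, rule n_pos)
  also have "\<dots> = disc_factor s * (\<Sum>\<^sub>\<infinity>k. \<Sum>\<^sub>\<infinity>g\<in>?\<Gamma>. T g k)"
    by (simp only: infsum_cmult_right' swap)
  also have "\<dots> = continuation s"
    unfolding T_eq infsum_cmult_right' continuation_def residues_def
    by (simp only: infsum_periodic_coeffs[OF q_pos norm_tail_ratio_less_1[OF s] coef_cong])
  finally show ?thesis .
qed

end

section \<open>The meromorphic continuation\<close>

lemma negbin_nonneg:
  fixes r :: real
  assumes "r \<ge> 0"
  shows "0 \<le> negbin r k"
  using order_trans[OF norm_ge_zero norm_negbin_le[of "of_real r" r k]] assms by simp

lemma negbin_real_abs_summable:
  fixes z r :: real
  assumes "\<bar>z\<bar> < 1" "r \<ge> 0" "z \<ge> 0"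
  shows "(\<lambda>k. negbin r k * z ^ k) abs_summable_on UNIV"
proof -
  have "norm (negbin r k * z ^ k) = negbin r k * z ^ k" for k
    using negbin_nonneg[OF assms(2)] assms(3) by simp
  then have "summable (\<lambda>k. norm (norm (negbin r k * z ^ k)))"
    using negbin_real_summable[OF assms(1), of r] by simp
  then show ?thesis by (rule norm_summable_imp_summable_on)
qed

lemma holomorphic_multi_on_negbin: "holomorphic_multi_on (\<lambda>s. negbin (s $ i) k) A"
  unfolding negbin_def pochhammer_prod divide_inverse by (intro holomorphic_multi_intros)

text \<open>The quotient of \<open>1 - z ^ n\<close> by \<open>1 - z\<close>, in a form that has the
  value n at z = 1.\<close>

definition q_integer :: "nat \<Rightarrow> complex \<Rightarrow> complex" where
  "q_integer n z = (\<Sum>i<n. z ^ i)"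

lemma norm_q_integer_le:
  assumes "norm z \<le> Y" "1 \<le> Y" "n \<le> q"
  shows "norm (q_integer n z) \<le> real q * Y ^ q"
proof -
  have "norm (q_integer n z) \<le> (\<Sum>i<n. norm (z ^ i))"
    unfolding q_integer_def by (rule norm_sum)
  also have "\<dots> \<le> (\<Sum>i<n. Y ^ q)"
  proof (rule sum_mono)
    fix i assume "i \<in> {..<n}"
    have "norm (z ^ i) \<le> Y ^ i" using assms(1) by (simp add: norm_power power_mono)
    also have "\<dots> \<le> Y ^ q" using assms \<open>i \<in> {..<n}\<close> by (intro power_increasing) auto
    finally show "norm (z ^ i) \<le> Y ^ q" .
  qed
  also have "\<dots> \<le> real q * Y ^ q" using assms by (simp add: mult_right_mono)
  finally show ?thesis .
qed

context lucas_L_setup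
begin

text \<open>Numerator and denominator of \<open>y ^ b / (1 - y ^ q)\<close> at \<open>y = tail_ratio s l K\<close>.  When \<open>p l K\<close> holds,
  \<open>y ^ b\<close> is replaced by \<open>y ^ b - e ^ b\<close> for a sign \<open>e = e l K\<close> with \<open>e ^ q = 1\<close>, and the common factor
  \<open>1 - e y\<close> is cancelled.\<close>

definition num :: "('d \<Rightarrow> nat \<Rightarrow> bool) \<Rightarrow> ('d \<Rightarrow> nat \<Rightarrow> complex) \<Rightarrow> (complex, 'd) vec \<Rightarrow> 'd \<Rightarrow> nat \<Rightarrow> nat \<Rightarrow> complex"
  where "num p e s l K b = (if p l K then - (e l K ^ b * q_integer b (e l K * tail_ratio s l K))
    else tail_ratio s l K ^ b)"

definition den :: "('d \<Rightarrow> nat \<Rightarrow> bool) \<Rightarrow> ('d \<Rightarrow> nat \<Rightarrow> complex) \<Rightarrow> (complex, 'd) vec \<Rightarrow> 'd \<Rightarrow> nat \<Rightarrow> complex"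
  where "den p e s l K = (if p l K then q_integer q (e l K * tail_ratio s l K)
    else 1 - tail_ratio s l K ^ q)"

text \<open>On a fixed ball and for a large cutoff \<open>N\<close>, the factors with K > N have no
  zeros, so the product can be finite.\<close>

definition denom where
  "denom p e N s = (\<Prod>l\<in>UNIV. \<Prod>K\<in>{..N}. den p e s l K)"

text \<open>The block of \<open>denom\<close> at \<open>l\<close> times \<open>num / den\<close>.
  For K \<le> N, where \<open>den\<close> may vanish, its factor is left out of the product instead
  of being divided by.\<close>

definition cleared where
  "cleared p e N s l K b = num p e s l K b * (\<Prod>K'\<in>{..N} - {K}. den p e s l K') /
     (if K \<le> N then 1 else den p e s l K)"

definition numer where
  "numer p e N s = disc_factor s * (\<Sum>\<^sub>\<infinity>k. binom_coeff s k * (\<Sum>b\<in>residues. coef b *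
     (\<Prod>l\<in>UNIV. cleared p e N s l (\<Sum>i\<in>{l..}. k i) (b l))))"

text \<open>Bounds \<open>tail_ratio s l 0\<close> on \<open>ball 0 r\<close>: a tail has at most
  \<open>CARD('d)\<close> entries, each with real part at least - r.\<close>

definition growth :: "real \<Rightarrow> real" where
  "growth r = exp (ln \<alpha> * (real CARD('d) * r))"

lemma growth_ge_1: "r \<ge> 0 \<Longrightarrow> growth r \<ge> 1"
  using ln_alpha_pos by (simp add: growth_def)

lemma norm_tail_ratio_le:
  assumes "s \<in> ball 0 r"
  shows "norm (tail_ratio s l K) \<le> growth r * \<bar>\<rho>\<bar> ^ K"
proof -
  have "- Re (s $ i) \<le> r" for i
    using assms abs_Re_le_cmod[of "s $ i"] Finite_Cartesian_Product.norm_nth_le[of s i] by simp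
  then have "(\<Sum>i\<in>{l..}. - Re (s $ i)) \<le> (\<Sum>i\<in>{l..}. r)" by (intro sum_mono)
  also have "\<dots> \<le> real CARD('d) * r"
  proof -
    have "card {l..} \<le> CARD('d)" by (rule card_mono) auto
    moreover have "r \<ge> 0" using assms norm_ge_zero[of s] by (simp del: norm_ge_zero)
    ultimately show ?thesis by (simp add: mult_right_mono)
  qed
  finally have "ln \<alpha> * (\<Sum>i\<in>{l..}. - Re (s $ i)) \<le> ln \<alpha> * (real CARD('d) * r)"
    using ln_alpha_pos by (simp only: mult_le_cancel_left_pos)
  then have "exp (- ln \<alpha> * (\<Sum>i\<in>{l..}. Re (s $ i))) \<le> growth r"
    by (simp add: growth_def sum_negf)
  then show ?thesis by (simp add: norm_tail_ratio mult_right_mono)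
qed

lemma norm_tail_ratio_le_growth:
  assumes "s \<in> ball 0 r"
  shows "norm (tail_ratio s l K) \<le> growth r"
proof -
  have "growth r * \<bar>\<rho>\<bar> ^ K \<le> growth r * 1"
    using rho_less_1 by (intro mult_left_mono) (auto simp: growth_def power_le_one)
  then show ?thesis using norm_tail_ratio_le[OF assms, of l K] by simp
qed

text \<open>The bound 1 / 2 keeps \<open>1 - y ^ q\<close> away from 0 beyond the cutoff;
  \<open>N0\<close> lets the cutoff also exceed given polar indices.\<close>

lemma large_cutoff_exists:
  obtains N where "N \<ge> N0" "growth r * \<bar>\<rho>\<bar> ^ Suc N \<le> 1 / 2"
proof -
  have g: "growth r > 0" by (simp add: growth_def)
  have "(\<lambda>n. growth r * \<bar>\<rho>\<bar> ^ n) \<longlonglongrightarrow> growth r * 0"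
    using rho_less_1 by (intro tendsto_intros LIMSEQ_power_zero) auto
  then have "\<forall>\<^sub>F n in sequentially. growth r * \<bar>\<rho>\<bar> ^ n < 1 / 2"
    by (rule order_tendstoD) simp
  then obtain n0 where n0: "\<And>n. n \<ge> n0 \<Longrightarrow> growth r * \<bar>\<rho>\<bar> ^ n < 1 / 2"
    unfolding eventually_sequentially by blast
  show ?thesis
    by (rule that[of "max N0 n0", OF _ less_imp_le[OF n0]]) auto
qed

lemma tail_ratio_small:
  assumes "s \<in> ball 0 r" "growth r * \<bar>\<rho>\<bar> ^ Suc N \<le> 1 / 2" "K > N"
  shows "norm (tail_ratio s l K) \<le> 1 / 2"
proof -
  have "\<bar>\<rho>\<bar> ^ K \<le> \<bar>\<rho>\<bar> ^ Suc N"
    using assms(3) rho_less_1 by (intro power_decreasing) auto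
  then have "growth r * \<bar>\<rho>\<bar> ^ K \<le> growth r * \<bar>\<rho>\<bar> ^ Suc N"
    by (intro mult_left_mono) (auto simp: growth_def)
  then show ?thesis using norm_tail_ratio_le[OF assms(1), of l K] assms(2) by linarith
qed

lemma norm_one_minus_power_ge:
  assumes "norm (y :: complex) \<le> 1 / 2"
  shows "1 / 2 \<le> norm (1 - y ^ q)"
proof -
  have "norm y ^ q \<le> norm y ^ 1"
    using assms q_pos by (intro power_decreasing) auto
  then have "norm (y ^ q) \<le> 1 / 2" using assms by (simp add: norm_power)
  then show ?thesis using norm_triangle_ineq2[of 1 "y ^ q"] by simp
qed

lemma holomorphic_tail_ratio: "holomorphic_multi_on (\<lambda>s. tail_ratio s l K) A"
  unfolding tail_ratio_def by (intro holomorphic_multi_intros)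

lemma holomorphic_num: "holomorphic_multi_on (\<lambda>s. num p e s l K b) A"
proof -
  have "holomorphic_multi_on (\<lambda>s. (- (e l K ^ b)) * q_integer b (e l K * tail_ratio s l K)) A"
    unfolding q_integer_def by (intro holomorphic_multi_intros holomorphic_tail_ratio)
  then show ?thesis
    by (cases "p l K") (simp_all add: num_def holomorphic_multi_on_power holomorphic_tail_ratio)
qed

lemma holomorphic_den: "holomorphic_multi_on (\<lambda>s. den p e s l K) A"
  by (cases "p l K") (auto simp: den_def q_integer_def intro!: holomorphic_multi_intros holomorphic_tail_ratio)

lemma holomorphic_denom: "holomorphic_multi_on (denom p e N) A"
  unfolding denom_def by (intro holomorphic_multi_intros holomorphic_den)

lemma holomorphic_disc_factor: "holomorphic_multi_on disc_factor A"
  unfolding disc_factor_def by (intro holomorphic_multi_intros)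

lemma holomorphic_binom_coeff: "holomorphic_multi_on (\<lambda>s. binom_coeff s k) A"
  unfolding binom_coeff_def by (intro holomorphic_multi_intros holomorphic_multi_on_negbin)

lemma disc_factor_nz: "disc_factor s \<noteq> 0"
  by (simp add: disc_factor_def)

lemma norm_den_le:
  assumes "s \<in> ball 0 r" "r \<ge> 0" "\<And>l K. norm (e l K) = 1"
  shows "norm (den p e s l K) \<le> 1 + real q * growth r ^ q"
proof -
  note g = growth_ge_1[OF assms(2)] and y = norm_tail_ratio_le_growth[OF assms(1), of l K]
  have "norm (tail_ratio s l K) ^ q \<le> growth r ^ q" using y by (intro power_mono) auto
  moreover have "growth r ^ q \<le> real q * growth r ^ q"
    using q_pos g by (intro mult_le_cancel_right1[THEN iffD2]) (auto simp: Suc_le_eq)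
  moreover have "norm (1 - tail_ratio s l K ^ q) \<le> 1 + norm (tail_ratio s l K) ^ q"
    using norm_triangle_ineq4[of 1 "tail_ratio s l K ^ q"] by (simp add: norm_power)
  moreover have "norm (q_integer q (e l K * tail_ratio s l K)) \<le> real q * growth r ^ q"
    by (rule norm_q_integer_le) (use y g assms(3) in \<open>simp_all add: norm_mult\<close>)
  ultimately show ?thesis by (auto simp: den_def)
qed

text \<open>The factor \<open>\<bar>\<rho>\<bar> ^ K\<close> is what later makes the sum over k
  converge.\<close>

lemma norm_num_le:
  assumes "s \<in> ball 0 r" "r \<ge> 0" "\<And>l K. norm (e l K) = 1" "\<And>l K. p l K \<Longrightarrow> K \<le> N"
    and b: "1 \<le> b" "b \<le> q"
  shows "norm (num p e s l K b) \<le> real q * growth r ^ q / \<bar>\<rho>\<bar> ^ N * \<bar>\<rho>\<bar> ^ K"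
proof (cases "p l K")
  case True
  \<comment> \<open>A reduced numerator need not decay with K, but K \<le> N, so the factor is
    obtained at the cost of the constant \<open>1 / \<bar>\<rho>\<bar> ^ N\<close>.\<close>
  have "\<bar>\<rho>\<bar> ^ N \<le> \<bar>\<rho>\<bar> ^ K"
    using assms(4)[OF True] rho_less_1 by (intro power_decreasing) auto
  then have "1 \<le> \<bar>\<rho>\<bar> ^ K / \<bar>\<rho>\<bar> ^ N" using rho_nz by simp
  moreover have "norm (num p e s l K b) \<le> real q * growth r ^ q"
    using norm_q_integer_le[of "e l K * tail_ratio s l K" "growth r" b q] b
      norm_tail_ratio_le_growth[OF assms(1), of l K] growth_ge_1[OF assms(2)] True
    by (simp add: num_def norm_mult norm_power assms(3))
  moreover have "0 \<le> real q * growth r ^ q" by (simp add: growth_def)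
  ultimately have "norm (num p e s l K b) * 1 \<le> real q * growth r ^ q * (\<bar>\<rho>\<bar> ^ K / \<bar>\<rho>\<bar> ^ N)"
    by (intro mult_mono) auto
  then show ?thesis by (simp add: field_simps)
next
  case False
  have g: "growth r \<ge> 1" by (rule growth_ge_1[OF assms(2)])
  have "norm (num p e s l K b) \<le> (growth r * \<bar>\<rho>\<bar> ^ K) ^ b"
    using False norm_tail_ratio_le[OF assms(1), of l K]
    by (simp add: num_def norm_power power_mono)
  also have "\<dots> = growth r ^ b * (\<bar>\<rho>\<bar> ^ K) ^ b" by (rule power_mult_distrib)
  also have "\<dots> \<le> growth r ^ q * (\<bar>\<rho>\<bar> ^ K) ^ 1"
    using g b rho_less_1
    by (intro mult_mono power_increasing power_decreasing) (auto simp: power_le_one)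
  also have "\<dots> \<le> (real q * growth r ^ q / \<bar>\<rho>\<bar> ^ N) * (\<bar>\<rho>\<bar> ^ K) ^ 1"
  proof (rule mult_right_mono)
    have "1 \<le> real q / \<bar>\<rho>\<bar> ^ N"
    proof -
      have "\<bar>\<rho>\<bar> ^ N \<le> 1" using rho_less_1 by (intro power_le_one) auto
      also have "1 \<le> real q" using q_pos by simp
      finally show ?thesis using rho_nz by simp
    qed
    then have "growth r ^ q * 1 \<le> growth r ^ q * (real q / \<bar>\<rho>\<bar> ^ N)"
      by (intro mult_left_mono) (auto simp: growth_def)
    then show "growth r ^ q \<le> real q * growth r ^ q / \<bar>\<rho>\<bar> ^ N" by (simp add: mult.commute)
  qed simp
  finally show ?thesis by simp
qed

lemma cleared_bound:
  assumes "r \<ge> 0" "\<And>l K. norm (e l K) = 1" "\<And>l K. p l K \<Longrightarrow> K \<le> N"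
    and N: "growth r * \<bar>\<rho>\<bar> ^ Suc N \<le> 1 / 2"
  shows "\<exists>C\<ge>0. \<forall>s\<in>ball 0 r. \<forall>l K b. 1 \<le> b \<longrightarrow> b \<le> q \<longrightarrow>
    norm (cleared p e N s l K b) \<le> C * \<bar>\<rho>\<bar> ^ K"
proof (intro exI conjI ballI allI impI)
  define M where "M = real q * growth r ^ q / \<bar>\<rho>\<bar> ^ N"
  define D where "D = 1 + real q * growth r ^ q"
  have M: "M \<ge> 0" and D: "D \<ge> 1" by (auto simp: M_def D_def growth_def)
  show "M * D ^ Suc N * 2 \<ge> 0" using M D by simp
  fix s :: "(complex, 'd) vec" and l K b
  assume s: "s \<in> ball 0 r" and b: "1 \<le> b" "b \<le> q"
  have 1: "norm (num p e s l K b) \<le> M * \<bar>\<rho>\<bar> ^ K"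
    unfolding M_def by (rule norm_num_le[OF s assms(1,2,3) b])
  have "norm (\<Prod>K'\<in>{..N} - {K}. den p e s l K') \<le> (\<Prod>K'\<in>{..N} - {K}. D)"
    unfolding D_def prod_norm[symmetric] using norm_den_le[OF s assms(1,2)] by (intro prod_mono) auto
  also have "\<dots> \<le> D ^ Suc N"
  proof -
    have "card ({..N} - {K}) \<le> card {..N}" by (rule card_mono) auto
    then show ?thesis using D power_increasing[of "card ({..N} - {K})" "Suc N" D] by simp
  qed
  finally have 2: "norm (\<Prod>K'\<in>{..N} - {K}. den p e s l K') \<le> D ^ Suc N" .
  have 3: "norm (1 / (if K \<le> N then 1 else den p e s l K)) \<le> 2"
  proof (cases "K \<le> N")
    case False
    then have "\<not> p l K" using assms(3) by blast
    moreover have "1 / 2 \<le> norm (1 - tail_ratio s l K ^ q)"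
      by (rule norm_one_minus_power_ge[OF tail_ratio_small[OF s N]]) (use False in simp)
    ultimately show ?thesis using False by (simp add: den_def norm_divide divide_simps)
  qed simp
  have "norm (cleared p e N s l K b) = norm (num p e s l K b) *
      norm (\<Prod>K'\<in>{..N} - {K}. den p e s l K') * norm (1 / (if K \<le> N then 1 else den p e s l K))"
    by (simp add: cleared_def norm_mult norm_divide)
  also have "\<dots> \<le> (M * \<bar>\<rho>\<bar> ^ K) * D ^ Suc N * 2"
    using 1 2 3 M D by (intro mult_mono) auto
  finally show "norm (cleared p e N s l K b) \<le> M * D ^ Suc N * 2 * \<bar>\<rho>\<bar> ^ K"
    by (simp only: mult_ac)
qed

text \<open>A termwise majorant on the ball. No divisor has to be excluded, since
  \<open>cleared\<close> divides only by denominators beyond the cutoff.\<close>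

theorem holomorphic_numer:
  assumes r: "r \<ge> 0" and e: "\<And>l K. norm (e l K) = 1" and p: "\<And>l K. p l K \<Longrightarrow> K \<le> N"
    and N: "growth r * \<bar>\<rho>\<bar> ^ Suc N \<le> 1 / 2"
  shows "holomorphic_multi_on (numer p e N) (ball 0 r)"
proof -
  obtain C where C: "C \<ge> 0"
    "\<And>s l K b. s \<in> ball 0 r \<Longrightarrow> 1 \<le> b \<Longrightarrow> b \<le> q \<Longrightarrow> norm (cleared p e N s l K b) \<le> C * \<bar>\<rho>\<bar> ^ K"
    using cleared_bound[of r e p N, OF r e _ N] p by blast
  define t where "t k s = binom_coeff s k * (\<Sum>b\<in>residues. coef b *
     (\<Prod>l\<in>UNIV. cleared p e N s l (\<Sum>i\<in>{l..}. k i) (b l)))" for k s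
  have "holomorphic_multi_on (\<lambda>s. \<Sum>\<^sub>\<infinity>k. t k s) (ball 0 r)"
  proof (rule holomorphic_multi_on_infsum)
    show "infinite (UNIV :: ('d \<Rightarrow> nat) set)"
      by (simp add: finite_UNIV_fun)
    have hc: "holomorphic_multi_on (\<lambda>s. cleared p e N s l K b) (ball 0 r)" for l K b
      unfolding cleared_def
    proof (intro holomorphic_multi_on_divide holomorphic_multi_intros holomorphic_num holomorphic_den)
      show "holomorphic_multi_on (\<lambda>s. if K \<le> N then 1 else den p e s l K) (ball 0 r)"
        by (cases "K \<le> N") (simp_all add: holomorphic_multi_on_const holomorphic_den)
      show "(if K \<le> N then 1 else den p e z l K) \<noteq> 0" if z: "z \<in> ball 0 r" for z
      proof (cases "K \<le> N")
        case False
        then have "\<not> p l K" using p by blast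
        moreover have "1 / 2 \<le> norm (1 - tail_ratio z l K ^ q)"
          by (rule norm_one_minus_power_ge[OF tail_ratio_small[OF z N]]) (use False in simp)
        ultimately show ?thesis using False by (auto simp: den_def)
      qed simp
    qed
    show "holomorphic_multi_on (t k) (ball 0 r)" for k
      unfolding t_def by (intro holomorphic_multi_intros holomorphic_binom_coeff hc)
    show "norm (t k s) \<le> (\<Prod>i\<in>UNIV. negbin r (k i) * \<bar>\<rho>\<bar> ^ k i) * (real (card residues) * C ^ CARD('d))"
      if s: "s \<in> ball 0 r" for k s
    proof -
      have "norm (s $ i) \<le> r" for i
        using s Finite_Cartesian_Product.norm_nth_le[of s i] by simp
      then have 1: "norm (binom_coeff s k) \<le> (\<Prod>i\<in>UNIV. negbin r (k i))"
        unfolding binom_coeff_def prod_norm[symmetric] by (intro prod_mono) (auto intro: norm_negbin_le)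
      have "norm (\<Sum>b\<in>residues. coef b * (\<Prod>l\<in>UNIV. cleared p e N s l (\<Sum>i\<in>{l..}. k i) (b l))) \<le>
        real (card residues) * (C ^ CARD('d) * (\<Prod>l\<in>UNIV. \<bar>\<rho>\<bar> ^ k l))"
      proof (rule sum_norm_bound)
        fix b assume b: "b \<in> residues"
        have "norm (\<Prod>l\<in>UNIV. cleared p e N s l (\<Sum>i\<in>{l..}. k i) (b l)) \<le> (\<Prod>l\<in>UNIV. C * \<bar>\<rho>\<bar> ^ k l)"
          unfolding prod_norm[symmetric]
        proof (intro prod_mono conjI)
          fix l
          have "1 \<le> b l" "b l \<le> q" using b by (auto simp: residues_def PiE_iff)
          then have "norm (cleared p e N s l (\<Sum>i\<in>{l..}. k i) (b l)) \<le> C * \<bar>\<rho>\<bar> ^ (\<Sum>i\<in>{l..}. k i)"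
            using C(2)[OF s] by blast
          \<comment> \<open>The tail sum at \<open>l\<close> contains \<open>k l\<close>. The
            product over all \<open>l\<close> thus supplies one power
            \<open>\<bar>\<rho>\<bar> ^ k i\<close> for each coordinate, enough for the binomial
            majorant to be summable.\<close>
          also have "\<dots> \<le> C * \<bar>\<rho>\<bar> ^ k l"
            using C(1) rho_less_1
            by (intro mult_left_mono power_decreasing) (auto simp: sum_atLeast_split)
          finally show "norm (cleared p e N s l (\<Sum>i\<in>{l..}. k i) (b l)) \<le> C * \<bar>\<rho>\<bar> ^ k l" .
        qed simp
        then have "norm (coef b) * norm (\<Prod>l\<in>UNIV. cleared p e N s l (\<Sum>i\<in>{l..}. k i) (b l)) \<le>
            1 * (C ^ CARD('d) * (\<Prod>l\<in>UNIV. \<bar>\<rho>\<bar> ^ k l))"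
          using norm_coef[of b] by (intro mult_mono) (auto simp: prod.distrib)
        then show "norm (coef b * (\<Prod>l\<in>UNIV. cleared p e N s l (\<Sum>i\<in>{l..}. k i) (b l))) \<le>
            C ^ CARD('d) * (\<Prod>l\<in>UNIV. \<bar>\<rho>\<bar> ^ k l)" by (simp add: norm_mult)
      qed
      then have "norm (t k s) \<le> (\<Prod>i\<in>UNIV. negbin r (k i)) *
          (real (card residues) * (C ^ CARD('d) * (\<Prod>l\<in>UNIV. \<bar>\<rho>\<bar> ^ k l)))"
        unfolding t_def norm_mult using 1 by (intro mult_mono) (auto intro!: prod_nonneg negbin_nonneg r)
      then show ?thesis by (simp add: prod.distrib mult_ac)
    qed
    have "(\<lambda>k. \<Prod>i\<in>UNIV. negbin r (k i) * \<bar>\<rho>\<bar> ^ k i) abs_summable_on PiE (UNIV :: 'd set) (\<lambda>_. UNIV)"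
      by (rule abs_summable_on_prod_PiE[OF finite negbin_real_abs_summable]) (use rho_less_1 r in auto)
    also have "PiE UNIV (\<lambda>_. UNIV) = (UNIV :: ('d \<Rightarrow> nat) set)" by (auto simp: PiE_UNIV_eq)
    finally show "(\<lambda>k. (\<Prod>i\<in>(UNIV :: 'd set). negbin r (k i) * \<bar>\<rho>\<bar> ^ k i) *
        (real (card residues) * C ^ CARD('d))) summable_on UNIV"
      by (intro summable_on_cmult_left) (rule abs_summable_summable)
  qed simp
  then have "holomorphic_multi_on (\<lambda>s. disc_factor s * (\<Sum>\<^sub>\<infinity>k. t k s)) (ball 0 r)"
    by (intro holomorphic_multi_intros holomorphic_disc_factor)
  then show ?thesis by (simp add: numer_def[abs_def] t_def)
qed

lemma denom_mult_fraction:
  assumes "\<And>K. den p e s l K \<noteq> 0"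
  shows "(\<Prod>K'\<in>{..N}. den p e s l K') * (num p e s l K b / den p e s l K) = cleared p e N s l K b"
proof (cases "K \<le> N")
  case True
  then have "(\<Prod>K'\<in>{..N}. den p e s l K') = den p e s l K * (\<Prod>K'\<in>{..N} - {K}. den p e s l K')"
    by (intro prod.remove) auto
  then show ?thesis using True assms[of K] by (simp add: cleared_def)
next
  case False
  then have "{..N} - {K} = {..N}" by auto
  then show ?thesis using False by (simp add: cleared_def)
qed

text \<open>A reduced fraction differs from the original one; only the sums over \<open>b\<close>
  agree. The second hypothesis asks for just that: it is immediate when nothing is reduced, and
  otherwise follows from vanishing residues.\<close>

lemma continuation_times_denom:
  assumes "\<And>l K. den p e s l K \<noteq> 0"
    and "\<And>k. (\<Sum>b\<in>residues. coef b * (\<Prod>l\<in>UNIV. tail_ratio s l (\<Sum>i\<in>{l..}. k i) ^ b l /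
          (1 - tail_ratio s l (\<Sum>i\<in>{l..}. k i) ^ q))) =
        (\<Sum>b\<in>residues. coef b * (\<Prod>l\<in>UNIV. num p e s l (\<Sum>i\<in>{l..}. k i) (b l) /
          den p e s l (\<Sum>i\<in>{l..}. k i)))"
  shows "continuation s * denom p e N s = numer p e N s"
proof -
  have *: "denom p e N s * (binom_coeff s k * (\<Sum>b\<in>residues. coef b * (\<Prod>l\<in>UNIV.
        num p e s l (\<Sum>i\<in>{l..}. k i) (b l) / den p e s l (\<Sum>i\<in>{l..}. k i)))) =
     binom_coeff s k * (\<Sum>b\<in>residues. coef b *
        (\<Prod>l\<in>UNIV. cleared p e N s l (\<Sum>i\<in>{l..}. k i) (b l)))" for k
    unfolding denom_mult_fraction[OF assms(1), symmetric] prod.distrib denom_def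
    by (simp add: sum_distrib_left mult_ac)
  have "(\<Sum>\<^sub>\<infinity>k. denom p e N s * (binom_coeff s k * (\<Sum>b\<in>residues. coef b * (\<Prod>l\<in>UNIV.
        num p e s l (\<Sum>i\<in>{l..}. k i) (b l) / den p e s l (\<Sum>i\<in>{l..}. k i))))) =
     (\<Sum>\<^sub>\<infinity>k. binom_coeff s k * (\<Sum>b\<in>residues. coef b *
        (\<Prod>l\<in>UNIV. cleared p e N s l (\<Sum>i\<in>{l..}. k i) (b l))))"
    by (rule infsum_cong) (rule *)
  then show ?thesis
    unfolding continuation_def numer_def assms(2) infsum_cmult_right' by (simp add: mult_ac)
qed

abbreviation plain_denom where "plain_denom \<equiv> denom (\<lambda>_ _. False) (\<lambda>_ _. 1)"
abbreviation plain_numer where "plain_numer \<equiv> numer (\<lambda>_ _. False) (\<lambda>_ _. 1)"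

lemma plain_denom_nonzero:
  assumes "s \<in> ball 0 r" "growth r * \<bar>\<rho>\<bar> ^ Suc N \<le> 1 / 2" "plain_denom N s \<noteq> 0"
  shows "tail_ratio s l K ^ q \<noteq> 1"
proof (cases "K \<le> N")
  case True
  then show ?thesis using assms(3) by (auto simp: denom_def den_def)
next
  case False
  then have "1 / 2 \<le> norm (1 - tail_ratio s l K ^ q)"
    by (intro norm_one_minus_power_ge[OF tail_ratio_small[OF assms(1,2)]]) simp
  then show ?thesis by auto
qed

lemma plain_denom_region:
  assumes "s \<in> lucas_L_region"
  shows "plain_denom N s \<noteq> 0"
proof -
  have "tail_ratio s l K ^ q \<noteq> 1" for l K
  proof -
    have "norm (tail_ratio s l K ^ q) < 1"
      using norm_tail_ratio_less_1[OF assms] q_pos by (simp add: norm_power power_less_one_iff)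
    then show ?thesis by auto
  qed
  then show ?thesis by (simp add: denom_def den_def)
qed

lemma continuation_times_plain_denom:
  assumes "s \<in> ball 0 r" "growth r * \<bar>\<rho>\<bar> ^ Suc N \<le> 1 / 2" "plain_denom N s \<noteq> 0"
  shows "continuation s * plain_denom N s = plain_numer N s"
  by (rule continuation_times_denom)
     (use plain_denom_nonzero[OF assms] in \<open>simp_all add: den_def num_def\<close>)

lemma region_point: "(\<chi> i. 1) \<in> (lucas_L_region :: (complex, 'd) vec set)"
proof -
  have "card {j..} > 0" for j :: 'd by (subst card_gt_0_iff) auto
  then show ?thesis by (simp add: lucas_L_region_def)
qed

lemma open_region: "open (lucas_L_region :: (complex, 'd) vec set)"
proof -
  have "lucas_L_region = (\<Inter>j::'d. {s. 0 < (\<Sum>i\<in>{j..}. Re (s $ i))})"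
    by (auto simp: lucas_L_region_def)
  also have "open \<dots>"
    by (intro open_INT finite ballI open_Collect_less continuous_intros)
  finally show ?thesis .
qed

text \<open>The ball has to contain the point (1, ..., 1) of the convergence region, where no
  denominator vanishes.\<close>

lemma plain_denom_dense:
  assumes "r > norm (\<chi> i. 1 :: (complex, 'd) vec)"
  shows "dense_on (ball 0 r) (\<lambda>s. plain_denom N s \<noteq> 0)"
  unfolding dense_on_def
  by (rule holomorphic_multi_nonzero_dense[OF holomorphic_denom open_ball convex_ball _
        plain_denom_region[OF region_point]]) (use assms in simp)

lemma continuation_meromorphic: "meromorphic_multi_on continuation UNIV"
  unfolding meromorphic_multi_on_def
proof
  fix z :: "(complex, 'd) vec"
  define r where "r = norm z + norm (\<chi> i. 1 :: (complex, 'd) vec) + 1"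
  obtain N where N: "growth r * \<bar>\<rho>\<bar> ^ Suc N \<le> 1 / 2" by (rule large_cutoff_exists)
  have r0: "r \<ge> 0" by (simp add: r_def add_nonneg_nonneg)
  show "\<exists>W g h. open W \<and> z \<in> W \<and> holomorphic_multi_on g W \<and> holomorphic_multi_on h W \<and>
    W \<subseteq> closure {w \<in> W. h w \<noteq> 0} \<and> (\<forall>w\<in>W. h w \<noteq> 0 \<longrightarrow> continuation w = g w / h w)"
  proof (intro exI conjI ballI impI)
    show "z \<in> ball 0 r" by (simp add: r_def add_nonneg_pos)
    show "holomorphic_multi_on (plain_numer N) (ball 0 r)"
      by (rule holomorphic_numer[OF r0 _ _ N]) auto
    show "ball 0 r \<subseteq> closure {w \<in> ball 0 r. plain_denom N w \<noteq> 0}"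
      using plain_denom_dense[of r N] by (simp add: dense_on_def r_def add_nonneg_pos)
    show "continuation w = plain_numer N w / plain_denom N w"
      if "w \<in> ball 0 r" "plain_denom N w \<noteq> 0" for w
      using continuation_times_plain_denom[OF that(1) N that(2)] that(2) by (simp add: field_simps)
  qed (simp_all add: holomorphic_denom)
qed

lemma continuation_holomorphic_region:
  assumes "s \<in> lucas_L_region"
  shows "holomorphic_multi_at continuation s"
proof -
  define r where "r = norm s + 1"
  obtain N where N: "growth r * \<bar>\<rho>\<bar> ^ Suc N \<le> 1 / 2" by (rule large_cutoff_exists)
  have r0: "r \<ge> 0" by (simp add: r_def)
  let ?W = "{w \<in> ball 0 r. plain_denom N w \<noteq> 0}"
  have W: "open ?W"
    by (rule open_nonzero[OF open_ball holomorphic_multi_on_continuous[OF holomorphic_denom]])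
  have "holomorphic_multi_on (plain_numer N) (ball 0 r)"
    by (rule holomorphic_numer[OF r0 _ _ N]) auto
  then have "holomorphic_multi_on (\<lambda>w. plain_numer N w / plain_denom N w) ?W"
    by (intro holomorphic_multi_on_divide holomorphic_denom)
       (auto intro: holomorphic_multi_on_subset)
  then have "holomorphic_multi_on continuation ?W"
  proof (rule holomorphic_multi_on_cong[OF W, rotated])
    fix w assume "w \<in> ?W"
    then show "plain_numer N w / plain_denom N w = continuation w"
      using continuation_times_plain_denom[of w r N, OF _ N] by (simp add: field_simps)
  qed
  moreover have "s \<in> ?W" using plain_denom_region[OF assms] by (simp add: r_def)
  ultimately show ?thesis unfolding holomorphic_multi_at_def using W by blast
qed

lemma multiple_lucas_L_nice: "nicely_meromorphic_multi_on (multiple_lucas_L P Q \<psi>) UNIV"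
  and multiple_lucas_L_dense: "dense_on UNIV (\<lambda>s. multiple_lucas_L P Q \<psi> s = continuation s)"
  using multiple_lucas_L_continuation[OF continuation_meromorphic continuation_holomorphic_region
      lucas_L_series_eq_continuation[symmetric] open_region] region_point by blast+

end

section \<open>Terms at a nonsingular point\<close>

lemma sum_powers_roots_unity:
  assumes "0 < d" "d < q"
  shows "(\<Sum>z | z ^ q = (1::complex). z ^ d) = 0"
proof -
  let ?Z = "{z. z ^ q = (1::complex)}"
  have fin: "finite ?Z" using assms by (intro finite_roots_unity) auto
  \<comment> \<open>As d < q, some q-th root of unity w has \<open>w ^ d \<noteq> 1\<close>;
    multiplication by it permutes \<open>?Z\<close> but scales the sum by
    \<open>w ^ d\<close>.\<close>
  have "card {z. z ^ d = (1::complex)} < card ?Z"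
    using assms card_complex_roots_unity[of d] card_complex_roots_unity[of q] by simp
  moreover have "finite {z. z ^ d = (1::complex)}" using assms by (intro finite_roots_unity) auto
  ultimately have "\<not> ?Z \<subseteq> {z. z ^ d = (1::complex)}" using card_mono linorder_not_le by blast
  then obtain w :: complex where w: "w ^ q = 1" "w ^ d \<noteq> 1" by blast
  have w0: "w \<noteq> 0" using w assms by (auto simp: power_0_left)
  have "(\<Sum>z\<in>?Z. z ^ d) = (\<Sum>z\<in>?Z. (w * z) ^ d)"
    by (rule sum.reindex_bij_witness[of _ "\<lambda>z. w * z" "\<lambda>z. z / w"])
       (use w w0 in \<open>auto simp: power_mult_distrib power_divide\<close>)
  also have "\<dots> = w ^ d * (\<Sum>z\<in>?Z. z ^ d)"
    by (simp add: power_mult_distrib sum_distrib_left)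
  finally have "(1 - w ^ d) * (\<Sum>z\<in>?Z. z ^ d) = 0"
    by (simp add: left_diff_distrib)
  then show ?thesis using w by simp
qed

lemma roots_unity_orthogonal:
  assumes "b \<in> {1..q}" "b' \<in> {1..q}"
  shows "(\<Sum>z | z ^ q = (1::complex). z ^ b / z ^ b') = (if b = b' then of_nat q else 0)"
proof -
  let ?Z = "{z. z ^ q = (1::complex)}"
  have nz: "z \<noteq> 0" if "z \<in> ?Z" for z using that assms by (auto simp: power_0_left)
  consider "b = b'" | "b' < b" | "b < b'" by linarith
  then show ?thesis
  proof cases
    case 1
    then have "(\<Sum>z\<in>?Z. z ^ b / z ^ b') = (\<Sum>z\<in>?Z. 1)" using nz by (intro sum.cong) auto
    then show ?thesis using 1 assms card_complex_roots_unity[of q] by simp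
  next
    case 2
    then have "(\<Sum>z\<in>?Z. z ^ b / z ^ b') = (\<Sum>z\<in>?Z. z ^ (b - b'))"
      using nz by (intro sum.cong) (auto simp: power_diff)
    then show ?thesis using 2 assms sum_powers_roots_unity[of "b - b'" q] by auto
  next
    case 3
    \<comment> \<open>The exponent b - b' is negative; adding q brings it strictly between 0 and
      q.\<close>
    have "(\<Sum>z\<in>?Z. z ^ b / z ^ b') = (\<Sum>z\<in>?Z. z ^ (q - (b' - b)))"
    proof (rule sum.cong[OF refl])
      fix z assume z: "z \<in> ?Z"
      have "z ^ (q - (b' - b)) * z ^ b' = z ^ (q + b)"
        using 3 assms by (simp flip: power_add)
      also have "\<dots> = z ^ b" using z by (simp add: power_add)
      finally show "z ^ b / z ^ b' = z ^ (q - (b' - b))" using nz[OF z] by (simp add: field_simps)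
    qed
    then show ?thesis using 3 assms sum_powers_roots_unity[of "q - (b' - b)" q] by auto
  qed
qed

text \<open>Fourier inversion on the cyclic group of order q, with 1..q representing the
  residues.\<close>

lemma roots_unity_expansion:
  fixes a :: "nat \<Rightarrow> complex"
  obtains c where "\<And>b. b \<in> {1..q} \<Longrightarrow> a b = (\<Sum>z | z ^ q = (1::complex). c z * z ^ b)"
proof
  define c where "c z = (\<Sum>b'\<in>{1..q}. a b' / z ^ b') / of_nat q" for z :: complex
  fix b assume b: "b \<in> {1..q}"
  have "(\<Sum>z | z ^ q = (1::complex). c z * z ^ b) =
      (\<Sum>z | z ^ q = (1::complex). \<Sum>b'\<in>{1..q}. a b' / of_nat q * (z ^ b / z ^ b'))"
    by (intro sum.cong refl) (simp add: c_def sum_divide_distrib sum_distrib_left mult_ac)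
  also have "\<dots> = (\<Sum>b'\<in>{1..q}. a b' / of_nat q * (\<Sum>z | z ^ q = (1::complex). z ^ b / z ^ b'))"
    unfolding sum_distrib_left by (rule sum.swap)
  also have "\<dots> = (\<Sum>b'\<in>{1..q}. if b = b' then a b' else 0)"
    by (rule sum.cong[OF refl]) (use b roots_unity_orthogonal[OF b] in auto)
  also have "\<dots> = a b" using b by simp
  finally show "a b = (\<Sum>z | z ^ q = (1::complex). c z * z ^ b)" ..
qed

lemma q_integer_mult: "(1 - z) * q_integer n z = 1 - z ^ n"
  unfolding q_integer_def by (rule one_diff_power_eq[symmetric])

context lucas_L_setup
begin

text \<open>\<open>residue_vanishes l \<epsilon>\<close> says that every term of \<open>continuation\<close> is regular along
  \<open>tail_ratio s l K = \<epsilon>\<close>.\<close>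

definition residue_vanishes :: "'d \<Rightarrow> complex \<Rightarrow> bool" where
  "residue_vanishes l \<epsilon> \<longleftrightarrow>
    (\<forall>a. (\<Sum>b\<in>residues. coef b * (\<epsilon> ^ b l * (\<Prod>i\<in>UNIV - {l}. a i (b i)))) = 0)"

text \<open>Expanding every \<open>a i\<close> into characters \<open>b \<mapsto> z ^ b\<close>
  turns the sum into a combination of the sums in the hypothesis, one for each tuple of roots of
  unity with entry \<open>\<epsilon>\<close> at \<open>l0\<close>.\<close>

lemma residue_vanishesI:
  assumes "\<epsilon> ^ q = 1"
    and zero: "\<And>\<zeta>. (\<And>l. \<zeta> l ^ q = 1) \<Longrightarrow> \<zeta> l0 = \<epsilon> \<Longrightarrow>
      (\<Sum>b\<in>residues. coef b * (\<Prod>l\<in>UNIV. \<zeta> l ^ b l)) = 0"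
  shows "residue_vanishes l0 \<epsilon>"
  unfolding residue_vanishes_def
proof
  fix a :: "'d \<Rightarrow> nat \<Rightarrow> complex"
  have "\<forall>i. \<exists>c. \<forall>b\<in>{1..q}. a i b = (\<Sum>z | z ^ q = (1::complex). c z * z ^ b)"
    using roots_unity_expansion by metis
  then obtain c where c: "\<And>i b. b \<in> {1..q} \<Longrightarrow> a i b = (\<Sum>z | z ^ q = (1::complex). c i z * z ^ b)"
    by metis
  define Z where "Z l = (if l = l0 then {\<epsilon>} else {z. z ^ q = (1::complex)})" for l
  define c' where "c' l z = (if l = l0 then 1 else c l z)" for l z
  have finZ: "finite (Z l)" for l
    using q_pos by (auto simp: Z_def intro!: finite_roots_unity)
  have expand: "\<epsilon> ^ b l0 * (\<Prod>i\<in>UNIV - {l0}. a i (b i)) =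
      (\<Sum>\<zeta>\<in>PiE UNIV Z. (\<Prod>l\<in>UNIV. c' l (\<zeta> l)) * (\<Prod>l\<in>UNIV. \<zeta> l ^ b l))"
    if b: "b \<in> residues" for b
  proof -
    have "(\<Prod>l\<in>UNIV. \<Sum>z\<in>Z l. c' l z * z ^ b l) =
      (\<Sum>z\<in>Z l0. c' l0 z * z ^ b l0) * (\<Prod>l\<in>UNIV - {l0}. \<Sum>z\<in>Z l. c' l z * z ^ b l)"
      by (rule prod.remove) auto
    also have "(\<Sum>z\<in>Z l0. c' l0 z * z ^ b l0) = \<epsilon> ^ b l0" by (simp add: Z_def c'_def)
    also have "(\<Prod>l\<in>UNIV - {l0}. \<Sum>z\<in>Z l. c' l z * z ^ b l) = (\<Prod>i\<in>UNIV - {l0}. a i (b i))"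
    proof (rule prod.cong[OF refl])
      fix l assume "l \<in> UNIV - {l0}"
      moreover have "b l \<in> {1..q}" using b by (auto simp: residues_def PiE_iff)
      ultimately show "(\<Sum>z\<in>Z l. c' l z * z ^ b l) = a l (b l)" using c by (simp add: Z_def c'_def)
    qed
    finally show ?thesis by (simp add: prod_sum_PiE finZ prod.distrib)
  qed
  have "(\<Sum>b\<in>residues. coef b * (\<epsilon> ^ b l0 * (\<Prod>i\<in>UNIV - {l0}. a i (b i)))) =
    (\<Sum>b\<in>residues. \<Sum>\<zeta>\<in>PiE UNIV Z. (\<Prod>l\<in>UNIV. c' l (\<zeta> l)) * (coef b * (\<Prod>l\<in>UNIV. \<zeta> l ^ b l)))"
    by (rule sum.cong[OF refl]) (simp add: expand sum_distrib_left mult_ac)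
  also have "\<dots> = (\<Sum>\<zeta>\<in>PiE UNIV Z. (\<Prod>l\<in>UNIV. c' l (\<zeta> l)) *
      (\<Sum>b\<in>residues. coef b * (\<Prod>l\<in>UNIV. \<zeta> l ^ b l)))"
    unfolding sum_distrib_left by (rule sum.swap)
  also have "\<dots> = 0"
  proof (rule sum.neutral, rule ballI)
    fix \<zeta> assume \<zeta>: "\<zeta> \<in> PiE UNIV Z"
    then have \<zeta>Z: "\<zeta> l \<in> Z l" for l by (auto simp: PiE_iff)
    have "\<zeta> l0 = \<epsilon>" "\<zeta> l ^ q = 1" for l
      using \<zeta>Z[of l0] \<zeta>Z[of l] assms(1) by (auto simp: Z_def split: if_splits)
    then have "(\<Sum>b\<in>residues. coef b * (\<Prod>l\<in>UNIV. \<zeta> l ^ b l)) = 0" by (intro zero)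
    then show "(\<Prod>l\<in>UNIV. c' l (\<zeta> l)) * (\<Sum>b\<in>residues. coef b * (\<Prod>l\<in>UNIV. \<zeta> l ^ b l)) = 0" by simp
  qed
  finally show "(\<Sum>b\<in>residues. coef b * (\<epsilon> ^ b l0 * (\<Prod>i\<in>UNIV - {l0}. a i (b i)))) = 0" .
qed

text \<open>Changing the factor at one \<open>l\<close> alters the sum by \<open>c l\<close> times a
  sum as in \<open>residue_vanishes\<close>, whose other factors may have been changed before. This
  is why \<open>residue_vanishes\<close> quantifies over all \<open>a\<close>.\<close>

lemma drop_polar_parts:
  assumes "\<And>l. l \<in> J \<Longrightarrow> residue_vanishes l (\<epsilon> l)"
  shows "(\<Sum>b\<in>residues. coef b * (\<Prod>l\<in>UNIV. a l (b l))) =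
    (\<Sum>b\<in>residues. coef b * (\<Prod>l\<in>UNIV. if l \<in> J then a l (b l) - c l * \<epsilon> l ^ b l else a l (b l)))"
proof -
  have "finite J" by simp
  then show ?thesis using assms
  proof (induction J rule: finite_induct)
    case (insert l J)
    let ?f = "\<lambda>J b i. if i \<in> J then a i (b i) - c i * \<epsilon> i ^ b i else a i (b i)"
    have rest: "(\<Prod>i\<in>UNIV - {l}. ?f (insert l J) b i) = (\<Prod>i\<in>UNIV - {l}. ?f J b i)" for b
      by (rule prod.cong) auto
    have "(\<Prod>i\<in>UNIV. ?f (insert l J) b i) = (a l (b l) - c l * \<epsilon> l ^ b l) * (\<Prod>i\<in>UNIV - {l}. ?f J b i)" for b
      using prod.remove[of UNIV l "?f (insert l J) b"] rest by simp
    moreover have "(\<Prod>i\<in>UNIV. ?f J b i) = a l (b l) * (\<Prod>i\<in>UNIV - {l}. ?f J b i)" for b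
      using prod.remove[of UNIV l "?f J b"] insert.hyps by simp
    ultimately have "coef b * (\<Prod>i\<in>UNIV. ?f (insert l J) b i) = coef b * (\<Prod>i\<in>UNIV. ?f J b i) -
      c l * (coef b * (\<epsilon> l ^ b l * (\<Prod>i\<in>UNIV - {l}. ?f J b i)))" for b
      by (simp only: left_diff_distrib right_diff_distrib mult_ac)
    then have "(\<Sum>b\<in>residues. coef b * (\<Prod>i\<in>UNIV. ?f (insert l J) b i)) =
      (\<Sum>b\<in>residues. coef b * (\<Prod>i\<in>UNIV. ?f J b i)) -
      c l * (\<Sum>b\<in>residues. coef b * (\<epsilon> l ^ b l * (\<Prod>i\<in>UNIV - {l}. ?f J b i)))"
      unfolding sum_distrib_left sum_subtractf[symmetric] by (rule sum.cong[OF refl])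
    moreover have "(\<Sum>b\<in>residues. coef b * (\<epsilon> l ^ b l * (\<Prod>i\<in>UNIV - {l}. ?f J b i))) = 0"
      using insert.prems[of l]
        spec[of _ "\<lambda>i n. if i \<in> J then a i n - c i * \<epsilon> i ^ n else a i n"]
      unfolding residue_vanishes_def by fastforce
    ultimately show ?case using insert by simp
  qed simp
qed

text \<open>The bound of \<open>h\<close> by \<open>M\<close> keeps the binomial coefficient of the
  one contributing exponent tuple nonzero at the end point.\<close>

theorem nonsingular_imp_residue_vanishes:
  assumes F: "holomorphic_multi_at (multiple_lucas_L P Q \<psi>) s0"
    and polar: "tail_ratio s0 l0 h ^ q = 1"
    and M: "(\<Sum>i\<in>{l0..}. s0 $ i) = - of_real M" "real h \<le> M"
  shows "residue_vanishes l0 (tail_ratio s0 l0 h)"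
proof (rule residue_vanishesI[OF polar])
  fix \<zeta> :: "'d \<Rightarrow> complex"
  assume \<zeta>: "\<And>l. \<zeta> l ^ q = 1" and \<zeta>0: "\<zeta> l0 = tail_ratio s0 l0 h"
  have n\<zeta>: "norm (\<zeta> l) = 1" for l
    using \<zeta>[of l] q_pos by (metis norm_one norm_power norm_ge_zero power_eq_1_iff less_numeral_extra(3))
  then have \<zeta>_nz: "\<zeta> l \<noteq> 0" for l by (metis norm_zero zero_neq_one)
  \<comment> \<open>The tail sum at \<open>l0\<close> is that of \<open>s0\<close>, so the line to
    \<open>s1\<close> stays in the divisor. The others solve
    \<open>tail_ratio s1 l h = \<zeta> l\<close>, with the same \<open>h\<close> for every
    \<open>l\<close>.\<close>
  define T where "T l = (if l = l0 then (\<Sum>i\<in>{l0..}. s0 $ i)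
    else - Ln (\<zeta> l / of_real \<rho> ^ h) / of_real (ln \<alpha>))" for l
  obtain sf where sf: "\<And>l. (\<Sum>i\<in>{l..}. sf i) = T l"
    by (rule tail_sums_surj[of T]) (rule that)
  define s1 where "s1 = (\<chi> i. sf i)"
  have s1_sum: "(\<Sum>i\<in>{l..}. s1 $ i) = T l" for l by (simp add: s1_def sf)
  have s1: "tail_ratio s1 l h = \<zeta> l" for l
  proof (cases "l = l0")
    case True
    then show ?thesis by (simp add: tail_ratio_def s1_sum T_def \<zeta>0)
  next
    case False
    have "exp (Ln (\<zeta> l / of_real \<rho> ^ h)) = \<zeta> l / of_real \<rho> ^ h"
      using \<zeta>_nz rho_nz by (intro exp_Ln) simp
    then show ?thesis
      using False rho_nz ln_alpha_pos by (simp add: tail_ratio_def s1_sum T_def)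
  qed
  \<comment> \<open>All \<open>\<zeta> l\<close> have norm 1 and share the exponent
    \<open>h\<close>, so the real parts of all tail sums coincide.\<close>
  have ReT: "Re (T l) = - M" for l
  proof -
    have "norm (tail_ratio s1 l h) = norm (tail_ratio s1 l0 h)" by (simp add: s1 n\<zeta>)
    then have "exp (- ln \<alpha> * (\<Sum>i\<in>{l..}. Re (s1 $ i))) = exp (- ln \<alpha> * (\<Sum>i\<in>{l0..}. Re (s1 $ i)))"
      unfolding norm_tail_ratio using rho_nz by simp
    then have "(\<Sum>i\<in>{l..}. Re (s1 $ i)) = (\<Sum>i\<in>{l0..}. Re (s1 $ i))"
      using ln_alpha_pos by simp
    then have "Re (T l) = Re (T l0)" using s1_sum Re_sum by metis
    then show ?thesis using M(1) by (simp add: T_def)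
  qed
  have norm_s1: "norm (tail_ratio s1 l K) * \<bar>\<rho>\<bar> ^ h = \<bar>\<rho>\<bar> ^ K" for l K
  proof -
    have "exp (- ln \<alpha> * (\<Sum>i\<in>{l..}. Re (s1 $ i))) * \<bar>\<rho>\<bar> ^ h = 1"
      using n\<zeta>[of l] s1[of l] norm_tail_ratio[of s1 l h] by simp
    then show ?thesis by (simp add: norm_tail_ratio mult_ac)
  qed
  define r where "r = norm s0 + norm s1 + norm (\<chi> i. 1 :: (complex, 'd) vec) + 1"
  have r0: "r \<ge> 0" and r_s0: "s0 \<in> ball 0 r" and r_s1: "s1 \<in> ball 0 r"
    and r_1: "r > norm (\<chi> i. 1 :: (complex, 'd) vec)"
    by (simp_all add: r_def add_nonneg_nonneg add_nonneg_pos)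
  obtain N where hN: "h \<le> N" and N: "growth r * \<bar>\<rho>\<bar> ^ Suc N \<le> 1 / 2"
    by (rule large_cutoff_exists)
  have hol: "holomorphic_multi_on (plain_numer N) (ball 0 r)"
    by (rule holomorphic_numer[OF r0 _ _ N]) auto
  obtain V where V: "open V" "s0 \<in> V" "holomorphic_multi_on (multiple_lucas_L P Q \<psi>) V"
    using F unfolding holomorphic_multi_at_def by blast
  \<comment> \<open>The continued function is holomorphic on \<open>V\<close>, so its product with
    the denominator vanishes wherever the denominator does.\<close>
  have zero: "plain_numer N x = 0"
    if x: "x \<in> V" "x \<in> ball 0 r" "(\<Sum>i\<in>{l0..}. x $ i) = (\<Sum>i\<in>{l0..}. s0 $ i)" for x
  proof -
    have "multiple_lucas_L P Q \<psi> x * plain_denom N x = plain_numer N x"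
      by (rule continuation_times_denominator[OF multiple_lucas_L_dense V(1,3) open_ball hol
            holomorphic_denom plain_denom_dense[OF r_1]
            holomorphic_multi_on_continuous[OF holomorphic_denom] _ x(1,2)])
         (rule continuation_times_plain_denom[OF _ N])
    moreover have "den (\<lambda>_ _. False) (\<lambda>_ _. 1) x l0 h = 0"
      using polar x(3) by (simp add: den_def tail_ratio_def)
    then have "(\<Prod>K\<in>{..N}. den (\<lambda>_ _. False) (\<lambda>_ _. 1) x l0 K) = 0"
      using hN by (intro prod_zero) auto
    then have "plain_denom N x = 0" unfolding denom_def by (intro prod_zero) auto
    ultimately show ?thesis by simp
  qed
  have "open ((\<lambda>t::complex. s0 + t *s (s1 - s0)) -` (V \<inter> ball 0 r))"
    using continuous_on_line by (rule open_vimage[rotated]) (use V in blast)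
  moreover have "0 \<in> (\<lambda>t::complex. s0 + t *s (s1 - s0)) -` (V \<inter> ball 0 r)"
    using V(2) r_s0 by simp
  ultimately obtain \<delta> where \<delta>: "\<delta> > 0" "ball 0 \<delta> \<subseteq> (\<lambda>t::complex. s0 + t *s (s1 - s0)) -` (V \<inter> ball 0 r)"
    using open_contains_ball by blast
  have "plain_numer N s1 = 0"
  proof (rule holomorphic_multi_zero_on_line[OF hol open_ball convex_ball r_s0 r_s1 \<delta>(1)])
    fix t :: complex assume "norm t < \<delta>"
    then have "t \<in> ball 0 \<delta>" by (simp add: dist_norm)
    then have "s0 + t *s (s1 - s0) \<in> V \<inter> ball 0 r" using \<delta>(2) by blast
    moreover have "(\<Sum>i\<in>{l0..}. (s0 + t *s (s1 - s0)) $ i) = (\<Sum>i\<in>{l0..}. s0 $ i)"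
    proof -
      have "(\<Sum>i\<in>{l0..}. (s0 + t *s (s1 - s0)) $ i) =
        (\<Sum>i\<in>{l0..}. s0 $ i) + t * ((\<Sum>i\<in>{l0..}. s1 $ i) - (\<Sum>i\<in>{l0..}. s0 $ i))"
        by (simp add: sum.distrib sum_subtractf right_diff_distrib flip: sum_distrib_left)
      then show ?thesis by (simp add: s1_sum T_def)
    qed
    ultimately show "plain_numer N (s0 + t *s (s1 - s0)) = 0" using zero by blast
  qed
  \<comment> \<open>Concentrating \<open>h\<close> at the last index makes every tail sum equal to
    \<open>h\<close>.\<close>
  moreover define k1 where "k1 i = (if i = Max UNIV then h else 0)" for i :: 'd
  have k1_sum: "(\<Sum>i\<in>{l..}. k1 i) = h" for l
    by (simp add: k1_def)
  let ?cl = "\<lambda>l K b. cleared (\<lambda>_ _. False) (\<lambda>_ _. 1) N s1 l K b"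
  let ?t = "\<lambda>k. binom_coeff s1 k * (\<Sum>b\<in>residues. coef b * (\<Prod>l\<in>UNIV. ?cl l (\<Sum>i\<in>{l..}. k i) (b l)))"
  \<comment> \<open>Any other k has a tail sum different from \<open>h\<close>; the product in
    \<open>cleared\<close> then retains the denominator at \<open>h\<close>, which vanishes at
    \<open>s1\<close>.\<close>
  have "(\<Sum>\<^sub>\<infinity>k. ?t k) = infsum ?t {k1}"
  proof (rule infsum_cong_neutral)
    fix k assume "k \<in> UNIV - {k1}"
    then obtain l where l: "(\<Sum>i\<in>{l..}. k i) \<noteq> h"
      using tail_sums_inj[of k k1] k1_sum by auto
    have "(\<Prod>K'\<in>{..N} - {\<Sum>i\<in>{l..}. k i}. den (\<lambda>_ _. False) (\<lambda>_ _. 1) s1 l K') = 0"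
      using hN l s1 \<zeta> by (intro prod_zero) (auto simp: den_def intro!: bexI[of _ h])
    then have "?cl l (\<Sum>i\<in>{l..}. k i) b = 0" for b by (simp add: cleared_def)
    then have "(\<Prod>l\<in>UNIV. ?cl l (\<Sum>i\<in>{l..}. k i) (b l)) = 0" for b by (intro prod_zero) auto
    then show "?t k = 0" by (simp only: mult_zero_right sum.neutral_const)
  qed auto
  then have "plain_numer N s1 = disc_factor s1 * ?t k1" by (simp add: numer_def)
  moreover have "binom_coeff s1 k1 \<noteq> 0"
  proof -
    \<comment> \<open>The last coordinate of \<open>s1\<close> has real part - M \<le> - h, so no
      factor \<open>s1 $ i + j\<close> with j < h can vanish.\<close>
    have "negbin (s1 $ i) (k1 i) \<noteq> 0" for i
    proof (cases "i = Max UNIV")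
      case True
      have "{i..} = {i}" using True by (auto intro: antisym)
      then have s1i: "s1 $ i = T i" using s1_sum[of i] by simp
      have "T i + of_nat j \<noteq> 0" if "j < h" for j
      proof
        assume "T i + of_nat j = 0"
        then have "Re (T i + of_nat j) = 0" by simp
        then show False using ReT[of i] M(2) that by simp
      qed
      then have "pochhammer (s1 $ i) h \<noteq> 0"
        unfolding s1i pochhammer_prod by simp
      then show ?thesis using True by (simp add: negbin_def k1_def)
    next
      case False
      then show ?thesis by (simp add: negbin_def k1_def)
    qed
    then show ?thesis by (simp add: binom_coeff_def)
  qed
  ultimately have "(\<Sum>b\<in>residues. coef b * (\<Prod>l\<in>UNIV. ?cl l h (b l))) = 0"
    using disc_factor_nz by (simp add: k1_sum)
  \<comment> \<open>The denominators other than the one at \<open>h\<close>. They are nonzero at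
    \<open>s1\<close>, because \<open>norm_s1\<close> allows norm 1 only for the exponent
    \<open>h\<close>.\<close>
  moreover define C where "C l = (\<Prod>K'\<in>{..N} - {h}. 1 - tail_ratio s1 l K' ^ q)" for l
  have "?cl l h b = \<zeta> l ^ b * C l" for l b
    using hN by (simp add: cleared_def num_def den_def C_def s1)
  ultimately have "(\<Prod>l\<in>UNIV. C l) * (\<Sum>b\<in>residues. coef b * (\<Prod>l\<in>UNIV. \<zeta> l ^ b l)) = 0"
    by (simp add: prod.distrib sum_distrib_left mult_ac)
  moreover have "C l \<noteq> 0" for l
    unfolding C_def
  proof (subst prod_zero_iff, simp, rule notI, elim bexE)
    fix K assume K: "K \<in> {..N} - {h}" and "1 - tail_ratio s1 l K ^ q = 0"
    then have "tail_ratio s1 l K ^ q = 1" by simp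
    then have "norm (tail_ratio s1 l K) = 1"
      using q_pos by (metis norm_one norm_power norm_ge_zero power_eq_1_iff less_numeral_extra(3))
    then have eq: "\<bar>\<rho>\<bar> ^ h = \<bar>\<rho>\<bar> ^ K" using norm_s1[of l K] by simp
    have "K < h \<or> h < K" using K by auto
    then show False
      using eq power_strict_decreasing[of K h "\<bar>\<rho>\<bar>"] power_strict_decreasing[of h K "\<bar>\<rho>\<bar>"]
        rho_less_1 rho_nz by auto
  qed
  ultimately show "(\<Sum>b\<in>residues. coef b * (\<Prod>l\<in>UNIV. \<zeta> l ^ b l)) = 0" by simp
qed

end

section \<open>Rationality of the value\<close>

locale quadratic_irrational =
  fixes w :: complex
  assumes square_rational: "w * w \<in> \<rat>" and irrational: "w \<notin> \<rat>"
begin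

text \<open>The graph of the nontrivial automorphism of the field generated by \<open>w\<close>. As
  a relation on complex numbers it needs no subfield type, and closure under field operations
  becomes a set of introduction rules; irrationality of \<open>w\<close> makes it
  single-valued.\<close>

definition conjugate :: "complex \<Rightarrow> complex \<Rightarrow> bool" where
  "conjugate x x' \<longleftrightarrow> (\<exists>a\<in>\<rat>. \<exists>b\<in>\<rat>. x = a + b * w \<and> x' = a - b * w)"

lemma conjugateI: "a \<in> \<rat> \<Longrightarrow> b \<in> \<rat> \<Longrightarrow> x = a + b * w \<Longrightarrow> x' = a - b * w \<Longrightarrow> conjugate x x'"
  unfolding conjugate_def by blast

lemma conjugate_rat: "a \<in> \<rat> \<Longrightarrow> conjugate a a"
  by (rule conjugateI[of _ 0]) auto

lemma conjugate_gen: "conjugate w (- w)"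
  by (rule conjugateI[of 0 1]) auto

lemma conjugate_add:
  assumes "conjugate x x'" "conjugate y y'"
  shows "conjugate (x + y) (x' + y')"
proof -
  obtain a b where ab: "a \<in> \<rat>" "b \<in> \<rat>" "x = a + b * w" "x' = a - b * w"
    using assms(1) unfolding conjugate_def by blast
  obtain c d where cd: "c \<in> \<rat>" "d \<in> \<rat>" "y = c + d * w" "y' = c - d * w"
    using assms(2) unfolding conjugate_def by blast
  show ?thesis
    by (rule conjugateI[of "a + c" "b + d"]) (use ab cd in \<open>auto simp: algebra_simps\<close>)
qed

lemma conjugate_mult:
  assumes "conjugate x x'" "conjugate y y'"
  shows "conjugate (x * y) (x' * y')"
proof -
  obtain a b where ab: "a \<in> \<rat>" "b \<in> \<rat>" "x = a + b * w" "x' = a - b * w"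
    using assms(1) unfolding conjugate_def by blast
  obtain c d where cd: "c \<in> \<rat>" "d \<in> \<rat>" "y = c + d * w" "y' = c - d * w"
    using assms(2) unfolding conjugate_def by blast
  show ?thesis
    by (rule conjugateI[of "a * c + b * d * (w * w)" "a * d + b * c"])
       (use ab cd square_rational in \<open>auto simp: algebra_simps intro!: Rats_add Rats_mult\<close>)
qed

lemma conjugate_sum: "(\<And>i. i \<in> I \<Longrightarrow> conjugate (f i) (f' i)) \<Longrightarrow> conjugate (sum f I) (sum f' I)"
  by (induction I rule: infinite_finite_induct) (auto intro: conjugate_add conjugate_rat)

lemma conjugate_prod: "(\<And>i. i \<in> I \<Longrightarrow> conjugate (f i) (f' i)) \<Longrightarrow> conjugate (prod f I) (prod f' I)"
  by (induction I rule: infinite_finite_induct) (auto intro: conjugate_mult conjugate_rat)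

lemma conjugate_power: "conjugate x x' \<Longrightarrow> conjugate (x ^ n) (x' ^ n)"
  by (induction n) (auto intro: conjugate_mult conjugate_rat)

lemma conjugate_diff: "conjugate x x' \<Longrightarrow> conjugate y y' \<Longrightarrow> conjugate (x - y) (x' - y')"
  using conjugate_add[of x x' "- 1 * y" "- 1 * y'"] conjugate_mult[OF conjugate_rat[of "- 1"], of y y']
  by auto

lemma rational_combination_zero:
  assumes "a \<in> \<rat>" "b \<in> \<rat>" "a + b * w = 0"
  shows "a = 0 \<and> b = 0"
proof -
  have "b = 0"
  proof (rule ccontr)
    assume "b \<noteq> 0"
    then have "w = - a / b" using assms(3) by (simp add: field_simps eq_neg_iff_add_eq_0)
    then show False using assms irrational by auto
  qed
  then show ?thesis using assms(3) by simp
qed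

text \<open>The norm \<open>x * x'\<close> is rational, and it is nonzero because 1 and
  \<open>w\<close> are independent over the rationals.\<close>

lemma conjugate_inverse:
  assumes "conjugate x x'" "x \<noteq> 0"
  shows "conjugate (1 / x) (1 / x')"
proof -
  obtain a b where ab: "a \<in> \<rat>" "b \<in> \<rat>" "x = a + b * w" "x' = a - b * w"
    using assms(1) unfolding conjugate_def by blast
  have "x' \<noteq> 0"
    using rational_combination_zero[of a "- b"] ab assms(2) by auto
  have N: "x * x' = a * a - b * b * (w * w)" unfolding ab(3,4) by (simp add: algebra_simps)
  then have NQ: "x * x' \<in> \<rat>" using ab square_rational by auto
  show ?thesis
  proof (rule conjugateI[of "a / (x * x')" "- b / (x * x')"])
    have "1 / x = x' / (x * x')" using \<open>x' \<noteq> 0\<close> by simp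
    then show "1 / x = a / (x * x') + - b / (x * x') * w"
      using ab(4) by (simp add: diff_divide_distrib)
    have "1 / x' = x / (x * x')" using \<open>x \<noteq> 0\<close> by simp
    then show "1 / x' = a / (x * x') - - b / (x * x') * w"
      using ab(3) by (simp add: add_divide_distrib)
  qed (use ab NQ in auto)
qed

lemma conjugate_divide:
  "conjugate x x' \<Longrightarrow> conjugate y y' \<Longrightarrow> y \<noteq> 0 \<Longrightarrow> conjugate (x / y) (x' / y')"
  using conjugate_mult[OF _ conjugate_inverse, of x x' y y'] by simp

lemma conjugate_unique:
  assumes "conjugate x x'" "conjugate x x''"
  shows "x' = x''"
proof -
  obtain a b where ab: "a \<in> \<rat>" "b \<in> \<rat>" "x = a + b * w" "x' = a - b * w"
    using assms(1) unfolding conjugate_def by blast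
  obtain c d where cd: "c \<in> \<rat>" "d \<in> \<rat>" "x = c + d * w" "x'' = c - d * w"
    using assms(2) unfolding conjugate_def by blast
  have "a - c = 0 \<and> b - d = 0"
    by (rule rational_combination_zero) (use ab cd in \<open>auto simp: algebra_simps\<close>)
  then show ?thesis using ab cd by simp
qed

lemma conjugate_self: "conjugate x x \<Longrightarrow> x \<in> \<rat>"
  using irrational by (auto simp: conjugate_def)

end

locale lucas_L_rational = lucas_L_setup P Q q \<psi>
  for P Q :: real and q :: nat and \<psi> :: "'d::{finite,linorder} \<Rightarrow> nat \<Rightarrow> complex" +
  assumes P_rat: "P \<in> \<rat>" and Q_rat: "Q \<in> \<rat>" and sqrt_disc_irrational: "sqrt (lucas_disc P Q) \<notin> \<rat>"
    and \<psi>_rat: "\<And>i n. \<psi> i n \<in> \<rat>"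
begin

text \<open>This is \<alpha> - \<beta>, so exchanging the roots negates it.\<close>

definition w :: complex where "w = of_real (sqrt (lucas_disc P Q))"

lemma of_real_Rats: "x \<in> \<rat> \<Longrightarrow> complex_of_real x \<in> \<rat>"
  by (auto elim!: Rats_cases)

sublocale quadratic_irrational w
proof
  have "w * w = of_real (lucas_disc P Q)"
    using lucas_admissible_roots(1)[OF adm] by (simp add: w_def flip: of_real_mult)
  moreover have "lucas_disc P Q \<in> \<rat>" using P_rat Q_rat by (simp add: lucas_disc_def)
  ultimately show "w * w \<in> \<rat>" by (simp add: of_real_Rats)
  show "w \<notin> \<rat>"
  proof
    assume "w \<in> \<rat>"
    then obtain a b where "w = of_int a / of_int b" by (auto elim: Rats_cases')
    then have "w = of_real (of_int a / of_int b)" by simp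
    then have "sqrt (lucas_disc P Q) = of_int a / of_int b" unfolding w_def of_real_eq_iff .
    then show False using sqrt_disc_irrational by simp
  qed
qed

lemma conjugate_alpha_beta: "conjugate (of_real \<alpha>) (of_real \<beta>)" "conjugate (of_real \<beta>) (of_real \<alpha>)"
proof -
  have "of_real P / 2 \<in> (\<rat> :: complex set)" using of_real_Rats[OF P_rat] by simp
  moreover have "complex_of_real \<alpha> = of_real P / 2 + 1 / 2 * w" "complex_of_real \<beta> = of_real P / 2 - 1 / 2 * w"
    by (simp_all add: \<alpha>_def \<beta>_def lucas_alpha_def lucas_beta_def w_def add_divide_distrib diff_divide_distrib)
  ultimately show "conjugate (of_real \<alpha>) (of_real \<beta>)" "conjugate (of_real \<beta>) (of_real \<alpha>)"
    using conjugateI[of "of_real P / 2" "1 / 2"] conjugateI[of "of_real P / 2" "- 1 / 2"] by auto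
qed

definition neg_point :: "('d \<Rightarrow> nat) \<Rightarrow> (complex, 'd) vec" where
  "neg_point m = (\<chi> i. - of_nat (m i))"

section \<open>Values at negative integer points\<close>

lemma tail_ratio_neg_point:
  "tail_ratio (neg_point m) l K = of_real (\<alpha> ^ (\<Sum>i\<in>{l..}. m i) * \<rho> ^ K)"
proof -
  have "exp (of_nat (\<Sum>i\<in>{l..}. m i) * of_real (ln \<alpha>)) = (exp (complex_of_real (ln \<alpha>))) ^ (\<Sum>i\<in>{l..}. m i)"
    by (rule exp_of_nat_mult)
  also have "exp (complex_of_real (ln \<alpha>)) = of_real \<alpha>" using alpha_gt_1 exp_of_real[of "ln \<alpha>", where 'a = complex] by simp
  finally show ?thesis
    by (simp add: tail_ratio_def neg_point_def sum_negf mult.commute)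
qed

lemma tail_ratio_neg_point':
  assumes "K \<le> (\<Sum>i\<in>{l..}. m i)"
  shows "tail_ratio (neg_point m) l K = of_real \<alpha> ^ ((\<Sum>i\<in>{l..}. m i) - K) * of_real \<beta> ^ K"
  using assms alpha_gt_1 by (simp add: tail_ratio_neg_point \<rho>_def power_divide power_diff)

lemma tail_sum_pos:
  fixes m :: "'d \<Rightarrow> nat"
  assumes "\<And>i. m i > 0"
  shows "(\<Sum>i\<in>{l..}. m i) > 0"
  using assms[of l] by (simp add: sum_atLeast_split)

text \<open>Conjugation turns \<open>\<alpha> ^ (M - K) * \<beta> ^ K = \<plusminus>1\<close> into \<open>\<beta> ^ (M - K) * \<alpha> ^ K = \<plusminus>1\<close>; multiplying the two
  gives \<open>Q ^ M = 1\<close>.\<close>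

lemma polar_half:
  assumes m: "\<And>i. m i > 0" and polar: "tail_ratio (neg_point m) l K ^ q = 1"
  shows "(\<Sum>i\<in>{l..}. m i) = 2 * K"
    and "tail_ratio (neg_point m) l K = 1 \<or> tail_ratio (neg_point m) l K = - 1"
proof -
  define M where "M = (\<Sum>i\<in>{l..}. m i)"
  define y where "y = \<alpha> ^ M * \<rho> ^ K"
  have y: "tail_ratio (neg_point m) l K = of_real y"
    by (simp add: tail_ratio_neg_point M_def y_def)
  have "norm (tail_ratio (neg_point m) l K) = 1"
    using polar q_pos by (metis norm_one norm_power norm_ge_zero power_eq_1_iff less_numeral_extra(3))
  then have absy: "\<bar>y\<bar> = 1" by (simp add: y)
  \<comment> \<open>The ratio is real at this point, so norm 1 leaves only the two signs.\<close>
  then have ycases: "y = 1 \<or> y = - 1" by linarith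
  then show "tail_ratio (neg_point m) l K = 1 \<or> tail_ratio (neg_point m) l K = - 1"
    by (auto simp: y)
  have eq: "\<alpha> ^ M * \<beta> ^ K = y * \<alpha> ^ K"
    using alpha_gt_1 by (simp add: y_def \<rho>_def power_divide)
  have "conjugate (of_real \<alpha> ^ M * of_real \<beta> ^ K) (of_real \<beta> ^ M * of_real \<alpha> ^ K)"
    by (intro conjugate_mult conjugate_power conjugate_alpha_beta)
  moreover have "conjugate (of_real y * of_real \<alpha> ^ K) (of_real y * of_real \<beta> ^ K)"
    by (intro conjugate_mult conjugate_power conjugate_alpha_beta conjugate_rat) (use ycases in auto)
  moreover have "complex_of_real \<alpha> ^ M * of_real \<beta> ^ K = of_real y * of_real \<alpha> ^ K"
    using arg_cong[OF eq, where f = complex_of_real] by simp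
  ultimately have "complex_of_real \<beta> ^ M * of_real \<alpha> ^ K = of_real y * of_real \<beta> ^ K"
    using conjugate_unique by metis
  then have "complex_of_real (\<beta> ^ M * \<alpha> ^ K) = of_real (y * \<beta> ^ K)" by simp
  then have eq': "\<beta> ^ M * \<alpha> ^ K = y * \<beta> ^ K" by (simp only: of_real_eq_iff)
  have "(\<alpha> ^ M * \<beta> ^ K) * (\<beta> ^ M * \<alpha> ^ K) = (y * \<alpha> ^ K) * (y * \<beta> ^ K)" by (simp only: eq eq')
  then have "(\<alpha> * \<beta>) ^ M * (\<alpha> * \<beta>) ^ K = (y * y) * (\<alpha> * \<beta>) ^ K"
    by (simp add: power_mult_distrib mult_ac)
  moreover have "y * y = 1" using ycases by auto
  moreover have "\<alpha> * \<beta> \<noteq> 0" using alpha_gt_1 beta_nz by simp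
  ultimately have "(\<alpha> * \<beta>) ^ M = 1" by simp
  then have "\<bar>\<alpha> * \<beta>\<bar> ^ M = 1" by (metis abs_one power_abs)
  moreover have "M > 0" unfolding M_def by (rule tail_sum_pos[OF m])
  ultimately have "\<bar>\<alpha> * \<beta>\<bar> = 1" using power_eq_1_iff[of "\<bar>\<alpha> * \<beta>\<bar>" M] by auto
  then have ab: "\<alpha> * \<bar>\<beta>\<bar> = 1" using alpha_gt_1 by (simp add: abs_mult)
  \<comment> \<open>Since \<bar>\<beta>\<bar> is now the inverse of \<alpha>, this compares powers
    of \<alpha> alone, and \<alpha> > 1.\<close>
  have "\<alpha> ^ M * \<bar>\<beta>\<bar> ^ K = \<alpha> ^ K"
    using arg_cong[OF eq, where f = abs] absy alpha_gt_1 by (simp add: abs_mult power_abs)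
  then have "\<alpha> ^ M * (\<alpha> * \<bar>\<beta>\<bar>) ^ K = \<alpha> ^ K * \<alpha> ^ K" by (simp add: power_mult_distrib mult_ac)
  then have "\<alpha> ^ M = \<alpha> ^ (2 * K)" by (simp add: ab power_add mult_2)
  then show "(\<Sum>i\<in>{l..}. m i) = 2 * K"
    using power_inject_exp[OF alpha_gt_1] by (simp add: M_def)
qed

text \<open>On a polar divisor, \<open>- y ^ b * b / q\<close> is the value at \<open>e = y\<close> of \<open>num / den\<close>, that is, of
  \<open>(y ^ b - e ^ b) / (1 - y ^ q)\<close> with the common factor cancelled.\<close>

definition value_factor :: "('d \<Rightarrow> nat) \<Rightarrow> 'd \<Rightarrow> nat \<Rightarrow> nat \<Rightarrow> complex" where
  "value_factor m l K b = (let y = tail_ratio (neg_point m) l K in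
    if y ^ q = 1 then - (y ^ b * of_nat b / of_nat q) else y ^ b / (1 - y ^ q))"

text \<open>The reduced denominators are nonzero at the point, so the cleared identity can be
  divided by them there; with the plain ones this fails as soon as a polar divisor passes through
  it.\<close>

theorem value_formula:
  assumes m: "\<And>i. m i > 0"
    and nonsing: "\<not> singularity_multi (multiple_lucas_L P Q \<psi>) (neg_point m)"
  shows "multiple_lucas_L P Q \<psi> (neg_point m) = disc_factor (neg_point m) *
    (\<Sum>k\<in>PiE UNIV (\<lambda>i. {..m i}). binom_coeff (neg_point m) k *
      (\<Sum>b\<in>residues. coef b * (\<Prod>l\<in>UNIV. value_factor m l (\<Sum>i\<in>{l..}. k i) (b l))))"
proof -
  let ?s = "neg_point m" and ?F = "multiple_lucas_L P Q \<psi>"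
  have hol: "holomorphic_multi_at ?F ?s"
    using multiple_lucas_L_nice nonsing unfolding nicely_meromorphic_multi_on_def by auto
  \<comment> \<open>\<open>p\<close> selects the polar divisors through this very point and
    \<open>e\<close> records their signs, with default 1 elsewhere.\<close>
  define p where "p l K \<longleftrightarrow> tail_ratio ?s l K ^ q = 1" for l K
  define e where "e l K = (if p l K then tail_ratio ?s l K else 1)" for l K
  have p_half: "(\<Sum>i\<in>{l..}. m i) = 2 * K" if "p l K" for l K
    using polar_half(1)[OF m] that by (simp add: p_def)
  have e_cases: "e l K = 1 \<or> e l K = - 1" for l K
    using polar_half(2)[OF m] by (auto simp: e_def p_def)
  then have e_norm: "norm (e l K) = 1" and e_sq: "e l K * e l K = 1" for l K
    by (metis norm_minus_cancel norm_one, metis mult_1 mult_minus1 minus_minus)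
  have e_q: "e l K ^ q = 1" for l K by (simp add: e_def p_def)
  have vanish: "residue_vanishes l (e l K)" if "p l K" for l K
  proof -
    have "residue_vanishes l (tail_ratio ?s l K)"
    proof (rule nonsingular_imp_residue_vanishes[OF hol])
      show "tail_ratio ?s l K ^ q = 1" using that by (simp add: p_def)
      show "(\<Sum>i\<in>{l..}. ?s $ i) = - of_real (real (\<Sum>i\<in>{l..}. m i))"
        by (simp add: neg_point_def sum_negf)
      show "real K \<le> real (\<Sum>i\<in>{l..}. m i)" using p_half[OF that] by simp
    qed
    then show ?thesis using that by (simp add: e_def)
  qed
  define r where "r = norm ?s + norm (\<chi> i. 1 :: (complex, 'd) vec) + 1"
  have r0: "r \<ge> 0" and r_s: "?s \<in> ball 0 r" and r_1: "r > norm (\<chi> i. 1 :: (complex, 'd) vec)"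
    by (simp_all add: r_def add_nonneg_nonneg add_nonneg_pos)
  \<comment> \<open>A polar exponent is half of a tail sum of \<open>m\<close>, so this cutoff lies
    beyond all of them.\<close>
  obtain N where NM: "(\<Sum>i\<in>UNIV. m i) \<le> N" and N: "growth r * \<bar>\<rho>\<bar> ^ Suc N \<le> 1 / 2"
    by (rule large_cutoff_exists)
  have pN: "K \<le> N" if "p l K" for l K
  proof -
    have "(\<Sum>i\<in>{l..}. m i) \<le> (\<Sum>i\<in>UNIV. m i)" by (rule sum_mono2) auto
    then show ?thesis using p_half[OF that] NM by simp
  qed
  obtain V where V: "open V" "?s \<in> V" "holomorphic_multi_on ?F V"
    using hol unfolding holomorphic_multi_at_def by blast
  have "?F ?s * denom p e N ?s = numer p e N ?s"
  proof (rule continuation_times_denominator[OF multiple_lucas_L_dense V(1,3) open_ball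
        holomorphic_numer[OF r0 e_norm pN N] holomorphic_denom plain_denom_dense[OF r_1]
        holomorphic_multi_on_continuous[OF holomorphic_denom] _ V(2) r_s])
    fix s assume s: "s \<in> ball 0 r" "plain_denom N s \<noteq> 0"
    have yq: "tail_ratio s l K ^ q \<noteq> 1" for l K by (rule plain_denom_nonzero[OF s(1) N s(2)])
    have mult_den: "(1 - e l K * tail_ratio s l K) * den p e s l K = 1 - tail_ratio s l K ^ q"
      if "p l K" for l K
      using that q_integer_mult[of "e l K * tail_ratio s l K" q] e_q[of l K]
      by (simp add: den_def power_mult_distrib)
    show "continuation s * denom p e N s = numer p e N s"
    proof (rule continuation_times_denom)
      show "den p e s l K \<noteq> 0" for l K
        using mult_den[of l K] yq[of l K] by (cases "p l K") (auto simp: den_def)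
      fix k :: "'d \<Rightarrow> nat"
      let ?K = "\<lambda>l. \<Sum>i\<in>{l..}. k i"
      let ?y = "\<lambda>l. tail_ratio s l (?K l)"
      let ?J = "{l. p l (?K l)}"
      have "(\<Sum>b\<in>residues. coef b * (\<Prod>l\<in>UNIV. ?y l ^ b l / (1 - ?y l ^ q))) =
        (\<Sum>b\<in>residues. coef b * (\<Prod>l\<in>UNIV. if l \<in> ?J then ?y l ^ b l / (1 - ?y l ^ q) -
          1 / (1 - ?y l ^ q) * e l (?K l) ^ b l else ?y l ^ b l / (1 - ?y l ^ q)))"
        by (rule drop_polar_parts[of ?J "\<lambda>l. e l (?K l)" "\<lambda>l n. ?y l ^ n / (1 - ?y l ^ q)"])
           (use vanish in auto)
      also have "\<dots> = (\<Sum>b\<in>residues. coef b * (\<Prod>l\<in>UNIV. num p e s l (?K l) (b l) / den p e s l (?K l)))"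
      proof (intro sum.cong prod.cong arg_cong2[of _ _ _ _ "(*)"] refl)
        fix b l
        show "(if l \<in> ?J then ?y l ^ b l / (1 - ?y l ^ q) - 1 / (1 - ?y l ^ q) * e l (?K l) ^ b l
            else ?y l ^ b l / (1 - ?y l ^ q)) = num p e s l (?K l) (b l) / den p e s l (?K l)"
        proof (cases "p l (?K l)")
          case True
          define \<epsilon> y where "\<epsilon> = e l (?K l)" and "y = ?y l"
          define n where "n = b l"
          have \<epsilon>: "\<epsilon> * \<epsilon> = 1" using e_sq by (simp add: \<epsilon>_def)
          have d: "(1 - \<epsilon> * y) * den p e s l (?K l) = 1 - y ^ q"
            using mult_den[OF True] by (simp add: \<epsilon>_def y_def)
          have nz: "1 - y ^ q \<noteq> 0" using yq by (simp add: y_def)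
          \<comment> \<open>A sign is its own inverse; this turns the geometric sum in
            \<open>\<epsilon> * y\<close> into a factorisation of
            \<open>\<epsilon> ^ n - y ^ n\<close>.\<close>
          have "\<epsilon> ^ n * (\<epsilon> * y) ^ n = y ^ n"
            using \<epsilon> by (simp flip: power_mult_distrib mult.assoc)
          then have "(1 - \<epsilon> * y) * (\<epsilon> ^ n * q_integer n (\<epsilon> * y)) = \<epsilon> ^ n - y ^ n"
            using q_integer_mult[of "\<epsilon> * y" n]
            by (simp add: mult.left_commute[of _ "\<epsilon> ^ n"] right_diff_distrib)
          moreover have nn: "num p e s l (?K l) n = - (\<epsilon> ^ n * q_integer n (\<epsilon> * y))"
            using True by (simp add: num_def \<epsilon>_def y_def)
          ultimately have "(1 - \<epsilon> * y) * num p e s l (?K l) n = y ^ n - \<epsilon> ^ n"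
            by (simp add: nn)
          moreover have "1 - \<epsilon> * y \<noteq> 0" using d nz by auto
          ultimately have "num p e s l (?K l) n / den p e s l (?K l) = (y ^ n - \<epsilon> ^ n) / (1 - y ^ q)"
            unfolding d[symmetric] by (metis mult_divide_mult_cancel_left)
          then show ?thesis using True by (simp add: \<epsilon>_def y_def n_def diff_divide_distrib)
        qed (simp add: num_def den_def)
      qed
      finally show "(\<Sum>b\<in>residues. coef b * (\<Prod>l\<in>UNIV. ?y l ^ b l / (1 - ?y l ^ q))) =
        (\<Sum>b\<in>residues. coef b * (\<Prod>l\<in>UNIV. num p e s l (?K l) (b l) / den p e s l (?K l)))" .
    qed
  qed
  moreover have den_nz: "den p e ?s l K \<noteq> 0" for l K
  proof (cases "p l K")
    case True
    then have "e l K * tail_ratio ?s l K = 1" using e_sq[of l K] by (simp add: e_def)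
    then show ?thesis using True q_pos by (simp add: den_def q_integer_def)
  qed (simp add: den_def p_def)
  have vf: "num p e ?s l K b / den p e ?s l K = value_factor m l K b" for l K b
  proof (cases "p l K")
    case True
    \<comment> \<open>At argument 1 the two geometric sums have the values b and q, whence the
      quotient b / q in \<open>value_factor\<close>.\<close>
    then have "e l K * tail_ratio ?s l K = 1" using e_sq[of l K] by (simp add: e_def)
    then show ?thesis using True
      by (simp add: num_def den_def q_integer_def value_factor_def e_def Let_def) (simp add: p_def)
  qed (simp add: num_def den_def value_factor_def p_def Let_def)
  define t where "t k = binom_coeff ?s k *
      (\<Sum>b\<in>residues. coef b * (\<Prod>l\<in>UNIV. value_factor m l (\<Sum>i\<in>{l..}. k i) (b l)))" for k
  have "numer p e N ?s = disc_factor ?s * (\<Sum>\<^sub>\<infinity>k. denom p e N ?s * t k)"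
    unfolding numer_def t_def
  proof (rule arg_cong2[of _ _ _ _ "(*)", OF refl], rule infsum_cong)
    fix k :: "'d \<Rightarrow> nat"
    show "binom_coeff ?s k * (\<Sum>b\<in>residues. coef b *
          (\<Prod>l\<in>UNIV. cleared p e N ?s l (\<Sum>i\<in>{l..}. k i) (b l))) =
        denom p e N ?s * (binom_coeff ?s k * (\<Sum>b\<in>residues. coef b *
          (\<Prod>l\<in>UNIV. value_factor m l (\<Sum>i\<in>{l..}. k i) (b l))))"
      unfolding denom_mult_fraction[OF den_nz, symmetric] vf prod.distrib denom_def
      by (simp add: sum_distrib_left mult_ac)
  qed
  moreover have "denom p e N ?s \<noteq> 0" using den_nz by (simp add: denom_def)
  ultimately have "?F ?s = disc_factor ?s * (\<Sum>\<^sub>\<infinity>k. t k)"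
    unfolding infsum_cmult_right' by simp
  also have "(\<Sum>\<^sub>\<infinity>k. t k) = infsum t (PiE UNIV (\<lambda>i. {..m i}))"
  proof (rule infsum_cong_neutral)
    fix k assume "k \<in> UNIV - PiE UNIV (\<lambda>i. {..m i})"
    then obtain i where "m i < k i" by (auto simp: PiE_iff not_le)
    \<comment> \<open>Up to sign this is the ordinary binomial coefficient (m i over k i).\<close>
    then have "negbin (?s $ i) (k i) = 0"
      by (simp add: neg_point_def negbin_gbinomial flip: binomial_gbinomial)
    then have "binom_coeff ?s k = 0" unfolding binom_coeff_def by (intro prod_zero) auto
    then show "t k = 0" by (simp add: t_def)
  qed auto
  also have "\<dots> = (\<Sum>k\<in>PiE UNIV (\<lambda>i. {..m i}). t k)"
    by (intro infsum_finite finite_PiE) auto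
  finally show ?thesis unfolding t_def .
qed

text \<open>With M the tail sum, \<open>\<alpha> ^ (M - K) * \<beta> ^ K\<close> and its analogue
  for M - K are conjugate. A polar K is half of M, hence its own mirror image, and there the factor
  is rational.\<close>

lemma conjugate_value_factor:
  assumes m: "\<And>i. m i > 0" and K: "K \<le> (\<Sum>i\<in>{l..}. m i)"
  shows "conjugate (value_factor m l K b) (value_factor m l ((\<Sum>i\<in>{l..}. m i) - K) b)"
proof -
  define M where "M = (\<Sum>i\<in>{l..}. m i)"
  define y y' where "y = tail_ratio (neg_point m) l K" and "y' = tail_ratio (neg_point m) l (M - K)"
  have KM: "K \<le> M" using K by (simp add: M_def)
  have "y = of_real \<alpha> ^ (M - K) * of_real \<beta> ^ K"
    unfolding y_def M_def by (rule tail_ratio_neg_point'[OF K])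
  moreover have "y' = of_real \<beta> ^ (M - K) * of_real \<alpha> ^ K"
    unfolding y'_def using tail_ratio_neg_point'[of "M - K" m l] KM by (simp add: M_def mult.commute)
  ultimately have yy': "conjugate y y'"
    by (auto intro!: conjugate_mult conjugate_power conjugate_alpha_beta)
  show ?thesis
  proof (cases "y ^ q = 1")
    case True
    then have "M = 2 * K" unfolding y_def M_def by (rule polar_half(1)[OF m])
    then have half: "(\<Sum>i\<in>{l..}. m i) - K = K" by (simp add: M_def)
    have "y = 1 \<or> y = - 1" using polar_half(2)[OF m] True by (simp add: y_def)
    then have "y \<in> \<rat>" by auto
    then have "- (y ^ b * of_nat b / of_nat q) \<in> \<rat>"
      by (intro Rats_minus_iff[THEN iffD2] Rats_divide Rats_mult Rats_power Rats_of_nat)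
    then have "value_factor m l K b \<in> \<rat>"
      using True by (simp add: value_factor_def y_def Let_def)
    then show ?thesis unfolding half by (rule conjugate_rat)
  next
    case False
    have "y' ^ q \<noteq> 1"
    proof
      assume "y' ^ q = 1"
      then have "(\<Sum>i\<in>{l..}. m i) = 2 * (M - K)" unfolding y'_def by (rule polar_half(1)[OF m])
      then have "M = 2 * (M - K)" by (simp only: M_def)
      then have "M - K = K" using KM by linarith
      then show False using \<open>y' ^ q = 1\<close> False by (simp add: y_def y'_def)
    qed
    moreover have "conjugate (y ^ b / (1 - y ^ q)) (y' ^ b / (1 - y' ^ q))"
      by (intro conjugate_divide conjugate_diff conjugate_power conjugate_rat yy') (use False in auto)
    ultimately show ?thesis
      using False unfolding M_def[symmetric] by (simp add: value_factor_def y_def y'_def Let_def)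
  qed
qed

text \<open>Two signs have to cancel: conjugation multiplies \<open>1 / w ^ ?n\<close> by
  \<open>(- 1) ^ ?n\<close>, and the reflection of k to m - k multiplies the binomial coefficients
  \<open>c k\<close> by the same sign.\<close>

theorem value_rational:
  assumes m: "\<And>i. m i > 0"
    and nonsing: "\<not> singularity_multi (multiple_lucas_L P Q \<psi>) (neg_point m)"
  shows "multiple_lucas_L P Q \<psi> (neg_point m) \<in> \<rat>"
proof -
  let ?A = "PiE UNIV (\<lambda>i. {..m i})" and ?n = "\<Sum>i\<in>UNIV. m i"
  define c where "c k = (\<Prod>i\<in>UNIV. (- 1) ^ k i * complex_of_nat (m i choose k i))" for k
  define S where "S k = (\<Sum>b\<in>residues. coef b * (\<Prod>l\<in>UNIV. value_factor m l (\<Sum>i\<in>{l..}. k i) (b l)))" for k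
  have "binom_coeff (neg_point m) k = c k" for k
    by (simp add: binom_coeff_def c_def neg_point_def negbin_gbinomial binomial_gbinomial)
  moreover have "disc_factor (neg_point m) = 1 / w ^ ?n"
  proof -
    have "disc_factor (neg_point m) = inverse (exp (of_nat ?n * of_real (ln (\<alpha> - \<beta>))))"
      by (simp add: disc_factor_def neg_point_def sum_negf exp_minus mult.commute flip: of_nat_sum)
    also have "exp (of_nat ?n * of_real (ln (\<alpha> - \<beta>))) = exp (complex_of_real (ln (\<alpha> - \<beta>))) ^ ?n"
      by (rule exp_of_nat_mult)
    also have "exp (complex_of_real (ln (\<alpha> - \<beta>))) = w"
      using lucas_admissible_roots(1,6)[OF adm] exp_of_real[of "ln (\<alpha> - \<beta>)", where 'a = complex]
      by (simp add: w_def \<alpha>_def \<beta>_def)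
    finally show ?thesis by (simp add: divide_inverse)
  qed
  ultimately have val: "multiple_lucas_L P Q \<psi> (neg_point m) = 1 / w ^ ?n * (\<Sum>k\<in>?A. c k * S k)"
    unfolding value_formula[OF m nonsing] S_def by simp
  have flip_sum: "(\<Sum>i\<in>{l..}. m i - k i) = (\<Sum>i\<in>{l..}. m i) - (\<Sum>i\<in>{l..}. k i)" if "k \<in> ?A" for k l
    using that by (intro sum_subtractf_nat) (auto simp: PiE_iff)
  have S: "conjugate (S k) (S (\<lambda>i. m i - k i))" if k: "k \<in> ?A" for k
    unfolding S_def flip_sum[OF k]
  proof (intro conjugate_sum conjugate_mult conjugate_prod conjugate_value_factor m)
    show "conjugate (coef b) (coef b)" for b
      unfolding coef_def by (intro conjugate_prod conjugate_rat \<psi>_rat)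
    show "(\<Sum>i\<in>{l..}. k i) \<le> (\<Sum>i\<in>{l..}. m i)" for l
      by (rule sum_mono) (use k in \<open>auto simp: PiE_iff\<close>)
  qed
  have w0: "w \<noteq> 0" using irrational by auto
  have "conjugate (1 / w ^ ?n * (\<Sum>k\<in>?A. c k * S k))
      (1 / (- w) ^ ?n * (\<Sum>k\<in>?A. c k * S (\<lambda>i. m i - k i)))"
    by (intro conjugate_sum conjugate_mult conjugate_inverse conjugate_power conjugate_gen S conjugate_rat)
       (auto simp: c_def w0 intro!: Rats_prod)
  also have "(\<Sum>k\<in>?A. c k * S (\<lambda>i. m i - k i)) = (\<Sum>k\<in>?A. c (\<lambda>i. m i - k i) * S k)"
    by (rule sum.reindex_bij_witness[of _ "\<lambda>k i. m i - k i" "\<lambda>k i. m i - k i"])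
       (auto simp: PiE_iff)
  also have "\<dots> = (\<Sum>k\<in>?A. (- 1) ^ ?n * (c k * S k))"
  proof (rule sum.cong[OF refl])
    fix k assume k: "k \<in> ?A"
    have "(- 1) ^ (m i - k i) * complex_of_nat (m i choose (m i - k i)) =
        (- 1) ^ m i * ((- 1) ^ k i * complex_of_nat (m i choose k i))" for i
    proof -
      have "k i \<le> m i" using k by (auto simp: PiE_iff)
      moreover from this have "(- 1 :: complex) ^ m i = (- 1) ^ (m i - k i) * (- 1) ^ k i"
        by (simp flip: power_add)
      ultimately show ?thesis by (simp flip: binomial_symmetric power_mult_distrib mult.assoc)
    qed
    then have "c (\<lambda>i. m i - k i) = (- 1) ^ ?n * c k"
      by (simp add: c_def prod.distrib power_sum)
    then show "c (\<lambda>i. m i - k i) * S k = (- 1) ^ ?n * (c k * S k)" by simp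
  qed
  also have "1 / (- w) ^ ?n * (\<Sum>k\<in>?A. (- 1) ^ ?n * (c k * S k)) = 1 / w ^ ?n * (\<Sum>k\<in>?A. c k * S k)"
    unfolding sum_distrib_left[symmetric] power_minus[of w] by simp
  finally show ?thesis unfolding val by (rule conjugate_self)
qed

end

text \<open>The values 0, 1 and - 1 are rational, so conjugation fixes the characters, and they are
  bounded by 1.\<close>

lemma quadratic_character_values:
  assumes "quadratic_character q \<psi>"
  shows "\<psi> n = 0 \<or> \<psi> n = 1 \<or> \<psi> n = - 1" "\<psi> (n mod q) = \<psi> n"
proof -
  have per: "\<psi> (n + q) = \<psi> n" for n
    using assms by (simp add: quadratic_character_def dirichlet_character_def)
  have "\<psi> (a + k * q) = \<psi> a" for a k
    by (induction k) (use per in \<open>simp_all add: add.assoc[symmetric] add.commute[of q]\<close>)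
  from this[of "n mod q" "n div q"] show "\<psi> (n mod q) = \<psi> n" by simp
  show "\<psi> n = 0 \<or> \<psi> n = 1 \<or> \<psi> n = - 1"
    using assms by (auto simp: quadratic_character_def dirichlet_character_def power2_eq_1_iff)
qed

theorem theorem15:
  fixes P Q :: real and q :: nat
    and m :: "'d::{finite,linorder} \<Rightarrow> nat"
    and \<psi> :: "'d \<Rightarrow> nat \<Rightarrow> complex"
  assumes "lucas_admissible P Q"
    and "P \<in> \<rat>" and "Q \<in> \<rat>"
    and "sqrt (lucas_disc P Q) \<notin> \<rat>"
    and "q \<ge> 2"
    and "\<And>i. quadratic_character q (\<psi> i)"
    and "\<And>i. m i > 0"
    and "\<not> singularity_multi (multiple_lucas_L P Q \<psi>) (\<chi> i. - of_nat (m i))"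
  shows "multiple_lucas_L P Q \<psi> (\<chi> i. - of_nat (m i)) \<in> \<rat>"
proof -
  interpret lucas_L_rational P Q q \<psi>
  proof
    fix i n
    note \<psi> = quadratic_character_values[OF assms(6)[of i], of n]
    show "\<psi> i (n mod q) = \<psi> i n" by (rule \<psi>(2))
    show "norm (\<psi> i n) \<le> 1" "\<psi> i n \<in> \<rat>" using \<psi>(1) by auto
  qed (use assms in auto)
  show ?thesis
    using value_rational[OF assms(7)] assms(8) by (simp add: neg_point_def)
qed

end
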